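(* Let $\mathbf{X}=L^{1}(\mathbb{R}^{d},dv)$, $\gamma\in(-d,0)$ and $b\in L^{1}(\mathbb{S}^{d-1})$, and let $(V(t))_{t\ge0}$ be the $C_0$-semigroup generated by the linear Boltzmann operator $\mathcal{L}$ in $\mathbf{X}$. Let $f\in\mathrm{Ker}(\mathcal{L})\oplus\mathrm{Im}(\mathcal{L})$ be nonnegative and $\varrho_f=\int_{\mathbb{R}^d}f(v)\,dv$. Then, for any $c\in(0,1)$, $$\|V(t)f-\varrho_f\,\mathcal{M}\|_{\mathbf{X}}=\mathrm{O}\left(\vartheta_{\log}^{-1}(ct)\right)\qquad\text{as } t\to\infty,$$ where $\vartheta_{\log}^{-1}$ is the inverse of the strictly decreasing mapping $\vartheta_{\log}:r>0\mapsto\vartheta(r)\log\left(1+\frac{\vartheta(r)}{r}\right)$ and $$\vartheta(r)=\frac{1}{r}\,\frac{1}{1-\frac{\Sigma_{\max}}{\sqrt{r^{2}+\Sigma_{\max}^{2}}}},\qquad \Sigma_{\max}=\sup_{v\in\mathbb{R}^{d}}\Sigma(v).$$ In particular, for any $\varepsilon>0$ there exists $C=C(f,\varepsilon)>0$ such that $$\|V(t)f-\varrho_f\,\mathcal{M}\|_{\mathbf{X}}\le C(1+t)^{-\frac{1}{3+\varepsilon}}\qquad\forall t\ge 0.$$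
   Context: Let $d\ge 2$ and $\mathcal{M}(v)=(2\pi)^{-d/2}\exp(-|v|^2/2)$, $v\in\mathbb{R}^d$. For $v,v_*\in\mathbb{R}^d$ and $\sigma\in\mathbb{S}^{d-1}$ set $v'=\frac{v+v_*}{2}+\frac{|v-v_*|}{2}\sigma$, $v_*'=\frac{v+v_*}{2}-\frac{|v-v_*|}{2}\sigma$ and $\cos\theta=\left\langle \frac{v-v_*}{|v-v_*|},\sigma\right\rangle$. The angular kernel $b:[-1,1]\to[0,\infty)$ is measurable; $b\in L^1(\mathbb{S}^{d-1})$ means $\ell_b=\int_{\mathbb{S}^{d-1}}b(\cos\theta)\,d\sigma<\infty$ (this integral does not depend on $v,v_*$), and it is assumed that $\ell_b>0$. The collision kernel is $B(v-v_*,\sigma)=|v-v_*|^{\gamma}b(\cos\theta)$. Define the gain operator $Kf(v)=\int_{\mathbb{R}^d\times\mathbb{S}^{d-1}}B(v-v_*,\sigma)f(v')\mathcal{M}(v_*')\,dv_*\,d\sigma$, the collision frequency $\Sigma(v)=\int_{\mathbb{R}^d\times\mathbb{S}^{d-1}}B(v-v_*,\sigma)\mathcal{M}(v_* )\,dv_*\,d\sigma=\ell_b\int_{\mathbb{R}^d}|v-v_*|^{\gamma}\mathcal{M}(v_* )\,dv_*$, and the linear Boltzmann operator $\mathcal{L}f=Kf-\Sigma f$. For $\gamma\in(-d,0)$, $\Sigma$ is bounded and $\mathcal{L}$ is a bounded operator on $L^1(\mathbb{R}^d,dv)$, with domain the whole space. *)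

theory Defs
  imports "HOL-Analysis.Analysis" "HOL-Library.Landau_Symbols"
begin

text \<open>Surface measure of the unit sphere as the cone measure: a Borel set \<open>E\<close> of the sphere
  gets mass \<open>d \<cdot> |{x. 0 < |x| \<le> 1, x / |x| \<in> E}|\<close>, which is the normalisation for which
  \<open>dx = r\<^sup>d\<^sup>-\<^sup>1 dr d\<sigma>\<close> in polar coordinates.\<close>

definition sphere_measure :: "'a::euclidean_space measure" where
  "sphere_measure = scale_measure (of_nat DIM('a))
     (distr (restrict_space lborel (cball 0 1 - {0})) (restrict_space borel (sphere 0 1))
        (\<lambda>x. x /\<^sub>R norm x))"

definition maxwellian :: "'a::euclidean_space \<Rightarrow> real" where
  "maxwellian v = (2 * pi) powr (- real DIM('a) / 2) * exp (- (norm v)\<^sup>2 / 2)"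

definition post_velocity :: "'a::euclidean_space \<Rightarrow> 'a \<Rightarrow> 'a \<Rightarrow> 'a" where
  "post_velocity v w \<sigma> = (v + w) /\<^sub>R 2 + (norm (v - w) / 2) *\<^sub>R \<sigma>"

definition post_velocity_star :: "'a::euclidean_space \<Rightarrow> 'a \<Rightarrow> 'a \<Rightarrow> 'a" where
  "post_velocity_star v w \<sigma> = (v + w) /\<^sub>R 2 - (norm (v - w) / 2) *\<^sub>R \<sigma>"

definition cos_deviation :: "'a::euclidean_space \<Rightarrow> 'a \<Rightarrow> 'a \<Rightarrow> real" where
  "cos_deviation v w \<sigma> = ((v - w) /\<^sub>R norm (v - w)) \<bullet> \<sigma>"

text \<open>\<open>\<ell>\<^sub>b\<close>, computed from a pair \<open>v \<noteq> w\<close> of reference velocities (on which it does not depend).\<close>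

definition angular_mass :: "(real \<Rightarrow> real) \<Rightarrow> 'a::euclidean_space \<Rightarrow> 'a \<Rightarrow> ennreal" where
  "angular_mass b v w = (\<integral>\<^sup>+\<sigma>. ennreal (b (cos_deviation v w \<sigma>)) \<partial>sphere_measure)"

definition collision_kernel ::
    "real \<Rightarrow> (real \<Rightarrow> real) \<Rightarrow> 'a::euclidean_space \<Rightarrow> 'a \<Rightarrow> 'a \<Rightarrow> real" where
  "collision_kernel \<gamma> b v w \<sigma> = norm (v - w) powr \<gamma> * b (cos_deviation v w \<sigma>)"

definition gain :: "real \<Rightarrow> (real \<Rightarrow> real) \<Rightarrow> ('a::euclidean_space \<Rightarrow> real) \<Rightarrow> 'a \<Rightarrow> real" where
  "gain \<gamma> b f v = (\<integral>(w, \<sigma>). collision_kernel \<gamma> b v w \<sigma> *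
      f (post_velocity v w \<sigma>) * maxwellian (post_velocity_star v w \<sigma>)
      \<partial>(lborel \<Otimes>\<^sub>M sphere_measure))"

definition collision_frequency :: "real \<Rightarrow> (real \<Rightarrow> real) \<Rightarrow> 'a::euclidean_space \<Rightarrow> real" where
  "collision_frequency \<gamma> b v = (\<integral>(w, \<sigma>). collision_kernel \<gamma> b v w \<sigma> * maxwellian w
      \<partial>(lborel \<Otimes>\<^sub>M sphere_measure))"

definition linear_boltzmann ::
    "real \<Rightarrow> (real \<Rightarrow> real) \<Rightarrow> ('a::euclidean_space \<Rightarrow> real) \<Rightarrow> 'a \<Rightarrow> real" where
  "linear_boltzmann \<gamma> b f = (\<lambda>v. gain \<gamma> b f v - collision_frequency \<gamma> b v * f v)"

definition Sigma_max :: "'a::euclidean_space itself \<Rightarrow> real \<Rightarrow> (real \<Rightarrow> real) \<Rightarrow> real" where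
  "Sigma_max _ \<gamma> b = (SUP v::'a. collision_frequency \<gamma> b v)"

text \<open>Elements of \<open>L\<^sup>1\<close> are represented by integrable functions. Operators act on representatives,
  and every identity between elements of \<open>L\<^sup>1\<close> is an almost-everywhere identity.\<close>

definition L1 :: "('a::euclidean_space \<Rightarrow> real) set" where
  "L1 = {f. integrable lborel f}"

definition L1_norm :: "('a::euclidean_space \<Rightarrow> real) \<Rightarrow> real" where
  "L1_norm f = (\<integral>v. \<bar>f v\<bar> \<partial>lborel)"

definition L1_eq :: "('a::euclidean_space \<Rightarrow> real) \<Rightarrow> ('a \<Rightarrow> real) \<Rightarrow> bool" where
  "L1_eq f g \<longleftrightarrow> (AE v in lborel. f v = g v)"

text \<open>The norm bound together with additivity makes such an operator respect \<^const>\<open>L1_eq\<close>.\<close>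

definition L1_bounded_linear ::
    "(('a::euclidean_space \<Rightarrow> real) \<Rightarrow> ('a \<Rightarrow> real)) \<Rightarrow> bool" where
  "L1_bounded_linear T \<longleftrightarrow>
     (\<forall>f\<in>L1. T f \<in> L1) \<and>
     (\<forall>f\<in>L1. \<forall>g\<in>L1. L1_eq (T (\<lambda>v. f v + g v)) (\<lambda>v. T f v + T g v)) \<and>
     (\<forall>a. \<forall>f\<in>L1. L1_eq (T (\<lambda>v. a * f v)) (\<lambda>v. a * T f v)) \<and>
     (\<exists>C. \<forall>f\<in>L1. L1_norm (T f) \<le> C * L1_norm f)"

definition C0_semigroup ::
    "(real \<Rightarrow> ('a::euclidean_space \<Rightarrow> real) \<Rightarrow> ('a \<Rightarrow> real)) \<Rightarrow> bool" where
  "C0_semigroup V \<longleftrightarrow>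
     (\<forall>t\<ge>0. L1_bounded_linear (V t)) \<and>
     (\<forall>f\<in>L1. L1_eq (V 0 f) f) \<and>
     (\<forall>s\<ge>0. \<forall>t\<ge>0. \<forall>f\<in>L1. L1_eq (V (s + t) f) (V s (V t f))) \<and>
     (\<forall>f\<in>L1. ((\<lambda>t. L1_norm (\<lambda>v. V t f v - f v)) \<longlongrightarrow> 0) (at_right 0))"

definition generator_graph ::
    "(real \<Rightarrow> ('a::euclidean_space \<Rightarrow> real) \<Rightarrow> ('a \<Rightarrow> real)) \<Rightarrow>
     (('a \<Rightarrow> real) \<times> ('a \<Rightarrow> real)) set" where
  "generator_graph V = {(f, g). f \<in> L1 \<and> g \<in> L1 \<and>
     ((\<lambda>t. L1_norm (\<lambda>v. (V t f v - f v) / t - g v)) \<longlongrightarrow> 0) (at_right 0)}"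

text \<open>The operator \<open>A\<close>, with domain all of \<open>L\<^sup>1\<close>, is the generator of \<open>V\<close>.\<close>

definition generated_by ::
    "(real \<Rightarrow> ('a::euclidean_space \<Rightarrow> real) \<Rightarrow> ('a \<Rightarrow> real)) \<Rightarrow>
     (('a \<Rightarrow> real) \<Rightarrow> ('a \<Rightarrow> real)) \<Rightarrow> bool" where
  "generated_by V A \<longleftrightarrow> generator_graph V = {(f, g). f \<in> L1 \<and> g \<in> L1 \<and> L1_eq g (A f)}"

definition L1_ker :: "(('a::euclidean_space \<Rightarrow> real) \<Rightarrow> ('a \<Rightarrow> real)) \<Rightarrow> ('a \<Rightarrow> real) set" where
  "L1_ker A = {h \<in> L1. L1_eq (A h) (\<lambda>v. 0)}"

definition L1_im :: "(('a::euclidean_space \<Rightarrow> real) \<Rightarrow> ('a \<Rightarrow> real)) \<Rightarrow> ('a \<Rightarrow> real) set" where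
  "L1_im A = {u \<in> L1. \<exists>g\<in>L1. L1_eq u (A g)}"

definition L1_sum :: "('a::euclidean_space \<Rightarrow> real) set \<Rightarrow> ('a \<Rightarrow> real) set \<Rightarrow> ('a \<Rightarrow> real) set" where
  "L1_sum S T = {f \<in> L1. \<exists>h\<in>S. \<exists>u\<in>T. L1_eq f (\<lambda>v. h v + u v)}"

text \<open>In the following, \<open>S\<close> stands for \<open>\<Sigma>\<^sub>m\<^sub>a\<^sub>x\<close>. For \<open>S > 0\<close> the map \<open>vartheta_log S\<close> is a decreasing
  bijection of \<open>(0,\<infinity>)\<close> onto itself, so its inverse is meaningful at every positive argument.\<close>

definition vartheta :: "real \<Rightarrow> real \<Rightarrow> real" where
  "vartheta S r = (1 / r) * (1 / (1 - S / sqrt (r\<^sup>2 + S\<^sup>2)))"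

definition vartheta_log :: "real \<Rightarrow> real \<Rightarrow> real" where
  "vartheta_log S r = vartheta S r * ln (1 + vartheta S r / r)"

definition vartheta_log_inv :: "real \<Rightarrow> real \<Rightarrow> real" where
  "vartheta_log_inv S = the_inv_into {0<..} (vartheta_log S)"

end

theory Submission
  imports Defs "HOL-Probability.Distributions"
begin

text \<open>
  Let \<open>S = \<Sigma>\<^sub>m\<^sub>a\<^sub>x\<close>. Then \<open>L = S (P - 1)\<close> with an \<open>L\<^sup>1\<close>-contraction \<open>P\<close>, so \<open>V(t)\<close> is the average of the powers of \<open>P\<close> with
  respect to the Poisson distribution of mean \<open>S t\<close>. Summation by parts bounds \<open>V(t) L g\<close> by the total
  variation of the Poisson weights, which is at most \<open>(S t)\<^sup>-\<^sup>1\<^sup>/\<^sup>2\<close>. This gives the rate \<open>t\<^sup>-\<^sup>1\<^sup>/\<^sup>2\<close>, which is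
  better than the claimed one because \<open>\<vartheta>\<^sub>l\<^sub>o\<^sub>g(r) \<ge> C r\<^sup>-\<^sup>2\<close> for small \<open>r\<close>.

  It remains to see that the kernel of \<open>L\<close> is spanned by the Maxwellian. The map
  \<open>(v, v\<^sub>*, \<sigma>) \<mapsto> (v', v\<^sub>*', (v - v\<^sub>*) / |v - v\<^sub>*|)\<close> preserves \<open>dv dv\<^sub>* d\<sigma>\<close>. Testing \<open>L h = 0\<close> with the arctangent of
  \<open>u = h / \<M>\<close> and symmetrising therefore yields \<open>u(v') = u(v)\<close> wherever the collision kernel does not vanish.
  Hence almost all multiples of \<open>\<sigma> - \<omega>\<close> are periods of \<open>u\<close> for almost all unit vectors \<open>\<sigma>\<close>, \<open>\<omega>\<close> with \<open>b(\<sigma> \<cdot> \<omega>) > 0\<close>.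
  These vectors lie in no proper subspace, so every vector is a period and \<open>u\<close> is constant.
\<close>

section \<open>The rate function\<close>

text \<open>The contraction is \<open>P f = (1 - \<Sigma> / S) f + Gain f / S\<close>: its first
  coefficient is nonnegative because \<open>S\<close> bounds \<open>\<Sigma>\<close>, and
  \<open>Gain\<close> applied to \<open>|f|\<close> has the same integral as
  \<open>\<Sigma> |f|\<close>. The power -1/2 is a standard deviation: consecutive Poisson weights
  of mean \<open>m\<close> differ by \<open>p n * (1 - n / m)\<close>, and the variance is again
  \<open>m\<close>. The kernel matters because \<open>f = h + L g\<close> relaxes to
  \<open>h\<close>; since \<open>L g\<close> has integral zero, \<open>h\<close> carries the mass of
  \<open>f\<close>, and knowing that \<open>h\<close> is a multiple of \<open>maxwellian\<close>
  identifies the limit. Two obstacles shape the argument. The semigroup is known only through its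
  right derivative at \<open>0\<close>, so the Poisson series has to come from a uniqueness theorem
  for right-differentiable curves. And \<open>u = h / maxwellian\<close> comes with no bound or
  moment, so only bounded functions of \<open>u\<close> are admissible in the weak form of
  \<open>L h = 0\<close>; the arctangent is bounded and still strictly increasing. Finally,
  collisions give periods only almost everywhere, and two devices remove this: the difference of two
  good multiples on a line, and the nullity of hyperplane sections of the sphere.\<close>

lemma vartheta_denominator:
  fixes S r :: real
  assumes "0 < S" "0 < r"
  shows "0 < 1 - S / sqrt (r\<^sup>2 + S\<^sup>2)"
    and "1 - S / sqrt (r\<^sup>2 + S\<^sup>2) \<le> r\<^sup>2 / (2 * S\<^sup>2)"
proof -
  define q where "q = sqrt (r\<^sup>2 + S\<^sup>2)"
  have q2: "q\<^sup>2 = r\<^sup>2 + S\<^sup>2" unfolding q_def by simp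
  have qS: "S < q" unfolding q_def using assms by (intro real_less_rsqrt) simp
  have q: "0 < q" using qS assms by simp
  show "0 < 1 - S / sqrt (r\<^sup>2 + S\<^sup>2)" using qS q by (simp add: q_def[symmetric])
  \<comment> \<open>Multiplying by the conjugate, \<open>(q - S) * (q + S) = r^2\<close>: the
    denominator vanishes to second order at \<open>r = 0\<close>, which makes
    \<open>vartheta\<close> blow up like \<open>r^(-3)\<close>.\<close>
  have "1 - S / q = (q - S) * (1 / q)" using q by (simp add: field_simps)
  also have "\<dots> \<le> (q - S) * ((q + S) / (2 * S\<^sup>2))"
  proof (rule mult_left_mono)
    have "1 / q \<le> 1 / S" using qS assms by (simp add: frac_le)
    also have "1 / S = (S + S) / (2 * S\<^sup>2)" using assms by (simp add: power2_eq_square field_simps)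
    also have "\<dots> \<le> (q + S) / (2 * S\<^sup>2)" using qS by (intro divide_right_mono) auto
    finally show "1 / q \<le> (q + S) / (2 * S\<^sup>2)" .
  qed (use qS in simp)
  also have "\<dots> = r\<^sup>2 / (2 * S\<^sup>2)" using q2 by (simp add: power2_eq_square algebra_simps)
  finally show "1 - S / sqrt (r\<^sup>2 + S\<^sup>2) \<le> r\<^sup>2 / (2 * S\<^sup>2)" by (simp add: q_def)
qed

lemma vartheta_denominator_strict_mono:
  fixes S :: real
  assumes "0 < S" "0 < r" "r < s"
  shows "1 - S / sqrt (r\<^sup>2 + S\<^sup>2) < 1 - S / sqrt (s\<^sup>2 + S\<^sup>2)"
proof -
  have "r\<^sup>2 < s\<^sup>2" using assms by (intro power_strict_mono) auto
  moreover have "0 < r\<^sup>2 + S\<^sup>2" using assms by (intro add_pos_pos) auto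
  ultimately show ?thesis
    using assms by (simp add: divide_strict_left_mono)
qed

lemma vartheta_pos: "0 < S \<Longrightarrow> 0 < r \<Longrightarrow> 0 < vartheta S r"
  using vartheta_denominator(1)[of S r] by (simp add: vartheta_def)

lemma vartheta_strict_antimono:
  assumes "0 < S" "0 < r" "r < s"
  shows "vartheta S s < vartheta S r"
proof -
  have "1 / s * (1 / (1 - S / sqrt (s\<^sup>2 + S\<^sup>2))) < 1 / r * (1 / (1 - S / sqrt (r\<^sup>2 + S\<^sup>2)))"
    using vartheta_denominator(1)[of S r] vartheta_denominator_strict_mono[of S r s] assms
    by (intro mult_strict_mono divide_strict_left_mono) auto
  then show ?thesis by (simp add: vartheta_def)
qed

lemma vartheta_log_strict_antimono:
  assumes "0 < S"
  shows "strict_antimono_on {0<..} (vartheta_log S)"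
proof (rule monotone_onI)
  fix r s :: real
  assume rs: "r \<in> {0<..}" "s \<in> {0<..}" "r < s"
  have th: "0 < vartheta S s" "vartheta S s < vartheta S r"
    using rs assms by (auto intro: vartheta_pos vartheta_strict_antimono)
  have "vartheta S s / s < vartheta S r / r" using rs th by (intro frac_less2) auto
  moreover have "0 < vartheta S s / s" using rs th by simp
  ultimately show "vartheta_log S s < vartheta_log S r"
    unfolding vartheta_log_def using th by (intro mult_strict_mono) auto
qed

lemma vartheta_ge:
  assumes "0 < S" "0 < r"
  shows "2 * S\<^sup>2 / r ^ 3 \<le> vartheta S r"
proof -
  note D = vartheta_denominator[OF assms]
  have "1 / (r\<^sup>2 / (2 * S\<^sup>2)) \<le> 1 / (1 - S / sqrt (r\<^sup>2 + S\<^sup>2))"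
    using D assms by (intro divide_left_mono) (auto intro!: mult_pos_pos divide_pos_pos)
  then have "1 / r * (1 / (r\<^sup>2 / (2 * S\<^sup>2))) \<le> vartheta S r"
    unfolding vartheta_def using assms by (intro mult_left_mono) auto
  then show ?thesis by (simp add: power3_eq_cube power2_eq_square)
qed

text \<open>Near \<open>0\<close> the logarithm is replaced by a constant:
  \<open>vartheta S r / r\<close> is at least \<open>2 * S^2\<close>. Giving away one power of the
  singularity \<open>r^(-3)\<close> leaves \<open>r^(-2)\<close>, all that a decay of order
  \<open>t^(-1/2)\<close> requires. The weaker second bound serves to show that arbitrarily large
  values are attained.\<close>

lemma vartheta_log_ge:
  assumes "0 < S" "0 < r" "r \<le> 1"
  shows "2 * S\<^sup>2 * ln (1 + 2 * S\<^sup>2) \<le> r\<^sup>2 * vartheta_log S r"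
    and "2 * S\<^sup>2 * ln (1 + 2 * S\<^sup>2) \<le> r * vartheta_log S r"
proof -
  have r3: "r ^ 3 \<le> 1" using assms by (intro power_le_one) auto
  have r2: "r ^ 2 \<le> 1" using assms by (intro power_le_one) auto
  have r2r: "r ^ 2 \<le> r" using assms by (simp add: power2_eq_square mult_left_le)
  have a: "2 * S\<^sup>2 / r ^ 3 \<le> vartheta S r" using assms by (intro vartheta_ge)
  have p: "0 < vartheta S r" using assms by (intro vartheta_pos)
  have "2 * S\<^sup>2 \<le> 2 * S\<^sup>2 / r ^ 3" using assms r3 by (simp add: pos_le_divide_eq mult_left_le)
  with a have c: "2 * S\<^sup>2 \<le> vartheta S r" by simp
  have d: "vartheta S r \<le> vartheta S r / r"
    using p assms by (simp add: pos_le_divide_eq mult_left_le)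
  have l: "ln (1 + 2 * S\<^sup>2) \<le> ln (1 + vartheta S r / r)"
    using c d assms by (smt (verit) ln_le_cancel_iff zero_less_power)
  have l0: "0 \<le> ln (1 + 2 * S\<^sup>2)" by simp
  have "2 * S\<^sup>2 = r ^ 3 * (2 * S\<^sup>2 / r ^ 3)" using assms by simp
  also have "\<dots> \<le> r ^ 3 * vartheta S r" using a assms by (intro mult_left_mono) auto
  also have "r ^ 3 * vartheta S r \<le> r\<^sup>2 * vartheta S r"
    using p assms by (intro mult_right_mono power_decreasing) auto
  finally have e: "2 * S\<^sup>2 \<le> r\<^sup>2 * vartheta S r" .
  show *: "2 * S\<^sup>2 * ln (1 + 2 * S\<^sup>2) \<le> r\<^sup>2 * vartheta_log S r"
    using mult_mono[OF e l] p l0 by (simp add: vartheta_log_def mult.assoc)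
  have "0 < vartheta_log S r"
    unfolding vartheta_log_def using p assms by (intro mult_pos_pos ln_gt_zero) auto
  then have "r\<^sup>2 * vartheta_log S r \<le> r * vartheta_log S r" using r2r by (intro mult_right_mono) auto
  with * show "2 * S\<^sup>2 * ln (1 + 2 * S\<^sup>2) \<le> r * vartheta_log S r" by simp
qed

text \<open>Smallness at infinity: for \<open>r \<ge> S\<close> the denominator is at least its
  value \<open>1 - 1 / sqrt 2\<close> at \<open>r = S\<close>, and
  \<open>ln (1 + x) \<le> x\<close>.\<close>

lemma vartheta_log_le:
  assumes "0 < S" "1 \<le> r" "S \<le> r"
  shows "vartheta_log S r \<le> 1 / ((1 - 1 / sqrt 2)\<^sup>2 * r)"
proof -
  define \<delta> where "\<delta> = 1 - 1 / sqrt (2::real)"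
  have \<delta>: "0 < \<delta>" by (simp add: \<delta>_def)
  have "sqrt (S\<^sup>2 + S\<^sup>2) = sqrt 2 * S" using assms by (simp add: real_sqrt_mult flip: mult_2)
  then have "\<delta> = 1 - S / sqrt (S\<^sup>2 + S\<^sup>2)" using assms by (simp add: \<delta>_def)
  then have D: "\<delta> \<le> 1 - S / sqrt (r\<^sup>2 + S\<^sup>2)"
    using vartheta_denominator_strict_mono[of S S r] assms by (cases "S = r") auto
  have "vartheta S r \<le> 1 / r * (1 / \<delta>)"
    unfolding vartheta_def using D \<delta> assms by (intro mult_left_mono divide_left_mono) auto
  then have t: "vartheta S r \<le> 1 / (r * \<delta>)" by simp
  have p: "0 < vartheta S r" using assms by (intro vartheta_pos) auto
  have "vartheta_log S r \<le> vartheta S r * (vartheta S r / r)"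
    unfolding vartheta_log_def using p assms by (intro mult_left_mono ln_add_one_self_le_self) auto
  also have "\<dots> \<le> (1 / (r * \<delta>)) * ((1 / (r * \<delta>)) / r)"
    using p t assms \<delta> by (intro mult_mono divide_right_mono) auto
  also have "\<dots> = 1 / (\<delta>\<^sup>2 * (r * (r * r)))" by (simp add: power2_eq_square field_simps)
  also have "\<dots> \<le> 1 / (\<delta>\<^sup>2 * r)"
  proof (intro divide_left_mono mult_left_mono)
    have "1 * 1 \<le> r * r" using assms by (intro mult_mono) auto
    then show "r \<le> r * (r * r)" using assms by (simp add: mult_left_le_imp_le)
  qed (use assms \<delta> in auto)
  finally show ?thesis by (simp add: \<delta>_def)
qed

lemma vartheta_log_continuous_on: "0 < S \<Longrightarrow> 0 < a \<Longrightarrow> continuous_on {a..b} (vartheta_log S)"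
proof -
  assume S: "0 < S" and a: "0 < a"
  have nz: "1 - S / sqrt (r\<^sup>2 + S\<^sup>2) \<noteq> 0" "sqrt (r\<^sup>2 + S\<^sup>2) \<noteq> 0" "r \<noteq> 0" if "r \<in> {a..b}" for r
    using vartheta_denominator(1)[of S r] that S a by auto
  have "continuous_on {a..b} (vartheta S)"
    unfolding vartheta_def by (intro continuous_intros) (use nz in auto)
  moreover have "1 + vartheta S r / r \<noteq> 0" if "r \<in> {a..b}" for r
  proof -
    have "0 < r" using that a by auto
    then have "0 < vartheta S r / r" using vartheta_pos S by simp
    then show ?thesis by linarith
  qed
  ultimately show ?thesis
    unfolding vartheta_log_def using nz(3)
    by (intro continuous_on_mult continuous_on_ln continuous_on_add continuous_on_const
        continuous_on_divide continuous_on_id) auto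
qed

text \<open>\<open>the_inv_into\<close> says something only at attained values, so every
  \<open>c * t > 0\<close> must be shown to be one. The two one-sided bounds supply endpoints for
  the intermediate value theorem.\<close>

lemma vartheta_log_surj:
  assumes S: "0 < S" and y: "0 < y"
  shows "\<exists>r>0. vartheta_log S r = y"
proof -
  define k where "k = 2 * S\<^sup>2 * ln (1 + 2 * S\<^sup>2)"
  have k: "0 < k" unfolding k_def using S by (intro mult_pos_pos ln_gt_zero) auto
  \<comment> \<open>Chosen so that the lower bound \<open>k / a\<close> of
    \<open>vartheta_log S a\<close> is at least \<open>y\<close>.\<close>
  define a where "a = min 1 (k / y)"
  have a: "0 < a" "a \<le> 1" "a \<le> k / y" using k y by (auto simp: a_def)
  have "a * y \<le> k" using a(3) y by (simp add: pos_le_divide_eq)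
  also have "k \<le> a * vartheta_log S a" unfolding k_def by (rule vartheta_log_ge) (use a S in auto)
  finally have ya: "y \<le> vartheta_log S a" using a by simp
  define \<delta> where "\<delta> = (1 - 1 / sqrt (2::real))\<^sup>2"
  have \<delta>: "0 < \<delta>" by (simp add: \<delta>_def)
  \<comment> \<open>Chosen so that the upper bound \<open>1 / (\<delta> * b)\<close> of
    \<open>vartheta_log S b\<close> is at most \<open>y\<close>.\<close>
  define b where "b = max 1 (max S (1 / (\<delta> * y)))"
  have b: "1 \<le> b" "S \<le> b" "1 / (\<delta> * y) \<le> b" by (auto simp: b_def)
  have "vartheta_log S b \<le> 1 / (\<delta> * b)" unfolding \<delta>_def by (rule vartheta_log_le) (use b S in auto)
  also have "\<dots> \<le> y" using b \<delta> y by (simp add: field_simps)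
  finally have yb: "vartheta_log S b \<le> y" .
  have "\<exists>r\<ge>a. r \<le> b \<and> vartheta_log S r = y"
    by (rule IVT2') (use a b ya yb S in \<open>auto intro!: vartheta_log_continuous_on\<close>)
  then obtain r where "a \<le> r" "vartheta_log S r = y" by auto
  then show ?thesis using a(1) by (intro exI[of _ r]) auto
qed

text \<open>The preimage \<open>r\<close> of \<open>c * t\<close> satisfies
  \<open>k \<le> r^2 * c * t\<close> if \<open>r \<le> 1\<close>, and exceeds \<open>1\<close>
  otherwise; the minimum in \<open>K\<close> covers both cases. This converts a bound of order
  \<open>t^(-1/2)\<close> into one by the inverse of \<open>vartheta_log\<close>.\<close>

lemma vartheta_log_inv_ge:
  assumes S: "0 < S" and c: "0 < c"
  shows "\<exists>K>0. \<forall>t\<ge>1. K / sqrt t \<le> vartheta_log_inv S (c * t)"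
proof -
  define k where "k = 2 * S\<^sup>2 * ln (1 + 2 * S\<^sup>2)"
  have k: "0 < k" unfolding k_def using S by (intro mult_pos_pos ln_gt_zero) auto
  define K where "K = min 1 (sqrt (k / c))"
  have K: "0 < K" using k c by (simp add: K_def)
  have inj: "inj_on (vartheta_log S) {0<..}"
    using vartheta_log_strict_antimono[OF S]
    by (intro linorder_inj_onI') (force simp: monotone_on_def)
  have "K / sqrt t \<le> vartheta_log_inv S (c * t)" if t: "1 \<le> t" for t
  proof -
    obtain r where r: "0 < r" "vartheta_log S r = c * t"
      using vartheta_log_surj[of S "c * t"] S c t by auto
    have inv: "vartheta_log_inv S (c * t) = r"
      unfolding vartheta_log_inv_def using inj r by (intro the_inv_into_f_eq) auto
    show ?thesis
    proof (cases "r \<le> 1")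
      case True
      have "k \<le> r\<^sup>2 * vartheta_log S r"
        unfolding k_def by (rule vartheta_log_ge) (use S r True in auto)
      then have "k / c \<le> r\<^sup>2 * t" using r c by (simp add: field_simps)
      then have "sqrt (k / c) \<le> sqrt (r\<^sup>2 * t)" by simp
      also have "\<dots> = r * sqrt t" using r by (simp add: real_sqrt_mult)
      finally have "K \<le> r * sqrt t" by (simp add: K_def)
      then show ?thesis using inv t by (simp add: pos_divide_le_eq)
    next
      case False
      have "K / sqrt t \<le> K / 1" using t K by (intro divide_left_mono) auto
      also have "\<dots> \<le> r" using False by (simp add: K_def)
      finally show ?thesis using inv by simp
    qed
  qed
  then show ?thesis using K by auto
qed

section \<open>Total variation of the Poisson weights\<close>

definition poisson :: "real \<Rightarrow> nat \<Rightarrow> real" where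
  "poisson m n = exp (- m) * (m ^ n / fact n)"

lemma poisson_nonneg: "0 \<le> m \<Longrightarrow> 0 \<le> poisson m n"
  by (simp add: poisson_def)

lemma poisson_Suc: "real (Suc n) * poisson m (Suc n) = m * poisson m n"
  by (simp add: poisson_def field_simps del: of_nat_Suc)

lemma poisson_sums: "poisson m sums 1"
proof -
  have "(\<lambda>n. exp (- m) * (m ^ n / fact n)) sums (exp (- m) * exp m)"
    using exp_converges[of m] by (intro sums_mult) (simp add: divide_inverse mult.commute)
  then show ?thesis by (simp add: poisson_def[abs_def] exp_minus_inverse mult.commute)
qed

lemma poisson_mean_sums: "(\<lambda>n. real n * poisson m n) sums m"
proof -
  have "(\<lambda>n. real (Suc n) * poisson m (Suc n)) sums m"
    unfolding poisson_Suc using sums_mult[OF poisson_sums, of m] by simp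
  then show ?thesis by (subst (asm) sums_Suc_iff) simp
qed

lemma poisson_square_sums: "(\<lambda>n. (real n)\<^sup>2 * poisson m n) sums (m\<^sup>2 + m)"
proof -
  have "(\<lambda>n. m * (real n * poisson m n) + m * poisson m n) sums (m * m + m * 1)"
    by (intro sums_add sums_mult poisson_mean_sums poisson_sums)
  moreover have "m * (real n * poisson m n) + m * poisson m n = (real (Suc n))\<^sup>2 * poisson m (Suc n)" for n
  proof -
    have "(real (Suc n))\<^sup>2 * poisson m (Suc n) = real (Suc n) * (m * poisson m n)"
      by (simp only: power2_eq_square mult.assoc poisson_Suc)
    then show ?thesis by (simp add: algebra_simps)
  qed
  ultimately have "(\<lambda>n. (real (Suc n))\<^sup>2 * poisson m (Suc n)) sums (m\<^sup>2 + m)"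
    by (simp add: power2_eq_square)
  then show ?thesis by (subst (asm) sums_Suc_iff) simp
qed

text \<open>The mean of \<open>|1 - N / m|\<close> for a Poisson variable \<open>N\<close> is at
  most the standard deviation of \<open>N / m\<close>, whose variance is \<open>1 / m\<close>. The
  majorant \<open>?g\<close> is a quadratic polynomial in \<open>n\<close> times the weight, so the
  first three moments give its sum.\<close>

lemma poisson_deviation_sum:
  assumes "0 < m"
  shows "summable (\<lambda>n. \<bar>poisson m n * (1 - real n / m)\<bar>)"
    and "(\<Sum>n. \<bar>poisson m n * (1 - real n / m)\<bar>) \<le> 1 / sqrt m"
proof -
  let ?g = "\<lambda>n. sqrt m / 2 * (poisson m n - 2 / m * (real n * poisson m n)
              + 1 / m\<^sup>2 * ((real n)\<^sup>2 * poisson m n)) + 1 / (2 * sqrt m) * poisson m n"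
  have s: "?g sums (sqrt m / 2 * (1 - 2 / m * m + 1 / m\<^sup>2 * (m\<^sup>2 + m)) + 1 / (2 * sqrt m) * 1)"
    by (intro sums_add sums_diff sums_mult poisson_sums poisson_mean_sums poisson_square_sums)
  have "sqrt m / 2 * (1 - 2 / m * m + 1 / m\<^sup>2 * (m\<^sup>2 + m)) + 1 / (2 * sqrt m) * 1
      = sqrt m / 2 * (1 / m) + 1 / (2 * sqrt m)"
    using assms by (simp add: field_simps power2_eq_square)
  also have "\<dots> = 1 / sqrt m"
    using assms by (simp add: field_simps flip: power2_eq_square)
  finally have s': "?g sums (1 / sqrt m)" using s by simp
  have le: "\<bar>poisson m n * (1 - real n / m)\<bar> \<le> ?g n" for n
  proof -
    define x where "x = 1 - real n / m"
    \<comment> \<open>Instead of the Cauchy-Schwarz inequality for series: the arithmetic-geometric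
      mean inequality, weighted so that both terms contribute \<open>1 / (2 * sqrt m)\<close> after
      summation.\<close>
    have "0 \<le> (sqrt m * \<bar>x\<bar> - 1)\<^sup>2 / (2 * sqrt m)"
      using assms by (intro divide_nonneg_pos) auto
    also have "\<dots> = sqrt m / 2 * x\<^sup>2 + 1 / (2 * sqrt m) - \<bar>x\<bar>"
      using assms by (simp add: field_simps power2_eq_square flip: abs_mult)
    finally have "\<bar>x\<bar> \<le> sqrt m / 2 * x\<^sup>2 + 1 / (2 * sqrt m)" by simp
    then have "poisson m n * \<bar>x\<bar> \<le> poisson m n * (sqrt m / 2 * x\<^sup>2 + 1 / (2 * sqrt m))"
      using poisson_nonneg[of m n] assms by (intro mult_left_mono) auto
    also have "x\<^sup>2 = 1 - 2 / m * real n + 1 / m\<^sup>2 * (real n)\<^sup>2"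
      unfolding x_def by (simp add: power2_eq_square algebra_simps)
    also have "poisson m n * (sqrt m / 2 * (1 - 2 / m * real n + 1 / m\<^sup>2 * (real n)\<^sup>2) + 1 / (2 * sqrt m)) = ?g n"
      by (simp add: algebra_simps)
    finally show ?thesis using poisson_nonneg[of m n] assms by (simp add: abs_mult x_def)
  qed
  show sm: "summable (\<lambda>n. \<bar>poisson m n * (1 - real n / m)\<bar>)"
    by (rule summable_comparison_test'[OF sums_summable[OF s'], of 0]) (use le in auto)
  show "(\<Sum>n. \<bar>poisson m n * (1 - real n / m)\<bar>) \<le> 1 / sqrt m"
    using suminf_le[OF le sm sums_summable[OF s']] sums_unique[OF s'] by simp
qed

section \<open>Semigroups with a bounded dissipative generator\<close>

text \<open>Only right-hand increments are controlled. If \<open>\<phi> T\<close> were larger than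
  \<open>\<phi> 0 + e * T\<close>, the last time \<open>t\<close> with
  \<open>\<phi> t \<le> \<phi> 0 + e * t\<close> would lie before \<open>T\<close>, and the
  assumption at \<open>t\<close> would produce a later such time.\<close>

lemma nonincreasing_from_right_Dini:
  fixes \<phi> :: "real \<Rightarrow> real"
  assumes cont: "continuous_on {0..T} \<phi>" and T: "0 \<le> T"
    and dini: "\<And>t e. 0 \<le> t \<Longrightarrow> t < T \<Longrightarrow> 0 < e \<Longrightarrow>
      \<exists>d>0. \<forall>h. 0 < h \<and> h < d \<longrightarrow> \<phi> (t + h) \<le> \<phi> t + e * h"
  shows "\<phi> T \<le> \<phi> 0"
proof -
  have main: "\<phi> T \<le> \<phi> 0 + e * T" if e: "0 < e" for e
  proof (rule ccontr)
    assume neg: "\<not> \<phi> T \<le> \<phi> 0 + e * T"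
    define A where "A = {t \<in> {0..T}. \<phi> t - e * t \<le> \<phi> 0}"
    have "closed A"
      unfolding A_def by (intro continuous_on_closed_Collect_le continuous_intros cont)
    moreover have "A \<subseteq> {0..T}" by (auto simp: A_def)
    ultimately have "compact A"
      using compact_Int_closed[OF compact_Icc[of 0 T], of A] by (simp add: Int_absorb1)
    moreover have "0 \<in> A" using T by (simp add: A_def)
    ultimately obtain t where t: "t \<in> A" "\<And>s. s \<in> A \<Longrightarrow> s \<le> t"
      using compact_attains_sup[of A] by auto
    have tT: "0 \<le> t" "t < T" using t(1) neg by (auto simp: A_def less_le)
    obtain d where d: "0 < d" "\<And>h. 0 < h \<Longrightarrow> h < d \<Longrightarrow> \<phi> (t + h) \<le> \<phi> t + e * h"
      using dini[OF tT e] by auto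
    define h where "h = min (d / 2) (T - t)"
    have h: "0 < h" "h < d" "t + h \<le> T" using d tT by (auto simp: h_def)
    have "t + h \<in> A" using d(2)[OF h(1,2)] t(1) h tT by (auto simp: A_def algebra_simps)
    then show False using t(2) h by force
  qed
  show ?thesis
  proof (rule field_le_epsilon)
    fix e :: real assume e: "0 < e"
    \<comment> \<open>Dividing by \<open>T + 1\<close> rather than \<open>T\<close> admits
      \<open>T = 0\<close>.\<close>
    have "\<phi> T \<le> \<phi> 0 + e / (T + 1) * T" using e T by (intro main) auto
    also have "e / (T + 1) * T \<le> e" using e T by (simp add: field_simps)
    finally show "\<phi> T \<le> \<phi> 0 + e" by simp
  qed
qed

text \<open>The Banach-Steinhaus theorem from Baire's. If no uniform bound exists, every set
  \<open>U k\<close> of points at which some \<open>T n\<close> exceeds \<open>k\<close> is open and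
  dense; a point common to all of them contradicts the pointwise bounds.\<close>

lemma uniform_boundedness:
  fixes T :: "nat \<Rightarrow> 'a::banach \<Rightarrow> 'b::real_normed_vector"
  assumes lin: "\<And>n. bounded_linear (T n)"
    and bnd: "\<And>x. \<exists>K. \<forall>n. norm (T n x) \<le> K"
  shows "\<exists>K. \<forall>n x. norm (T n x) \<le> K * norm x"
proof (rule ccontr)
  assume neg: "\<not> ?thesis"
  define U where "U k = (\<Union>n. {x. real k < norm (T n x)})" for k
  have "open (U k)" for k
    unfolding U_def using lin
    by (intro open_UN ballI open_Collect_less continuous_on_const continuous_on_norm linear_continuous_on)
  moreover have "closure (U k) = UNIV" for k
  proof -
    have "\<exists>y\<in>U k. dist y x < r" if r: "0 < r" for x r
    proof -
      obtain n z where z: "2 * real (Suc k) / r * norm z < norm (T n z)"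
        using neg unfolding not_ex not_all not_le by blast
      interpret bounded_linear "T n" by (rule lin)
      have z0: "0 < norm z" using z by (cases "z = 0") (auto simp: zero)
      \<comment> \<open>Of norm \<open>r / 2\<close> and with image of norm above
        \<open>k + 1\<close>. Since \<open>T n (x + w)\<close> and \<open>T n (x - w)\<close> differ
        by \<open>2 T n w\<close>, at least one of them is large, whatever \<open>x\<close>
        is.\<close>
      define w where "w = (r / (2 * norm z)) *\<^sub>R z"
      have nw: "norm w < r" using z0 r by (simp add: w_def)
      have "real (Suc k) = r / (2 * norm z) * (2 * real (Suc k) / r * norm z)"
        using z0 r by (simp add: field_simps del: of_nat_Suc)
      also have "\<dots> < r / (2 * norm z) * norm (T n z)"
        using z z0 r by (intro mult_strict_left_mono) auto
      finally have "real (Suc k) < norm (T n w)" using z0 r by (simp add: w_def scaleR)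
      moreover have "2 * norm (T n w) \<le> norm (T n (x + w)) + norm (T n (x - w))"
      proof -
        have "(2::real) *\<^sub>R T n w = T n (x + w) - T n (x - w)" by (simp add: add diff scaleR_2)
        then have "norm ((2::real) *\<^sub>R T n w) \<le> norm (T n (x + w)) + norm (T n (x - w))"
          by (metis norm_triangle_ineq4)
        then show ?thesis by simp
      qed
      ultimately have "real k < norm (T n (x + w)) \<or> real k < norm (T n (x - w))" by linarith
      then have "x + w \<in> U k \<or> x - w \<in> U k" by (auto simp: U_def)
      moreover have "dist (x + w) x < r" "dist (x - w) x < r" using nw by (auto simp: dist_norm)
      ultimately show ?thesis by blast
    qed
    then show ?thesis by (auto simp: closure_approachable)
  qed
  ultimately have "Met_TC.mtopology closure_of \<Inter>(range U) = UNIV"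
    by (intro Met_TC.metric_Baire_category)
       (auto simp only: mcomplete_iff_complete complete_UNIV mtopology_is_euclidean euclidean_closure_of
          open_openin countable_image[OF countableI_type])
  then have "\<Inter>(range U) \<noteq> {}" by auto
  then obtain x where x: "\<And>k. x \<in> U k" by auto
  obtain K where K: "\<And>n. norm (T n x) \<le> K" using bnd by auto
  obtain k where "K < real k" using reals_Archimedean2 by blast
  moreover obtain n where "real k < norm (T n x)" using x[of k] by (auto simp: U_def)
  ultimately show False using K[of n] by linarith
qed

lemma power_Suc_add_ge:
  fixes s h :: real
  assumes "0 \<le> s" "0 \<le> h"
  shows "s ^ Suc n + real (Suc n) * h * s ^ n \<le> (s + h) ^ Suc n"
proof (induction n)
  case (Suc n)
  have "s ^ Suc (Suc n) + real (Suc (Suc n)) * h * s ^ Suc n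
      \<le> (s + h) * (s ^ Suc n + real (Suc n) * h * s ^ n)"
    using assms by (simp add: algebra_simps)
  also have "\<dots> \<le> (s + h) * (s + h) ^ Suc n" using Suc assms by (intro mult_left_mono) auto
  finally show ?case by simp
qed (use assms in auto)

text \<open>The generator is everywhere defined and bounded. \<open>jump_contraction\<close> is
  dissipativity in the discrete form that makes \<open>A = S (P - 1)\<close> with a contraction
  \<open>P\<close>.\<close>

locale dissipative_semigroup =
  fixes V :: "real \<Rightarrow> 'x::banach \<Rightarrow> 'x" and A :: "'x \<Rightarrow> 'x" and S :: real
  assumes V_linear: "\<And>t. 0 \<le> t \<Longrightarrow> bounded_linear (V t)"
    and V_0: "\<And>x. V 0 x = x"
    and V_add: "\<And>s t x. 0 \<le> s \<Longrightarrow> 0 \<le> t \<Longrightarrow> V (s + t) x = V s (V t x)"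
    and V_gen: "\<And>x. ((\<lambda>h. (V h x - x) /\<^sub>R h) \<longlongrightarrow> A x) (at_right 0)"
    and A_linear: "bounded_linear A"
    and S_pos: "0 < S"
    and jump_contraction: "\<And>x. norm (x + (1 / S) *\<^sub>R A x) \<le> norm x"
begin

text \<open>The difference quotients converge at every \<open>x\<close>; multiplying them by
  \<open>h\<close> gives strong continuity at \<open>0\<close>.\<close>

lemma V_tendsto: "((\<lambda>h. V h x) \<longlongrightarrow> x) (at_right 0)"
proof -
  have "((\<lambda>h. x + h *\<^sub>R ((V h x - x) /\<^sub>R h)) \<longlongrightarrow> x + 0 *\<^sub>R A x) (at_right 0)"
    by (intro tendsto_intros V_gen)
  moreover have "\<forall>\<^sub>F h in at_right 0. x + h *\<^sub>R ((V h x - x) /\<^sub>R h) = V h x"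
    by (simp add: eventually_at_filter)
  ultimately have "((\<lambda>h. V h x) \<longlongrightarrow> x + 0 *\<^sub>R A x) (at_right 0)" by (rule Lim_transform_eventually)
  then show ?thesis by simp
qed

text \<open>Otherwise there are times \<open>t n\<close> tending to \<open>0\<close> at which
  \<open>V (t n)\<close> has norm above \<open>n\<close>. By strong continuity the orbits along
  these times are bounded, against the uniform boundedness principle.\<close>

lemma V_locally_bounded:
  "\<exists>d>0. \<exists>K. \<forall>t x. 0 \<le> t \<and> t \<le> d \<longrightarrow> norm (V t x) \<le> K * norm x"
proof (rule ccontr)
  assume neg: "\<not> ?thesis"
  have "\<exists>t. 0 \<le> t \<and> t \<le> 1 / real (Suc n) \<and> (\<exists>x. real n * norm x < norm (V t x))" for n
  proof (rule ccontr)
    assume "\<not> ?thesis"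
    then have "\<forall>t x. 0 \<le> t \<and> t \<le> 1 / real (Suc n) \<longrightarrow> norm (V t x) \<le> real n * norm x"
      by (auto simp del: of_nat_Suc simp: not_less)
    moreover have "0 < 1 / real (Suc n)" by simp
    ultimately show False using neg by blast
  qed
  then obtain t where t: "\<And>n. 0 \<le> t n" "\<And>n. t n \<le> 1 / real (Suc n)"
      "\<And>n. \<exists>x. real n * norm x < norm (V (t n) x)"
    by metis
  have t0: "t \<longlonglongrightarrow> 0"
  proof (rule tendsto_sandwich[OF _ _ tendsto_const LIMSEQ_Suc[OF lim_1_over_n]])
  qed (use t in \<open>auto simp del: of_nat_Suc\<close>)
  have "\<exists>K. \<forall>n. norm (V (t n) x) \<le> K" for x
  proof -
    have "((\<lambda>h. V h x) \<longlongrightarrow> V 0 x) (at 0 within {0..})"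
      using V_tendsto[of x] by (simp add: V_0 at_within_Ici_at_right)
    then have "(\<lambda>n. V (t n) x) \<longlonglongrightarrow> V 0 x"
      by (rule continuous_within_tendsto_compose'[of 0 "{0..}" "\<lambda>h. V h x" t sequentially,
            unfolded continuous_within]) (use t t0 in auto)
    then have "Bseq (\<lambda>n. V (t n) x)" by (intro convergent_imp_Bseq) (auto simp: convergent_def)
    then show ?thesis by (auto simp: Bseq_def)
  qed
  then have "\<exists>K. \<forall>n x. norm (V (t n) x) \<le> K * norm x"
    by (intro uniform_boundedness V_linear t(1))
  then obtain K where K: "\<And>n x. norm (V (t n) x) \<le> K * norm x" by blast
  obtain n where n: "K < real n" using reals_Archimedean2 by blast
  obtain x where x: "real n * norm x < norm (V (t n) x)" using t(3) by blast
  have "K * norm x \<le> real n * norm x" using n by (intro mult_right_mono) auto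
  with K[of n x] x show False by linarith
qed

lemma V_bounded_on: "\<exists>K. \<forall>t x. 0 \<le> t \<and> t \<le> T \<longrightarrow> norm (V t x) \<le> K * norm x"
proof -
  obtain d K0 where d: "0 < d" and K0: "\<And>t x. 0 \<le> t \<Longrightarrow> t \<le> d \<Longrightarrow> norm (V t x) \<le> K0 * norm x"
    using V_locally_bounded by blast
  \<comment> \<open>At least \<open>1\<close>, so that its powers increase and the bound for one
    step of length \<open>d\<close> also holds after several.\<close>
  define K where "K = max 1 K0"
  have K: "norm (V t x) \<le> K * norm x" if "0 \<le> t" "t \<le> d" for t x
    using K0[OF that, of x] by (rule order_trans) (auto simp: K_def intro!: mult_right_mono)
  have main: "norm (V t x) \<le> K ^ Suc m * norm x" if "0 \<le> t" "t \<le> real (Suc m) * d" for t x m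
    using that
  proof (induction m arbitrary: t)
    case 0
    then show ?case using K by simp
  next
    case (Suc m)
    show ?case
    proof (cases "t \<le> d")
      case True
      have "norm (V t x) \<le> K ^ 1 * norm x" using K Suc.prems True by simp
      also have "\<dots> \<le> K ^ Suc (Suc m) * norm x"
        by (intro mult_right_mono power_increasing) (auto simp: K_def)
      finally show ?thesis .
    next
      case False
      have "V t x = V d (V (t - d) x)" using V_add[of d "t - d" x] False d by simp
      then have "norm (V t x) \<le> K * norm (V (t - d) x)" using K[of d] d by simp
      also have "\<dots> \<le> K * (K ^ Suc m * norm x)"
        using False Suc.prems d
        by (intro mult_left_mono Suc.IH) (auto simp: algebra_simps K_def)
      finally show ?thesis by simp
    qed
  qed
  obtain m where m: "T / d < real m" using reals_Archimedean2 by blast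
  have "norm (V t x) \<le> K ^ Suc m * norm x" if "0 \<le> t" "t \<le> T" for t x
  proof (rule main)
    have "T \<le> real m * d" using m d by (simp add: pos_divide_less_eq)
    also have "\<dots> \<le> real (Suc m) * d" using d by (intro mult_right_mono) auto
    finally show "t \<le> real (Suc m) * d" using that by simp
  qed fact
  then show ?thesis by blast
qed

text \<open>Right continuity at \<open>0\<close> becomes continuity from both sides through
  \<open>V s x - V t x = V t (V (s - t) x - x)\<close> for \<open>t \<le> s\<close>, because the
  norms of \<open>V t\<close> are bounded on \<open>{0..T}\<close>.\<close>

lemma V_continuous_on: "continuous_on {0..T} (\<lambda>t. V t x)"
proof -
  obtain K where K: "\<And>t x. 0 \<le> t \<Longrightarrow> t \<le> T \<Longrightarrow> norm (V t x) \<le> K * norm x"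
    using V_bounded_on[of T] by blast
  have ord: "norm (V s x - V t x) \<le> \<bar>K\<bar> * norm (V \<bar>s - t\<bar> x - x)"
    if "0 \<le> t" "t \<le> s" "s \<le> T" for s t
  proof -
    interpret bounded_linear "V t" by (rule V_linear) fact
    have "V s x = V t (V (s - t) x)" using V_add[of t "s - t" x] that by simp
    then have "norm (V s x - V t x) \<le> K * norm (V (s - t) x - x)"
      using K[of t "V (s - t) x - x"] that by (simp add: diff)
    also have "\<dots> \<le> \<bar>K\<bar> * norm (V (s - t) x - x)" by (intro mult_right_mono) auto
    finally show ?thesis using that by simp
  qed
  have bound: "norm (V s x - V t x) \<le> \<bar>K\<bar> * norm (V \<bar>s - t\<bar> x - x)"
    if "s \<in> {0..T}" "t \<in> {0..T}" for s t
  proof (cases "t \<le> s")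
    case True then show ?thesis using that by (intro ord) auto
  next
    case False
    then have "norm (V t x - V s x) \<le> \<bar>K\<bar> * norm (V \<bar>t - s\<bar> x - x)" using that by (intro ord) auto
    then show ?thesis by (simp only: norm_minus_commute[of "V t x"] abs_minus_commute[of t])
  qed
  have lim: "continuous (at 0 within {0..}) (\<lambda>h. \<bar>K\<bar> * norm (V h x - x))"
  proof -
    have "continuous (at 0 within {0..}) (\<lambda>h. V h x)"
      unfolding continuous_within at_within_Ici_at_right V_0 by (rule V_tendsto)
    then show ?thesis by (intro continuous_intros)
  qed
  show ?thesis unfolding continuous_on_def
  proof
    fix t assume t: "t \<in> {0..T}"
    have "((\<lambda>s. \<bar>s - t\<bar>) \<longlongrightarrow> \<bar>t - t\<bar>) (at t within {0..T})" by (intro tendsto_intros)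
    then have "((\<lambda>s. \<bar>K\<bar> * norm (V \<bar>s - t\<bar> x - x)) \<longlongrightarrow> \<bar>K\<bar> * norm (V 0 x - x)) (at t within {0..T})"
      by (intro continuous_within_tendsto_compose'[OF lim]) simp_all
    then have "((\<lambda>s. \<bar>K\<bar> * norm (V \<bar>s - t\<bar> x - x)) \<longlongrightarrow> 0) (at t within {0..T})" by (simp add: V_0)
    then have "((\<lambda>s. V s x - V t x) \<longlongrightarrow> 0) (at t within {0..T})"
      by (rule Lim_null_comparison[rotated])
         (auto simp: eventually_at_filter intro!: bound always_eventually t)
    then show "((\<lambda>s. V s x) \<longlongrightarrow> V t x) (at t within {0..T})" by (simp add: LIM_zero_iff)
  qed
qed

text \<open>From \<open>V (t + h) x = V h (V t x)\<close> the defining limit of the generator can be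
  taken at the vector \<open>V t x\<close>. It yields the derivative from the right only.\<close>

lemma V_right_derivative:
  assumes "0 \<le> t"
  shows "((\<lambda>t. V t x) has_vector_derivative A (V t x)) (at t within {t..})"
proof -
  have "((\<lambda>h. (V h (V t x) - V t x) /\<^sub>R h) \<longlongrightarrow> A (V t x)) (at_right 0)" by (rule V_gen)
  moreover have "\<forall>\<^sub>F h in at_right 0. (V h (V t x) - V t x) /\<^sub>R h = (V (t + h) x - V t x) /\<^sub>R h"
    using assms by (auto simp: eventually_at_filter V_add[of _ t] add.commute[of t])
  ultimately have "((\<lambda>h. (V (t + h) x - V t x) /\<^sub>R h) \<longlongrightarrow> A (V t x)) (at_right 0)"
    by (rule Lim_transform_eventually)
  then have "((\<lambda>s. (V s x - V t x) /\<^sub>R (s - t)) \<longlongrightarrow> A (V t x)) (at_right t)"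
    by (subst filterlim_at_right_to_0) (simp add: add.commute)
  then have "((\<lambda>s. (V s x - V t x) /\<^sub>R (s - t) - A (V t x)) \<longlongrightarrow> 0) (at_right t)"
    by (simp add: LIM_zero)
  moreover have "\<forall>\<^sub>F s in at_right t. (V s x - V t x) /\<^sub>R (s - t) - A (V t x)
      = (1 / norm (s - t)) *\<^sub>R (V s x - (V t x + (s - t) *\<^sub>R A (V t x)))"
    by (auto simp: eventually_at_filter scaleR_diff_right scaleR_add_right diff_diff_eq divide_inverse)
  ultimately have "((\<lambda>s. (1 / norm (s - t)) *\<^sub>R (V s x - (V t x + (s - t) *\<^sub>R A (V t x)))) \<longlongrightarrow> 0) (at_right t)"
    by (rule Lim_transform_eventually)
  then show ?thesis
    unfolding has_vector_derivative_def has_derivative_within at_within_Ici_at_right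
    by (simp add: bounded_linear_scaleR_left)
qed

text \<open>The step is the convex combination of the identity and of \<open>1 + A / S\<close> with
  weights \<open>1 - h * S\<close> and \<open>h * S\<close>.\<close>

lemma euler_step_contraction:
  assumes "0 \<le> h" "h * S \<le> 1"
  shows "norm (x + h *\<^sub>R A x) \<le> norm x"
proof -
  have "x + h *\<^sub>R A x = (1 - h * S) *\<^sub>R x + (h * S) *\<^sub>R (x + (1 / S) *\<^sub>R A x)"
    using S_pos by (simp add: algebra_simps)
  also have "norm \<dots> \<le> norm ((1 - h * S) *\<^sub>R x) + norm ((h * S) *\<^sub>R (x + (1 / S) *\<^sub>R A x))"
    by (rule norm_triangle_ineq)
  also have "\<dots> = (1 - h * S) * norm x + (h * S) * norm (x + (1 / S) *\<^sub>R A x)"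
    using assms S_pos by simp
  also have "\<dots> \<le> (1 - h * S) * norm x + (h * S) * norm x"
    using assms S_pos by (intro add_left_mono mult_left_mono jump_contraction) auto
  also have "\<dots> = norm x" by (simp add: algebra_simps)
  finally show ?thesis .
qed

text \<open>Up to \<open>e * h\<close>, \<open>w (t + h)\<close> is an Euler step from
  \<open>w t\<close>, and Euler steps contract. The result is used twice: for orbits of
  \<open>V\<close>, and for the difference of two solutions, where it is a uniqueness
  theorem.\<close>

lemma norm_solution_nonincreasing:
  assumes cont: "continuous_on {0..T} w" and T: "0 \<le> T"
    and deriv: "\<And>t. 0 \<le> t \<Longrightarrow> t < T \<Longrightarrow> (w has_vector_derivative A (w t)) (at t within {t..})"
  shows "norm (w T) \<le> norm (w 0)"
proof (rule nonincreasing_from_right_Dini[OF _ T])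
  show "continuous_on {0..T} (\<lambda>t. norm (w t))" by (intro continuous_intros cont)
  fix t e :: real
  assume t: "0 \<le> t" "t < T" and e: "0 < e"
  have "(w has_derivative (\<lambda>h. h *\<^sub>R A (w t))) (at t within {t..})"
    using deriv[OF t] by (simp add: has_vector_derivative_def)
  then obtain d where d: "0 < d"
    "\<And>y. y \<in> {t..} \<Longrightarrow> norm (y - t) < d \<Longrightarrow> norm (w y - w t - (y - t) *\<^sub>R A (w t)) \<le> e * norm (y - t)"
    using e unfolding has_derivative_within_alt by meson
  have "norm (w (t + h)) \<le> norm (w t) + e * h" if h: "0 < h" "h < min d (1 / S)" for h
  proof -
    have "norm (w (t + h)) = norm ((w t + h *\<^sub>R A (w t)) + (w (t + h) - w t - h *\<^sub>R A (w t)))" by simp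
    also have "\<dots> \<le> norm (w t + h *\<^sub>R A (w t)) + norm (w (t + h) - w t - h *\<^sub>R A (w t))"
      by (rule norm_triangle_ineq)
    also have "\<dots> \<le> norm (w t) + e * h"
      using d(2)[of "t + h"] h S_pos by (intro add_mono euler_step_contraction) (auto simp: field_simps)
    finally show ?thesis .
  qed
  then show "\<exists>d>0. \<forall>h. 0 < h \<and> h < d \<longrightarrow> norm (w (t + h)) \<le> norm (w t) + e * h"
    using d(1) S_pos by (intro exI[of _ "min d (1 / S)"]) auto
qed

lemma norm_V_le: "0 \<le> t \<Longrightarrow> norm (V t x) \<le> norm x"
  using norm_solution_nonincreasing[OF V_continuous_on _ V_right_derivative, of t x] by (simp add: V_0)

section \<open>The contraction \<open>jump\<close> and its exponential series\<close>

definition jump :: "'x \<Rightarrow> 'x" where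
  "jump x = x + (1 / S) *\<^sub>R A x"

lemma jump_linear: "bounded_linear jump"
  unfolding jump_def[abs_def]
  by (intro bounded_linear_add bounded_linear_ident bounded_linear_compose[OF bounded_linear_scaleR_right] A_linear)

lemma norm_jump_power: "norm ((jump ^^ n) x) \<le> norm x"
  by (induction n) (auto simp: jump_def intro: order_trans[OF jump_contraction])

lemma jump_series_summable:
  assumes "summable (\<lambda>n. \<bar>c n\<bar>)"
  shows "summable (\<lambda>n. c n *\<^sub>R (jump ^^ n) x)"
proof (rule summable_comparison_test')
  show "summable (\<lambda>n. \<bar>c n\<bar> * norm x)" using assms by (rule summable_mult2)
  show "norm (c n *\<^sub>R (jump ^^ n) x) \<le> \<bar>c n\<bar> * norm x" for n
    by (simp add: mult_left_mono norm_jump_power)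
qed

lemma norm_jump_series_le:
  assumes "summable (\<lambda>n. \<bar>c n\<bar>)"
  shows "norm (\<Sum>n. c n *\<^sub>R (jump ^^ n) x) \<le> (\<Sum>n. \<bar>c n\<bar>) * norm x"
proof -
  have le: "norm (c n *\<^sub>R (jump ^^ n) x) \<le> \<bar>c n\<bar> * norm x" for n
    by (simp add: mult_left_mono norm_jump_power)
  have sm: "summable (\<lambda>n. \<bar>c n\<bar> * norm x)" using assms by (rule summable_mult2)
  have "norm (\<Sum>n. c n *\<^sub>R (jump ^^ n) x) \<le> (\<Sum>n. norm (c n *\<^sub>R (jump ^^ n) x))"
    by (rule summable_norm) (rule summable_comparison_test'[OF sm], use le in auto)
  also have "\<dots> \<le> (\<Sum>n. \<bar>c n\<bar> * norm x)"
    by (intro suminf_le le sm) (rule summable_comparison_test'[OF sm], use le in auto)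
  also have "\<dots> = (\<Sum>n. \<bar>c n\<bar>) * norm x" using suminf_mult2[OF assms] by simp
  finally show ?thesis .
qed

definition jump_exp :: "real \<Rightarrow> 'x \<Rightarrow> 'x" where
  "jump_exp t x = (\<Sum>n. ((S * t) ^ n / fact n) *\<^sub>R (jump ^^ n) x)"

lemma exp_coefficients_sums: "(\<lambda>n. r ^ n / fact n) sums exp (r :: real)"
  using exp_converges[of r] by (simp add: divide_inverse mult.commute)

lemma exp_coefficients_summable: "summable (\<lambda>n. \<bar>(r :: real) ^ n / fact n\<bar>)"
  using sums_summable[OF exp_coefficients_sums[of "\<bar>r\<bar>"]] by (simp add: power_abs)

lemma jump_exp_0: "jump_exp 0 x = x"
proof -
  have "jump_exp 0 x = (\<Sum>n. if n = 0 then x else 0)"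
    unfolding jump_exp_def by (intro arg_cong[where f = suminf] ext) auto
  also have "\<dots> = x" using sums_unique[OF sums_single[of 0 "\<lambda>_. x"]] by simp
  finally show ?thesis .
qed

text \<open>All Taylor remainders of the scalar coefficients are nonnegative for \<open>t, h \<ge> 0\<close>, so the remainder of
  the vector-valued series is dominated by that of the scalar exponential.\<close>
lemma jump_exp_remainder:
  assumes t: "0 \<le> t" and h: "0 \<le> h"
  shows "norm (jump_exp (t + h) x - jump_exp t x - h *\<^sub>R S *\<^sub>R jump (jump_exp t x))
    \<le> (exp (S * (t + h)) - exp (S * t) - h * S * exp (S * t)) * norm x"
proof -
  define s where "s = S * t"
  define k where "k = S * h"
  have sk: "0 \<le> s" "0 \<le> k" using t h S_pos by (auto simp: s_def k_def)
  define a where "a r n = r ^ n / (fact n :: real)" for r :: real and n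
  \<comment> \<open>Applying \<open>jump\<close> to the series raises every power by one, so the
    coefficients are shifted and a \<open>0\<close> enters in front.\<close>
  define a' where "a' n = (case n of 0 \<Rightarrow> 0 | Suc m \<Rightarrow> a s m)" for n
  define R where "R n = a (s + k) n - a s n - k * a' n" for n
  have R: "0 \<le> R n" for n
  proof (cases n)
    case (Suc m)
    have "R n = ((s + k) ^ Suc m - (s ^ Suc m + real (Suc m) * k * s ^ m)) / fact (Suc m)"
      unfolding R_def a_def a'_def Suc by (simp add: diff_divide_distrib add_divide_distrib del: of_nat_Suc power_Suc)
    then show ?thesis using power_Suc_add_ge[OF sk, of m] by simp
  qed (simp add: R_def a_def a'_def)
  have as: "a r sums exp r" for r unfolding a_def by (rule exp_coefficients_sums)
  have a's: "a' sums exp s"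
  proof -
    have "(\<lambda>n. a' (Suc n)) sums exp s" unfolding a'_def using as by simp
    then show ?thesis by (subst (asm) sums_Suc_iff) (simp add: a'_def)
  qed
  have Rs: "R sums (exp (s + k) - exp s - k * exp s)"
    unfolding R_def by (intro sums_diff sums_mult as a's)
  have ax: "(\<lambda>n. a (S * t) n *\<^sub>R (jump ^^ n) x) sums jump_exp t x" for t
    unfolding jump_exp_def a_def
    by (intro summable_sums jump_series_summable exp_coefficients_summable)
  have a'x: "(\<lambda>n. a' n *\<^sub>R (jump ^^ n) x) sums jump (jump_exp t x)"
  proof -
    interpret jump: bounded_linear jump by (rule jump_linear)
    have "(\<lambda>n. jump (a s n *\<^sub>R (jump ^^ n) x)) sums jump (jump_exp t x)"
      using ax[of t] by (intro jump.sums) (simp add: s_def)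
    then have "(\<lambda>n. a' (Suc n) *\<^sub>R (jump ^^ Suc n) x) sums jump (jump_exp t x)"
      by (simp add: jump.scaleR a'_def)
    then show ?thesis by (subst (asm) sums_Suc_iff) (simp add: a'_def)
  qed
  have "(\<lambda>n. a (s + k) n *\<^sub>R (jump ^^ n) x - a s n *\<^sub>R (jump ^^ n) x - k *\<^sub>R (a' n *\<^sub>R (jump ^^ n) x))
      sums (jump_exp (t + h) x - jump_exp t x - k *\<^sub>R jump (jump_exp t x))"
    using ax[of "t + h"] ax[of t]
    by (intro sums_diff bounded_linear.sums[OF bounded_linear_scaleR_right] a'x) (auto simp: s_def k_def algebra_simps)
  then have "(\<lambda>n. R n *\<^sub>R (jump ^^ n) x) sums (jump_exp (t + h) x - jump_exp t x - k *\<^sub>R jump (jump_exp t x))"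
    by (simp add: R_def scaleR_diff_left)
  then have "jump_exp (t + h) x - jump_exp t x - k *\<^sub>R jump (jump_exp t x) = (\<Sum>n. R n *\<^sub>R (jump ^^ n) x)"
    by (rule sums_unique)
  also have "norm \<dots> \<le> (\<Sum>n. \<bar>R n\<bar>) * norm x"
    using Rs R by (intro norm_jump_series_le) (auto simp: sums_iff)
  also have "(\<Sum>n. \<bar>R n\<bar>) = exp (s + k) - exp s - k * exp s"
    using sums_unique[OF Rs] R by simp
  finally show ?thesis by (simp add: s_def k_def algebra_simps)
qed

text \<open>The remainder estimate reduces this to the differentiability of the scalar function
  \<open>exp (S * t)\<close>.\<close>

lemma jump_exp_right_derivative:
  assumes t: "0 \<le> t"
  shows "((\<lambda>t. jump_exp t x) has_vector_derivative S *\<^sub>R jump (jump_exp t x)) (at t within {t..})"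
  unfolding has_vector_derivative_def has_derivative_within_alt
proof (intro conjI allI impI)
  show "bounded_linear (\<lambda>h. h *\<^sub>R S *\<^sub>R jump (jump_exp t x))" by (rule bounded_linear_scaleR_left)
  fix e :: real assume e: "0 < e"
  \<comment> \<open>The summand \<open>1\<close> keeps the quotient meaningful for
    \<open>x = 0\<close>.\<close>
  define e' where "e' = e / (norm x + 1)"
  have e': "0 < e'" unfolding e'_def using e by (intro divide_pos_pos) (auto intro: add_nonneg_pos)
  have "((\<lambda>t. exp (S * t)) has_derivative (\<lambda>h. h * (S * exp (S * t)))) (at t within {t..})"
    by (auto intro!: derivative_eq_intros)
  then obtain d where d: "0 < d"
    "\<And>y. y \<in> {t..} \<Longrightarrow> norm (y - t) < d \<Longrightarrow>
       norm (exp (S * y) - exp (S * t) - (y - t) * (S * exp (S * t))) \<le> e' * norm (y - t)"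
    using e' unfolding has_derivative_within_alt by meson
  show "\<exists>d>0. \<forall>y\<in>{t..}. norm (y - t) < d \<longrightarrow>
      norm (jump_exp y x - jump_exp t x - (y - t) *\<^sub>R S *\<^sub>R jump (jump_exp t x)) \<le> e * norm (y - t)"
  proof (intro exI[of _ d] conjI ballI impI d)
    fix y assume y: "y \<in> {t..}" "norm (y - t) < d"
    have "norm (jump_exp y x - jump_exp t x - (y - t) *\<^sub>R S *\<^sub>R jump (jump_exp t x))
        \<le> (exp (S * y) - exp (S * t) - (y - t) * S * exp (S * t)) * norm x"
      using jump_exp_remainder[of t "y - t" x] t y by simp
    also have "\<dots> \<le> (e' * norm (y - t)) * norm x"
      using d(2)[OF y] by (intro mult_right_mono) (auto simp: algebra_simps)
    also have "\<dots> = (e' * norm x) * norm (y - t)" by simp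
    also have "\<dots> \<le> e * norm (y - t)"
    proof (rule mult_right_mono)
      have "norm x / (norm x + 1) \<le> 1" by (subst pos_divide_le_eq) (auto intro: add_nonneg_pos)
      then have "e * (norm x / (norm x + 1)) \<le> e * 1" using e by (intro mult_left_mono) auto
      then show "e' * norm x \<le> e" by (simp add: e'_def)
    qed simp
    finally show "norm (jump_exp y x - jump_exp t x - (y - t) *\<^sub>R S *\<^sub>R jump (jump_exp t x)) \<le> e * norm (y - t)" .
  qed
qed

text \<open>For \<open>t \<le> s\<close> all coefficients increase from \<open>t\<close> to
  \<open>s\<close>, so the absolute values of their differences sum to
  \<open>exp (S * s) - exp (S * t)\<close>.\<close>

lemma jump_exp_continuous_on: "continuous_on {0..T} (\<lambda>t. jump_exp t x)"
proof -
  define E where "E t = exp (S * t)" for t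
  have ord: "norm (jump_exp s x - jump_exp t x) \<le> \<bar>E s - E t\<bar> * norm x"
    if "0 \<le> t" "t \<le> s" for s t
  proof -
    have c: "summable (\<lambda>n. \<bar>(S * s) ^ n / fact n - (S * t) ^ n / fact n\<bar>)"
      by (rule summable_comparison_test'[OF summable_add[OF exp_coefficients_summable[of "S * s"]
            exp_coefficients_summable[of "S * t"]], of 0])
         (simp only: real_norm_def abs_abs abs_triangle_ineq4)
    have nn: "0 \<le> (S * s) ^ n / fact n - (S * t) ^ n / fact n" for n
      using that S_pos by (simp add: divide_right_mono power_mono)
    have "jump_exp s x - jump_exp t x = (\<Sum>n. ((S * s) ^ n / fact n - (S * t) ^ n / fact n) *\<^sub>R (jump ^^ n) x)"
      unfolding jump_exp_def scaleR_diff_left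
      by (intro suminf_diff jump_series_summable exp_coefficients_summable)
    also have "norm \<dots> \<le> (\<Sum>n. \<bar>(S * s) ^ n / fact n - (S * t) ^ n / fact n\<bar>) * norm x"
      by (rule norm_jump_series_le[OF c])
    also have "(\<Sum>n. \<bar>(S * s) ^ n / fact n - (S * t) ^ n / fact n\<bar>) = E s - E t"
      unfolding abs_of_nonneg[OF nn] E_def
      by (intro sums_unique[symmetric] sums_diff exp_coefficients_sums)
    also have "(E s - E t) * norm x \<le> \<bar>E s - E t\<bar> * norm x" by (intro mult_right_mono) auto
    finally show ?thesis .
  qed
  have bound: "norm (jump_exp s x - jump_exp t x) \<le> \<bar>E s - E t\<bar> * norm x"
    if "s \<in> {0..T}" "t \<in> {0..T}" for s t
  proof (cases "t \<le> s")
    case True then show ?thesis using that by (intro ord) auto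
  next
    case False
    then have "norm (jump_exp t x - jump_exp s x) \<le> \<bar>E t - E s\<bar> * norm x" using that by (intro ord) auto
    then show ?thesis by (simp only: norm_minus_commute[of "jump_exp t x"] abs_minus_commute[of "E t"])
  qed
  show ?thesis unfolding continuous_on_def
  proof
    fix t assume t: "t \<in> {0..T}"
    have "((\<lambda>s. \<bar>E s - E t\<bar> * norm x) \<longlongrightarrow> \<bar>E t - E t\<bar> * norm x) (at t within {0..T})"
      unfolding E_def by (intro tendsto_intros)
    then have "((\<lambda>s. \<bar>E s - E t\<bar> * norm x) \<longlongrightarrow> 0) (at t within {0..T})" by simp
    then have "((\<lambda>s. jump_exp s x - jump_exp t x) \<longlongrightarrow> 0) (at t within {0..T})"
      by (rule Lim_null_comparison[rotated])
         (auto simp: eventually_at_filter intro!: bound always_eventually t)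
    then show "((\<lambda>s. jump_exp s x) \<longlongrightarrow> jump_exp t x) (at t within {0..T})" by (simp add: LIM_zero_iff)
  qed
qed

text \<open>Both sides solve \<open>w' = A w\<close> from the right with initial value
  \<open>x\<close>: the factor \<open>exp (- S t)\<close> turns the derivative
  \<open>S * jump\<close> of the exponential series into \<open>S * (jump - 1) = A\<close>. Their
  difference starts at \<open>0\<close> and its norm cannot grow.\<close>

lemma V_eq_poisson_series:
  assumes T: "0 \<le> T"
  shows "V T x = (\<Sum>n. poisson (S * T) n *\<^sub>R (jump ^^ n) x)"
proof -
  define y where "y t = exp (- (S * t)) *\<^sub>R jump_exp t x" for t
  define w where "w t = V t x - y t" for t
  interpret A: bounded_linear A by (rule A_linear)
  have "norm (w T) \<le> norm (w 0)"
  proof (rule norm_solution_nonincreasing[OF _ T])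
    show "continuous_on {0..T} w"
      unfolding w_def y_def by (intro continuous_intros V_continuous_on jump_exp_continuous_on)
    fix t assume t: "0 \<le> t" "t < T"
    have "(w has_vector_derivative A (V t x)
        - (exp (- (S * t)) *\<^sub>R S *\<^sub>R jump (jump_exp t x) + (- S * exp (- (S * t))) *\<^sub>R jump_exp t x)) (at t within {t..})"
      unfolding w_def y_def
      by (intro has_vector_derivative_diff has_vector_derivative_scaleR V_right_derivative jump_exp_right_derivative t)
         (auto intro!: derivative_eq_intros)
    also have "A (V t x) - (exp (- (S * t)) *\<^sub>R S *\<^sub>R jump (jump_exp t x) + (- S * exp (- (S * t))) *\<^sub>R jump_exp t x)
        = A (w t)"
      using S_pos by (simp add: w_def y_def jump_def A.diff A.scaleR algebra_simps)
    finally show "(w has_vector_derivative A (w t)) (at t within {t..})" .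
  qed
  then have "V T x = y T" by (simp add: w_def y_def V_0 jump_exp_0)
  also have "\<dots> = (\<Sum>n. exp (- (S * T)) *\<^sub>R (((S * T) ^ n / fact n) *\<^sub>R (jump ^^ n) x))"
    unfolding y_def jump_exp_def
    by (intro bounded_linear.suminf[OF bounded_linear_scaleR_right] jump_series_summable exp_coefficients_summable)
  finally show ?thesis by (simp add: poisson_def)
qed

text \<open>Kernel vectors are fixed points of \<open>jump\<close>, and the Poisson weights sum to
  \<open>1\<close>.\<close>

lemma V_fixes_kernel:
  assumes "0 \<le> t" "A x = 0"
  shows "V t x = x"
proof -
  have "jump x = x" by (simp add: jump_def assms)
  then have "(jump ^^ n) x = x" for n by (induction n) auto
  then have "V t x = (\<Sum>n. poisson (S * t) n *\<^sub>R x)" by (simp only: V_eq_poisson_series[OF assms(1)])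
  also have "\<dots> = x"
    using sums_unique[OF sums_scaleR_left[OF poisson_sums[of "S * t"], of x], symmetric] by simp
  finally show ?thesis .
qed

text \<open>Summation by parts moves \<open>jump - 1\<close> onto the Poisson weights, whose total variation is at most
  the inverse square root of their mean.\<close>
lemma norm_V_generator_le:
  assumes t: "0 < t"
  shows "norm (V t (A x)) \<le> S / sqrt (S * t) * norm x"
proof -
  define m where "m = S * t"
  have m: "0 < m" using S_pos t by (simp add: m_def)
  interpret jump: bounded_linear jump by (rule jump_linear)
  have lin: "bounded_linear (jump ^^ n)" for n
  proof (induction n)
    case 0 then show ?case using bounded_linear_ident by (simp add: id_def)
  next
    case (Suc n) then show ?case using bounded_linear_compose[OF jump_linear Suc] by (simp add: comp_def)
  qed
  have Ax: "A x = S *\<^sub>R (jump x - x)" using S_pos by (simp add: jump_def)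
  have pow: "(jump ^^ n) (A x) = S *\<^sub>R ((jump ^^ Suc n) x - (jump ^^ n) x)" for n
    unfolding Ax linear_cmul[OF bounded_linear.linear[OF lin]] linear_diff[OF bounded_linear.linear[OF lin]]
    by (simp only: funpow_Suc_right comp_def)
  have psum: "summable (\<lambda>n. \<bar>poisson m n\<bar>)"
    using sums_summable[OF poisson_sums[of m]] poisson_nonneg[of m] m by simp
  \<comment> \<open>The weights moved one place to the right. With the value \<open>0\<close> at
    \<open>n = 0\<close>, the formula for \<open>poisson m n - p' n\<close> holds there as
    well.\<close>
  define p' where "p' n = (case n of 0 \<Rightarrow> 0 | Suc k \<Rightarrow> poisson m k)" for n
  have p': "poisson m n - p' n = poisson m n * (1 - real n / m)" for n
  proof (cases n)
    case (Suc k)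
    have "poisson m k = poisson m n * (real n / m)"
      using poisson_Suc[of k m] m Suc by (simp add: eq_divide_eq mult.commute)
    moreover have "p' n = poisson m k" by (simp add: p'_def Suc)
    ultimately show ?thesis by (simp only: right_diff_distrib mult_1_right)
  qed (simp add: p'_def)
  have p's: "summable (\<lambda>n. \<bar>p' n\<bar>)"
    using psum summable_Suc_iff[of "\<lambda>n. \<bar>p' n\<bar>"] by (simp add: p'_def)
  have 1: "(\<lambda>n. poisson m n *\<^sub>R (jump ^^ Suc n) x) sums (\<Sum>n. p' n *\<^sub>R (jump ^^ n) x)"
  proof -
    have "(\<lambda>n. p' n *\<^sub>R (jump ^^ n) x) sums (\<Sum>n. p' n *\<^sub>R (jump ^^ n) x)"
      by (intro summable_sums jump_series_summable p's)
    then have "(\<lambda>n. p' (Suc n) *\<^sub>R (jump ^^ Suc n) x) sums (\<Sum>n. p' n *\<^sub>R (jump ^^ n) x)"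
      by (subst sums_Suc_iff) (simp add: p'_def)
    then show ?thesis by (simp add: p'_def)
  qed
  have 2: "(\<lambda>n. poisson m n *\<^sub>R (jump ^^ n) x) sums (\<Sum>n. poisson m n *\<^sub>R (jump ^^ n) x)"
    by (intro summable_sums jump_series_summable psum)
  have "(\<lambda>n. poisson m n *\<^sub>R (jump ^^ n) (A x)) sums
      (S *\<^sub>R ((\<Sum>n. p' n *\<^sub>R (jump ^^ n) x) - (\<Sum>n. poisson m n *\<^sub>R (jump ^^ n) x)))"
    using bounded_linear.sums[OF bounded_linear_scaleR_right sums_diff[OF 1 2], of S]
    by (simp only: pow scaleR_diff_right scaleR_scaleR mult.commute[of S])
  then have "V t (A x) = S *\<^sub>R ((\<Sum>n. p' n *\<^sub>R (jump ^^ n) x) - (\<Sum>n. poisson m n *\<^sub>R (jump ^^ n) x))"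
    using V_eq_poisson_series[of t "A x"] t by (simp add: m_def sums_iff)
  also have "\<dots> = - (S *\<^sub>R (\<Sum>n. (poisson m n - p' n) *\<^sub>R (jump ^^ n) x))"
    unfolding scaleR_diff_left
    using suminf_diff[OF jump_series_summable[OF psum] jump_series_summable[OF p's], of x x, symmetric]
    by (simp add: scaleR_diff_right)
  finally have "norm (V t (A x)) = S * norm (\<Sum>n. (poisson m n - p' n) *\<^sub>R (jump ^^ n) x)"
    using S_pos by simp
  also have "\<dots> \<le> S * ((\<Sum>n. \<bar>poisson m n - p' n\<bar>) * norm x)"
    using S_pos poisson_deviation_sum(1)[OF m] by (intro mult_left_mono norm_jump_series_le) (auto simp: p')
  also have "\<dots> \<le> S * (1 / sqrt m * norm x)"
    using S_pos poisson_deviation_sum(2)[OF m] by (intro mult_left_mono mult_right_mono) (auto simp: p')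
  finally show ?thesis by (simp add: m_def)
qed

end

section \<open>The Banach space of integrable functions modulo null sets\<close>

lemma L1_eq_refl: "L1_eq f f"
  by (simp add: L1_eq_def)

lemma L1_eq_sym: "L1_eq f g \<Longrightarrow> L1_eq g f"
  by (auto simp: L1_eq_def)

lemma L1_eq_trans: "L1_eq f g \<Longrightarrow> L1_eq g h \<Longrightarrow> L1_eq f h"
  unfolding L1_eq_def by (elim AE_mp) auto

lemma L1_norm_cong:
  assumes "f \<in> L1" "g \<in> L1" "L1_eq f g"
  shows "L1_norm f = L1_norm g"
  unfolding L1_norm_def
  by (rule integral_cong_AE) (use assms in \<open>auto simp: L1_def L1_eq_def\<close>)

lemma L1_norm_nonneg: "0 \<le> L1_norm f"
  by (simp add: L1_norm_def)

lemma L1_norm_eq_0: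
  assumes "f \<in> L1"
  shows "L1_norm f = 0 \<longleftrightarrow> L1_eq f (\<lambda>v. 0)"
  using assms integral_nonneg_eq_0_iff_AE[of lborel "\<lambda>v. \<bar>f v\<bar>"]
  by (simp add: L1_def L1_norm_def L1_eq_def)

lemma L1_intros:
  "(\<lambda>v. 0) \<in> L1"
  "f \<in> L1 \<Longrightarrow> g \<in> L1 \<Longrightarrow> (\<lambda>v. f v + g v) \<in> L1"
  "f \<in> L1 \<Longrightarrow> g \<in> L1 \<Longrightarrow> (\<lambda>v. f v - g v) \<in> L1"
  "f \<in> L1 \<Longrightarrow> (\<lambda>v. - f v) \<in> L1"
  "f \<in> L1 \<Longrightarrow> (\<lambda>v. a * f v) \<in> L1"
  "f \<in> L1 \<Longrightarrow> (\<lambda>v. f v / a) \<in> L1"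
  by (auto simp: L1_def)

lemma L1_norm_triangle:
  assumes "f \<in> L1" "g \<in> L1"
  shows "L1_norm (\<lambda>v. f v + g v) \<le> L1_norm f + L1_norm g"
proof -
  have "L1_norm (\<lambda>v. f v + g v) \<le> (\<integral>v. \<bar>f v\<bar> + \<bar>g v\<bar> \<partial>lborel)"
    unfolding L1_norm_def using assms by (intro integral_mono) (auto simp: L1_def)
  also have "\<dots> = L1_norm f + L1_norm g"
    unfolding L1_norm_def using assms by (intro Bochner_Integration.integral_add) (auto simp: L1_def)
  finally show ?thesis .
qed

lemma L1_norm_scale: "L1_norm (\<lambda>v. a * f v) = \<bar>a\<bar> * L1_norm f"
  by (simp add: L1_norm_def abs_mult)

lemma L1_bounded_linear_add:
  "L1_bounded_linear T \<Longrightarrow> f \<in> L1 \<Longrightarrow> g \<in> L1 \<Longrightarrow> L1_eq (T (\<lambda>v. f v + g v)) (\<lambda>v. T f v + T g v)"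
  unfolding L1_bounded_linear_def by (elim conjE) (drule bspec, assumption, drule bspec, assumption)+

lemma L1_bounded_linear_scale:
  "L1_bounded_linear T \<Longrightarrow> f \<in> L1 \<Longrightarrow> L1_eq (T (\<lambda>v. a * f v)) (\<lambda>v. a * T f v)"
  unfolding L1_bounded_linear_def by (elim conjE) (drule spec[of _ a], drule bspec, assumption)+

lemma L1_bounded_linear_cong:
  assumes T: "L1_bounded_linear T" and f: "f \<in> L1" and g: "g \<in> L1" and eq: "L1_eq f g"
  shows "L1_eq (T f) (T g)"
proof -
  let ?d = "\<lambda>v. f v - g v"
  have d: "?d \<in> L1" using f g by (rule L1_intros)
  have "L1_eq ?d (\<lambda>v. 0)" using eq by (simp add: L1_eq_def)
  then have "L1_norm ?d = 0" using d by (simp add: L1_norm_eq_0)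
  moreover obtain C where "L1_norm (T ?d) \<le> C * L1_norm ?d"
    using T d by (auto simp: L1_bounded_linear_def)
  ultimately have "L1_norm (T ?d) = 0" using L1_norm_nonneg[of "T ?d"] by simp
  moreover have "T ?d \<in> L1" using T d by (auto simp: L1_bounded_linear_def)
  ultimately have 1: "L1_eq (T ?d) (\<lambda>v. 0)" by (simp add: L1_norm_eq_0)
  have 2: "L1_eq (T (\<lambda>v. g v + ?d v)) (\<lambda>v. T g v + T ?d v)"
    by (rule L1_bounded_linear_add[OF T g d])
  have "(\<lambda>v. g v + ?d v) = f" by auto
  with 2 have 2: "L1_eq (T f) (\<lambda>v. T g v + T ?d v)" by simp
  from 1 2 show ?thesis unfolding L1_eq_def by eventually_elim simp
qed

\<comment> \<open>The abstract semigroup argument needs a Banach space as a type, while the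
  operators act on functions. The partial relation at once restricts to integrable functions and
  identifies those that agree almost everywhere.\<close>
quotient_type (overloaded) 'a l1 = "'a::euclidean_space \<Rightarrow> real" / partial: "\<lambda>f g. f \<in> L1 \<and> g \<in> L1 \<and> L1_eq f g"
proof (rule part_equivpI)
  show "\<exists>x. x \<in> L1 \<and> x \<in> L1 \<and> L1_eq x (x :: 'a \<Rightarrow> real)"
    using L1_intros(1) L1_eq_refl by blast
qed (auto simp: symp_def transp_def intro: L1_eq_sym L1_eq_trans)

lemma abs_l1_eq: "f \<in> L1 \<Longrightarrow> g \<in> L1 \<Longrightarrow> abs_l1 f = abs_l1 g \<longleftrightarrow> L1_eq f g"
  using Quotient_rel[OF Quotient_l1, of f g] L1_eq_refl by blast

lemma rep_l1_L1: "rep_l1 x \<in> L1"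
  using Quotient_rep_reflp[OF Quotient_l1, of x] by blast

lemma abs_rep_l1: "abs_l1 (rep_l1 x) = x"
  by (rule Quotient_abs_rep[OF Quotient_l1])

lemma rep_abs_l1: "f \<in> L1 \<Longrightarrow> L1_eq (rep_l1 (abs_l1 f)) f"
  using Quotient_rep_abs[OF Quotient_l1, of f] L1_eq_refl by blast

lemma l1_cases:
  obtains f where "f \<in> L1" "x = abs_l1 f"
  using rep_l1_L1 abs_rep_l1 by metis

instantiation l1 :: (euclidean_space) real_normed_vector
begin

definition "0 = abs_l1 (\<lambda>v. 0)"
definition "x + y = abs_l1 (\<lambda>v. rep_l1 x v + rep_l1 y v)"
definition "x - y = abs_l1 (\<lambda>v. rep_l1 x v - rep_l1 y v)"
definition "- x = abs_l1 (\<lambda>v. - rep_l1 x v)"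
definition "a *\<^sub>R x = abs_l1 (\<lambda>v. a * rep_l1 x v)"
definition "norm x = L1_norm (rep_l1 x)"
definition "dist x y = norm (x - y :: 'a l1)"
definition "sgn x = inverse (norm x) *\<^sub>R (x :: 'a l1)"
definition "(uniformity :: ('a l1 \<times> 'a l1) filter) = (INF e\<in>{0 <..}. principal {(x, y). dist x y < e})"
definition "open U = (\<forall>x\<in>U. \<forall>\<^sub>F (x', y) in uniformity. x' = x \<longrightarrow> y \<in> (U :: 'a l1 set))"

lemma abs_l1_add: "f \<in> L1 \<Longrightarrow> g \<in> L1 \<Longrightarrow> abs_l1 f + abs_l1 g = abs_l1 (\<lambda>v. f v + g v)"
  using rep_abs_l1[of f] rep_abs_l1[of g] unfolding plus_l1_def
  by (subst abs_l1_eq) (auto intro!: L1_intros rep_l1_L1 simp: L1_eq_def elim!: AE_mp)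

lemma abs_l1_diff: "f \<in> L1 \<Longrightarrow> g \<in> L1 \<Longrightarrow> abs_l1 f - abs_l1 g = abs_l1 (\<lambda>v. f v - g v)"
  using rep_abs_l1[of f] rep_abs_l1[of g] unfolding minus_l1_def
  by (subst abs_l1_eq) (auto intro!: L1_intros rep_l1_L1 simp: L1_eq_def elim!: AE_mp)

lemma abs_l1_minus: "f \<in> L1 \<Longrightarrow> - abs_l1 f = abs_l1 (\<lambda>v. - f v)"
  using rep_abs_l1[of f] unfolding uminus_l1_def
  by (subst abs_l1_eq) (auto intro!: L1_intros rep_l1_L1 simp: L1_eq_def elim!: AE_mp)

lemma abs_l1_scaleR: "f \<in> L1 \<Longrightarrow> a *\<^sub>R abs_l1 f = abs_l1 (\<lambda>v. a * f v)"
  using rep_abs_l1[of f] unfolding scaleR_l1_def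
  by (subst abs_l1_eq) (auto intro!: L1_intros rep_l1_L1 simp: L1_eq_def elim!: AE_mp)

lemma norm_abs_l1: "f \<in> L1 \<Longrightarrow> norm (abs_l1 f) = L1_norm f"
  unfolding norm_l1_def by (intro L1_norm_cong rep_l1_L1 rep_abs_l1)

instance
proof
  fix x y z :: "'a l1" and a b :: real
  obtain f where f: "f \<in> L1" "x = abs_l1 f" by (rule l1_cases)
  obtain g where g: "g \<in> L1" "y = abs_l1 g" by (rule l1_cases)
  obtain h where h: "h \<in> L1" "z = abs_l1 h" by (rule l1_cases)
  note L = f g h abs_l1_add abs_l1_diff abs_l1_minus abs_l1_scaleR norm_abs_l1 zero_l1_def L1_intros
  show "x + y + z = x + (y + z)" by (simp add: L add.assoc)
  show "x + y = y + x" by (simp add: L add.commute)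
  show "0 + x = x" by (simp add: L)
  show "- x + x = 0" by (simp add: L)
  show "x - y = x + - y" by (simp add: L)
  show "a *\<^sub>R (x + y) = a *\<^sub>R x + a *\<^sub>R y" by (simp add: L distrib_left)
  show "(a + b) *\<^sub>R x = a *\<^sub>R x + b *\<^sub>R x" by (simp add: L distrib_right)
  show "a *\<^sub>R b *\<^sub>R x = (a * b) *\<^sub>R x" by (simp add: L mult.assoc)
  show "1 *\<^sub>R x = x" by (simp add: L)
  show "norm x = 0 \<longleftrightarrow> x = 0" by (simp add: L L1_norm_eq_0 abs_l1_eq)
  show "norm (x + y) \<le> norm x + norm y" by (simp add: L L1_norm_triangle)
  show "norm (a *\<^sub>R x) = \<bar>a\<bar> * norm x" by (simp add: L L1_norm_scale)
qed (rule dist_l1_def sgn_l1_def uniformity_l1_def open_l1_def)+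

end

text \<open>The Riesz-Fischer theorem: a subsequence converges almost everywhere, and Fatou's lemma
  turns the Cauchy condition into convergence in norm to that pointwise limit.\<close>

instance l1 :: (euclidean_space) banach
proof
  fix X :: "nat \<Rightarrow> 'a l1"
  assume C: "Cauchy X"
  define s where "s n = rep_l1 (X n)" for n
  have sL: "s n \<in> L1" for n by (simp add: s_def rep_l1_L1)
  then have int: "integrable lborel (s n)" for n by (simp add: L1_def)
  note [measurable] = borel_measurable_integrable[OF int]
  have nrm: "norm (X i - X j) = (\<integral>v. norm (s i v - s j v) \<partial>lborel)" for i j
  proof -
    have "X i = abs_l1 (s i)" "X j = abs_l1 (s j)" by (simp_all add: s_def abs_rep_l1)
    then show ?thesis using sL by (simp add: abs_l1_diff norm_abs_l1 L1_intros) (simp add: L1_norm_def)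
  qed
  have cau: "\<exists>N. \<forall>i\<ge>N. \<forall>j\<ge>N. (\<integral>v. norm (s i v - s j v) \<partial>lborel) < e" if "0 < e" for e
    using C that unfolding Cauchy_iff nrm[symmetric] by blast
  obtain r where r: "strict_mono r" "AE v in lborel. Cauchy (\<lambda>i. s (r i) v)"
    using cauchy_L1_AE_cauchy_subseq[OF int cau] by blast
  define f where "f v = lim (\<lambda>i. s (r i) v)" for v
  have [measurable]: "f \<in> borel_measurable lborel" unfolding f_def by measurable
  have lim: "AE v in lborel. (\<lambda>i. s (r i) v) \<longlonglongrightarrow> f v"
    using r(2) by eventually_elim (simp add: f_def Cauchy_convergent_iff convergent_LIMSEQ_iff)
  \<comment> \<open>Only the second index runs through the subsequence; since \<open>n\<close> is
    arbitrary, the estimate already concerns the whole sequence.\<close>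
  have fatou: "(\<integral>\<^sup>+v. ennreal (norm (s n v - f v)) \<partial>lborel) \<le> ennreal e"
    if "0 < e" "\<And>i j. i \<ge> N \<Longrightarrow> j \<ge> N \<Longrightarrow> (\<integral>v. norm (s i v - s j v) \<partial>lborel) < e" "n \<ge> N" for n N e
  proof -
    have "(\<integral>\<^sup>+v. ennreal (norm (s n v - f v)) \<partial>lborel)
        = (\<integral>\<^sup>+v. liminf (\<lambda>i. ennreal (norm (s n v - s (r i) v))) \<partial>lborel)"
    proof (rule nn_integral_cong_AE, use lim in eventually_elim)
      case (elim v)
      then have "(\<lambda>i. ennreal (norm (s n v - s (r i) v))) \<longlonglongrightarrow> ennreal (norm (s n v - f v))"
        by (intro tendsto_intros)
      then show ?case using lim_imp_Liminf[OF sequentially_bot] by force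
    qed
    also have "\<dots> \<le> liminf (\<lambda>i. \<integral>\<^sup>+v. ennreal (norm (s n v - s (r i) v)) \<partial>lborel)"
      by (rule nn_integral_liminf) measurable
    also have "\<dots> \<le> liminf (\<lambda>i. ennreal e)"
    proof (rule Liminf_mono, rule eventually_sequentiallyI[of N])
      fix i assume "N \<le> i"
      then have "N \<le> r i" using seq_suble[OF r(1), of i] by simp
      then have "(\<integral>v. norm (s n v - s (r i) v) \<partial>lborel) < e" using that by blast
      then show "(\<integral>\<^sup>+v. ennreal (norm (s n v - s (r i) v)) \<partial>lborel) \<le> ennreal e"
        using int by (subst nn_integral_eq_integral) (auto intro!: ennreal_leI)
    qed
    also have "\<dots> = ennreal e" by (rule Liminf_const) simp
    finally show ?thesis .
  qed
  \<comment> \<open>Integrability of the limit: it differs from the integrable \<open>s N1\<close>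
    by a function of norm at most \<open>1\<close>.\<close>
  obtain N1 where "\<forall>i\<ge>N1. \<forall>j\<ge>N1. (\<integral>v. norm (s i v - s j v) \<partial>lborel) < 1" using cau[of 1] by auto
  then have "(\<integral>\<^sup>+v. ennreal (norm (s N1 v - f v)) \<partial>lborel) \<le> ennreal 1" by (intro fatou[of 1 N1 N1]) auto
  then have "integrable lborel (\<lambda>v. s N1 v - f v)"
    by (intro integrableI_bounded) (auto intro: le_less_trans)
  from Bochner_Integration.integrable_diff[OF int[of N1] this] have fint: "integrable lborel f" by simp
  then have fL: "f \<in> L1" by (simp add: L1_def)
  have "X \<longlonglongrightarrow> abs_l1 f"
  proof (rule LIMSEQ_I)
    fix e :: real assume e: "0 < e"
    then have e2: "0 < e / 2" by simp
    obtain N where N: "\<forall>i\<ge>N. \<forall>j\<ge>N. (\<integral>v. norm (s i v - s j v) \<partial>lborel) < e / 2" using cau[OF e2] by auto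
    have "norm (X n - abs_l1 f) < e" if "n \<ge> N" for n
    proof -
      have "ennreal (\<integral>v. norm (s n v - f v) \<partial>lborel) = (\<integral>\<^sup>+v. ennreal (norm (s n v - f v)) \<partial>lborel)"
        using int fint by (subst nn_integral_eq_integral) auto
      also have "\<dots> \<le> ennreal (e / 2)" using fatou[OF e2, of N n] N that by blast
      finally have "(\<integral>v. norm (s n v - f v) \<partial>lborel) \<le> e / 2" using e by simp
      moreover have "norm (X n - abs_l1 f) = (\<integral>v. norm (s n v - f v) \<partial>lborel)"
      proof -
        have "X n = abs_l1 (s n)" by (simp add: s_def abs_rep_l1)
        then show ?thesis using sL fL by (simp add: abs_l1_diff norm_abs_l1 L1_intros) (simp add: L1_norm_def)
      qed
      ultimately show ?thesis using e by simp
    qed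
    then show "\<exists>no. \<forall>n\<ge>no. norm (X n - abs_l1 f) < e" by blast
  qed
  then show "convergent X" by (auto simp: convergent_def)
qed

section \<open>Transfer of operators and semigroups to the quotient space\<close>

lemma L1_bounded_linear_lift:
  assumes T: "L1_bounded_linear T"
  shows "bounded_linear (\<lambda>x. abs_l1 (T (rep_l1 x)))"
    and "f \<in> L1 \<Longrightarrow> abs_l1 (T (rep_l1 (abs_l1 f))) = abs_l1 (T f)"
proof -
  have TL: "f \<in> L1 \<Longrightarrow> T f \<in> L1" for f using T by (auto simp: L1_bounded_linear_def)
  show eq: "abs_l1 (T (rep_l1 (abs_l1 f))) = abs_l1 (T f)" if "f \<in> L1" for f
    using that by (subst abs_l1_eq) (auto intro!: TL rep_l1_L1 L1_bounded_linear_cong[OF T] rep_abs_l1)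
  show "bounded_linear (\<lambda>x. abs_l1 (T (rep_l1 x)))"
  proof -
    obtain C where C: "\<And>f. f \<in> L1 \<Longrightarrow> L1_norm (T f) \<le> C * L1_norm f"
      using T unfolding L1_bounded_linear_def by blast
    show ?thesis
    proof (rule bounded_linear_intro[where K = C])
      fix x y :: "'a l1" and a :: real
      obtain f where f: "f \<in> L1" "x = abs_l1 f" by (rule l1_cases)
      obtain g where g: "g \<in> L1" "y = abs_l1 g" by (rule l1_cases)
      note L = f g abs_l1_add abs_l1_scaleR norm_abs_l1 L1_intros eq TL
      show "abs_l1 (T (rep_l1 (x + y))) = abs_l1 (T (rep_l1 x)) + abs_l1 (T (rep_l1 y))"
        using L1_bounded_linear_add[OF T f(1) g(1)] by (simp add: L abs_l1_eq)
      show "abs_l1 (T (rep_l1 (a *\<^sub>R x))) = a *\<^sub>R abs_l1 (T (rep_l1 x))"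
        using L1_bounded_linear_scale[OF T f(1)] by (simp add: L abs_l1_eq)
      show "norm (abs_l1 (T (rep_l1 x))) \<le> norm x * C"
        using C[OF f(1)] by (simp add: L mult.commute)
    qed
  qed
qed

lemma L1_dissipative_semigroup:
  assumes V: "C0_semigroup V" and gen: "generated_by V A" and A: "L1_bounded_linear A"
    and S: "0 < S" and contr: "\<And>f. f \<in> L1 \<Longrightarrow> L1_norm (\<lambda>v. f v + 1 / S * A f v) \<le> L1_norm f"
  shows "dissipative_semigroup (\<lambda>t x. abs_l1 (V t (rep_l1 x))) (\<lambda>x. abs_l1 (A (rep_l1 x))) S"
proof (rule dissipative_semigroup.intro)
  have VT: "L1_bounded_linear (V t)" if "0 \<le> t" for t using V that by (auto simp: C0_semigroup_def)
  have VL: "V t f \<in> L1" if "0 \<le> t" "f \<in> L1" for t f using VT that by (auto simp: L1_bounded_linear_def)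
  have AL: "A f \<in> L1" if "f \<in> L1" for f using A that by (auto simp: L1_bounded_linear_def)
  note Veq = L1_bounded_linear_lift(2)[OF VT] and Aeq = L1_bounded_linear_lift(2)[OF A]
  show "bounded_linear (\<lambda>x. abs_l1 (V t (rep_l1 x)))" if "0 \<le> t" for t
    by (intro L1_bounded_linear_lift VT that)
  show "bounded_linear (\<lambda>x. abs_l1 (A (rep_l1 x)))" by (intro L1_bounded_linear_lift A)
  fix x :: "'a l1"
  obtain f where f: "f \<in> L1" "x = abs_l1 f" by (rule l1_cases)
  have V0f: "L1_eq (V 0 f) f" using V f by (auto simp: C0_semigroup_def)
  show "abs_l1 (V 0 (rep_l1 x)) = x" using V0f f VL[of 0 f] by (simp add: Veq abs_l1_eq)
  show "abs_l1 (V (s + t) (rep_l1 x)) = abs_l1 (V s (rep_l1 (abs_l1 (V t (rep_l1 x)))))"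
    if "0 \<le> s" "0 \<le> t" for s t
  proof -
    have "L1_eq (V (s + t) f) (V s (V t f))" using V f that by (auto simp: C0_semigroup_def)
    then show ?thesis using f that by (simp add: Veq VL abs_l1_eq)
  qed
  \<comment> \<open>The generator's domain is all of \<open>L1\<close>, which gives the derivative
    at \<open>0\<close> for every vector of the quotient.\<close>
  have "(f, A f) \<in> generator_graph V"
    using gen f AL by (auto simp: generated_by_def L1_eq_refl)
  then have lim: "((\<lambda>t. L1_norm (\<lambda>v. (V t f v - f v) / t - A f v)) \<longlongrightarrow> 0) (at_right 0)"
    by (simp add: generator_graph_def)
  have "\<forall>\<^sub>F t in at_right 0. L1_norm (\<lambda>v. (V t f v - f v) / t - A f v)
      = norm ((abs_l1 (V t (rep_l1 x)) - x) /\<^sub>R t - abs_l1 (A (rep_l1 x)))"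
    unfolding eventually_at_filter
  proof (intro always_eventually allI impI)
    fix t :: real assume "t \<noteq> 0" "t \<in> {0<..}"
    then have t: "0 \<le> t" by simp
    have "(\<lambda>v. (V t f v - f v) / t) = (\<lambda>v. inverse t * (V t f v - f v))" by (simp add: divide_inverse mult.commute)
    then show "L1_norm (\<lambda>v. (V t f v - f v) / t - A f v)
        = norm ((abs_l1 (V t (rep_l1 x)) - x) /\<^sub>R t - abs_l1 (A (rep_l1 x)))"
      using f t
      by (simp add: Veq Aeq VL AL abs_l1_diff abs_l1_scaleR L1_intros norm_abs_l1 divide_inverse mult.commute)
  qed
  then have "((\<lambda>t. norm ((abs_l1 (V t (rep_l1 x)) - x) /\<^sub>R t - abs_l1 (A (rep_l1 x)))) \<longlongrightarrow> 0) (at_right 0)"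
    by (rule Lim_transform_eventually[OF lim])
  then show "((\<lambda>t. (abs_l1 (V t (rep_l1 x)) - x) /\<^sub>R t) \<longlongrightarrow> abs_l1 (A (rep_l1 x))) (at_right 0)"
    by (simp add: LIM_zero_iff tendsto_norm_zero_iff)
  show "norm (x + (1 / S) *\<^sub>R abs_l1 (A (rep_l1 x))) \<le> norm x"
  proof -
    have "x + (1 / S) *\<^sub>R abs_l1 (A (rep_l1 x)) = abs_l1 (\<lambda>v. f v + 1 / S * A f v)"
      unfolding f(2) Aeq[OF f(1)] abs_l1_scaleR[OF AL[OF f(1)]]
      by (intro abs_l1_add f L1_intros AL)
    then show ?thesis using contr[OF f(1)] f by (simp add: norm_abs_l1 L1_intros AL)
  qed
qed (rule S)

lemma L1_semigroup_generator_decay: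
  assumes V: "C0_semigroup V" and gen: "generated_by V A" and A: "L1_bounded_linear A"
    and S: "0 < S" and contr: "\<And>f. f \<in> L1 \<Longrightarrow> L1_norm (\<lambda>v. f v + 1 / S * A f v) \<le> L1_norm f"
    and g: "g \<in> L1" and t: "0 < t"
  shows "L1_norm (V t (A g)) \<le> S / sqrt (S * t) * L1_norm g"
proof -
  interpret dissipative_semigroup "\<lambda>t x. abs_l1 (V t (rep_l1 x))" "\<lambda>x. abs_l1 (A (rep_l1 x))" S
    by (rule L1_dissipative_semigroup) fact+
  have VT: "L1_bounded_linear (V t)" using V t by (auto simp: C0_semigroup_def)
  have Ag: "A g \<in> L1" using A g by (auto simp: L1_bounded_linear_def)
  have VAg: "V t (A g) \<in> L1" using VT Ag by (auto simp: L1_bounded_linear_def)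
  from norm_V_generator_le[OF t, of "abs_l1 g"] show ?thesis
    by (simp add: L1_bounded_linear_lift(2)[OF A g] L1_bounded_linear_lift(2)[OF VT Ag] norm_abs_l1 VAg g)
qed

lemma L1_semigroup_contraction:
  assumes V: "C0_semigroup V" and gen: "generated_by V A" and A: "L1_bounded_linear A"
    and S: "0 < S" and contr: "\<And>f. f \<in> L1 \<Longrightarrow> L1_norm (\<lambda>v. f v + 1 / S * A f v) \<le> L1_norm f"
    and f: "f \<in> L1" and t: "0 \<le> t"
  shows "L1_norm (V t f) \<le> L1_norm f"
proof -
  interpret dissipative_semigroup "\<lambda>t x. abs_l1 (V t (rep_l1 x))" "\<lambda>x. abs_l1 (A (rep_l1 x))" S
    by (rule L1_dissipative_semigroup) fact+
  have VT: "L1_bounded_linear (V t)" using V t by (auto simp: C0_semigroup_def)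
  then have "V t f \<in> L1" using f by (auto simp: L1_bounded_linear_def)
  with norm_V_le[OF t, of "abs_l1 f"] show ?thesis
    by (simp add: L1_bounded_linear_lift(2)[OF VT f] norm_abs_l1 f)
qed

lemma L1_semigroup_fixes_kernel:
  assumes V: "C0_semigroup V" and gen: "generated_by V A" and A: "L1_bounded_linear A"
    and S: "0 < S" and contr: "\<And>f. f \<in> L1 \<Longrightarrow> L1_norm (\<lambda>v. f v + 1 / S * A f v) \<le> L1_norm f"
    and h: "h \<in> L1_ker A" and t: "0 \<le> t"
  shows "L1_eq (V t h) h"
proof -
  interpret dissipative_semigroup "\<lambda>t x. abs_l1 (V t (rep_l1 x))" "\<lambda>x. abs_l1 (A (rep_l1 x))" S
    by (rule L1_dissipative_semigroup) fact+
  have VT: "L1_bounded_linear (V t)" using V t by (auto simp: C0_semigroup_def)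
  have hL: "h \<in> L1" and Ah: "L1_eq (A h) (\<lambda>v. 0)" using h by (auto simp: L1_ker_def)
  have AhL: "A h \<in> L1" and Vh: "V t h \<in> L1" using A VT hL by (auto simp: L1_bounded_linear_def)
  have "abs_l1 (A h) = 0" using Ah AhL by (simp add: zero_l1_def abs_l1_eq L1_intros)
  then show ?thesis
    using V_fixes_kernel[OF t, of "abs_l1 h"]
    by (simp add: L1_bounded_linear_lift(2)[OF A hL] L1_bounded_linear_lift(2)[OF VT hL] abs_l1_eq Vh hL)
qed

section \<open>The surface measure of the sphere\<close>

lemma sphere_projection_measurable:
  "(\<lambda>x::'a::euclidean_space. x /\<^sub>R norm x)
    \<in> restrict_space lborel (cball 0 1 - {0}) \<rightarrow>\<^sub>M restrict_space borel (sphere 0 1)"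
proof (rule measurable_restrict_space2)
  show "(\<lambda>x::'a. x /\<^sub>R norm x) \<in> restrict_space lborel (cball 0 1 - {0}) \<rightarrow>\<^sub>M borel"
    by (rule measurable_restrict_space1) measurable
qed (auto simp: space_restrict_space)

lemma space_sphere_measure [simp]: "space (sphere_measure :: 'a::euclidean_space measure) = sphere 0 1"
  by (simp add: sphere_measure_def space_scale_measure space_restrict_space)

lemma sets_sphere_measure: "sets (sphere_measure :: 'a::euclidean_space measure) = sets (restrict_space borel (sphere 0 1))"
  by (simp add: sphere_measure_def)

lemma ident_measurable_sphere_measure: "(\<lambda>s. s) \<in> (sphere_measure :: 'a::euclidean_space measure) \<rightarrow>\<^sub>M borel"
proof -
  have "(\<lambda>s. s) \<in> restrict_space (borel :: 'a measure) (sphere 0 1) \<rightarrow>\<^sub>M borel"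
    by (rule measurable_restrict_space1) simp
  then show ?thesis by (simp add: measurable_cong_sets[OF sets_sphere_measure refl])
qed

text \<open>The sigma-algebra lives on the sphere alone, so integrands are taken Borel on the whole
  space and composed with the inclusion.\<close>

lemma measurable_sphere_measure: "f \<in> (borel :: 'a::euclidean_space measure) \<rightarrow>\<^sub>M N \<Longrightarrow> f \<in> sphere_measure \<rightarrow>\<^sub>M N"
  by (rule measurable_compose[OF ident_measurable_sphere_measure])

lemma measurable_pair_sphere_measure:
  assumes "f \<in> M \<Otimes>\<^sub>M (borel :: 'a::euclidean_space measure) \<rightarrow>\<^sub>M N"
  shows "f \<in> M \<Otimes>\<^sub>M sphere_measure \<rightarrow>\<^sub>M N"
proof -
  have "(\<lambda>x. (fst x, snd x)) \<in> M \<Otimes>\<^sub>M sphere_measure \<rightarrow>\<^sub>M M \<Otimes>\<^sub>M (borel :: 'a measure)"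
    by (intro measurable_Pair measurable_fst measurable_compose[OF measurable_snd ident_measurable_sphere_measure])
  from measurable_compose[OF this assms] show ?thesis by simp
qed

lemma nn_integral_sphere_measure:
  fixes F :: "'a::euclidean_space \<Rightarrow> ennreal"
  assumes F: "F \<in> borel_measurable borel"
  shows "(\<integral>\<^sup>+s. F s \<partial>sphere_measure)
    = of_nat DIM('a) * (\<integral>\<^sup>+x. F (x /\<^sub>R norm x) * indicator (cball 0 1 - {0}) x \<partial>lborel)"
proof -
  have 1: "F \<in> borel_measurable (restrict_space borel (sphere 0 1))"
    by (rule measurable_restrict_space1[OF F])
  have "(\<integral>\<^sup>+s. F s \<partial>sphere_measure) = of_nat DIM('a) *
      (\<integral>\<^sup>+s. F s \<partial>(distr (restrict_space lborel (cball 0 1 - {0})) (restrict_space borel (sphere 0 1)) (\<lambda>x. x /\<^sub>R norm x)))"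
    unfolding sphere_measure_def by (rule nn_integral_scale_measure) (simp add: 1)
  also have "\<dots> = of_nat DIM('a) * (\<integral>\<^sup>+x. F (x /\<^sub>R norm x) \<partial>(restrict_space lborel (cball 0 1 - {0})))"
    by (subst nn_integral_distr[OF sphere_projection_measurable]) (auto simp: 1)
  also have "\<dots> = of_nat DIM('a) * (\<integral>\<^sup>+x. F (x /\<^sub>R norm x) * indicator (cball 0 1 - {0}) x \<partial>lborel)"
    by (subst nn_integral_restrict_space) auto
  finally show ?thesis .
qed

lemma finite_measure_sphere_measure: "finite_measure (sphere_measure :: 'a::euclidean_space measure)"
proof
  have "emeasure (sphere_measure :: 'a measure) (space sphere_measure) = (\<integral>\<^sup>+s. 1 \<partial>(sphere_measure :: 'a measure))"
    by simp
  also have "\<dots> = of_nat DIM('a) * (\<integral>\<^sup>+x. indicator (cball 0 1 - {0}) x \<partial>(lborel :: 'a measure))"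
    by (subst nn_integral_sphere_measure) auto
  also have "\<dots> \<le> of_nat DIM('a) * emeasure lborel (cball (0::'a) 1)"
    by (intro mult_left_mono) (auto intro!: emeasure_mono)
  also have "\<dots> < \<infinity>" using emeasure_lborel_cball_finite[of "0::'a" 1]
    by (simp add: ennreal_mult_less_top of_nat_less_top)
  finally show "emeasure (sphere_measure :: 'a measure) (space sphere_measure) \<noteq> \<infinity>" by simp
qed

interpretation sphere_measure: finite_measure "sphere_measure :: 'a::euclidean_space measure"
  by (rule finite_measure_sphere_measure)

interpretation lborel_sphere: pair_sigma_finite "lborel :: 'a::euclidean_space measure" "sphere_measure :: 'a measure" ..

interpretation sphere_pair: pair_sigma_finite "sphere_measure :: 'a::euclidean_space measure" "sphere_measure :: 'a measure" ..

section \<open>Changes of variables for Lebesgue measure and polar coordinates\<close>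

lemma nn_integral_lborel_scale:
  fixes F :: "'a::euclidean_space \<Rightarrow> ennreal"
  assumes F: "F \<in> borel_measurable borel" and c: "0 < c"
  shows "(\<integral>\<^sup>+x. F x \<partial>lborel) = ennreal (c ^ DIM('a)) * (\<integral>\<^sup>+x. F (c *\<^sub>R x) \<partial>lborel)"
proof -
  have "(\<integral>\<^sup>+x. F x \<partial>lborel) = (\<integral>\<^sup>+x. F x \<partial>density (distr lborel borel (\<lambda>x. 0 + c *\<^sub>R x)) (\<lambda>_. \<bar>c\<bar> ^ DIM('a)))"
    using lborel_affine[of c "0::'a"] c by (intro arg_cong2[where f=nn_integral] refl) (auto simp: ennreal_power)
  also have "\<dots> = ennreal (c ^ DIM('a)) * (\<integral>\<^sup>+x. F (c *\<^sub>R x) \<partial>lborel)"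
    using c F by (simp add: nn_integral_density nn_integral_distr nn_integral_cmult ennreal_power)
  finally show ?thesis .
qed

lemma nn_integral_lborel_translate:
  fixes F :: "'a::euclidean_space \<Rightarrow> ennreal"
  assumes F: "F \<in> borel_measurable borel"
  shows "(\<integral>\<^sup>+x. F (a + x) \<partial>lborel) = (\<integral>\<^sup>+x. F x \<partial>lborel)"
proof -
  have "(\<integral>\<^sup>+x. F x \<partial>lborel) = (\<integral>\<^sup>+x. F x \<partial>distr lborel borel ((+) a))" by (simp add: lborel_distr_plus)
  also have "\<dots> = (\<integral>\<^sup>+x. F (a + x) \<partial>lborel)" using F by (subst nn_integral_distr) auto
  finally show ?thesis by simp
qed

lemma nn_integral_lborel_uminus:
  fixes F :: "'a::euclidean_space \<Rightarrow> ennreal"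
  assumes F: "F \<in> borel_measurable borel"
  shows "(\<integral>\<^sup>+x. F (- x) \<partial>lborel) = (\<integral>\<^sup>+x. F x \<partial>lborel)"
proof -
  have "(\<integral>\<^sup>+x. F x \<partial>lborel) = (\<integral>\<^sup>+x. F x \<partial>density (distr lborel borel (\<lambda>x. 0 + (-1) *\<^sub>R x)) (\<lambda>_. 1))"
    using lborel_affine[of "-1" "0::'a"] by (intro arg_cong2[where f=nn_integral] refl) auto
  also have "\<dots> = (\<integral>\<^sup>+x. F (- x) \<partial>lborel)"
    using F by (simp add: nn_integral_density nn_integral_distr)
  finally show ?thesis by simp
qed

lemma nn_integral_inverse_power:
  fixes a :: real
  assumes a: "0 < a" and d: "0 < d"
  shows "(\<integral>\<^sup>+s. ennreal (real d / s ^ Suc d) * indicator {a..} s \<partial>lborel) = ennreal (1 / a ^ d)"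
proof -
  have "(\<integral>\<^sup>+s. ennreal (real d / s ^ Suc d) * indicator {a..} s \<partial>lborel) = ennreal (0 - (- (1 / a ^ d)))"
  proof (rule nn_integral_FTC_atLeast)
    show "((\<lambda>s::real. - (1 / s ^ d)) has_real_derivative real d / x ^ Suc d) (at x)" if "a \<le> x" for x
    proof -
      have x: "0 < x" using a that by simp
      obtain k where k: "d = Suc k" using d by (cases d) auto
      have "((\<lambda>s::real. - (1 / s ^ d)) has_real_derivative - ((0 * x ^ d - 1 * (real d * (1 * x ^ (d - Suc 0)))) / (x ^ d * x ^ d))) (at x)"
        using x by (intro DERIV_minus DERIV_divide DERIV_const DERIV_power DERIV_ident) auto
      moreover have "- ((0 * x ^ d - 1 * (real d * (1 * x ^ (d - Suc 0)))) / (x ^ d * x ^ d)) = real d / x ^ Suc d"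
        using x unfolding k by (simp add: field_simps)
      ultimately show ?thesis by simp
    qed
    have "filterlim (\<lambda>s::real. s ^ d) at_top at_top"
      using d by (intro filterlim_pow_at_top filterlim_ident) auto
    then have "((\<lambda>s::real. 1 / s ^ d) \<longlongrightarrow> 0) at_top"
      by (intro tendsto_divide_0[OF tendsto_const] filterlim_at_top_imp_at_infinity)
    then show "((\<lambda>s::real. - (1 / s ^ d)) \<longlongrightarrow> 0) at_top" by (metis minus_zero tendsto_minus)
  qed (use a in auto)
  then show ?thesis by simp
qed

text \<open>Integrating over all dilates of the unit ball (the variable \<open>s\<close> below) turns the definition of the
  surface measure into the polar coordinates formula by Fubini's theorem alone.\<close>
lemma nn_integral_polar:
  fixes F :: "'a::euclidean_space \<Rightarrow> ennreal"
  assumes F [measurable]: "F \<in> borel_measurable borel"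
  shows "(\<integral>\<^sup>+x. F x \<partial>lborel)
    = (\<integral>\<^sup>+s. (\<integral>\<^sup>+r. F (r *\<^sub>R s) * ennreal (r ^ (DIM('a) - 1)) * indicator {0<..} r \<partial>lborel) \<partial>sphere_measure)"
    (is "_ = ?R")
proof -
  define d where "d = DIM('a)"
  have d: "0 < d" by (simp add: d_def)
  define B :: "'a set" where "B = cball 0 1 - {0}"
  have [measurable]: "B \<in> sets borel" by (simp add: B_def)
  \<comment> \<open>With \<open>r = |x| s\<close> the radial weight \<open>r^(d-1) dr\<close>
    becomes \<open>|x|^d s^(d-1) ds\<close>; \<open>W\<close> is the integrand in the variables
    \<open>x\<close> and \<open>s\<close>.\<close>
  define W where "W x s = F (s *\<^sub>R x) * ennreal (norm x ^ d) * indicator B x * ennreal (s ^ (d - 1)) * indicator {0<..} s"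
    for x :: 'a and s :: real
  have Wm [measurable]: "(\<lambda>(x, s). W x s) \<in> borel_measurable (borel \<Otimes>\<^sub>M borel)"
    unfolding W_def by measurable
  have inner: "(\<integral>\<^sup>+r. F (r *\<^sub>R (x /\<^sub>R norm x)) * ennreal (r ^ (d - 1)) * indicator {0<..} r \<partial>lborel) * indicator B x
      = (\<integral>\<^sup>+s. W x s \<partial>lborel)" for x
  proof (cases "x \<in> B")
    case True
    then have n: "0 < norm x" by (simp add: B_def)
    have "(\<integral>\<^sup>+r. F (r *\<^sub>R (x /\<^sub>R norm x)) * ennreal (r ^ (d - 1)) * indicator {0<..} r \<partial>lborel)
        = ennreal \<bar>norm x\<bar> * (\<integral>\<^sup>+s. F ((0 + norm x * s) *\<^sub>R (x /\<^sub>R norm x)) * ennreal ((0 + norm x * s) ^ (d - 1))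
            * indicator {0<..} (0 + norm x * s) \<partial>lborel)"
      using n by (intro nn_integral_real_affine) auto
    also have "\<dots> = (\<integral>\<^sup>+s. ennreal (norm x) * (F ((norm x * s) *\<^sub>R (x /\<^sub>R norm x)) * ennreal ((norm x * s) ^ (d - 1))
            * indicator {0<..} (norm x * s)) \<partial>lborel)"
      by (subst nn_integral_cmult) auto
    also have "\<dots> = (\<integral>\<^sup>+s. W x s \<partial>lborel)"
    proof (rule nn_integral_cong)
      fix s :: real
      have "norm x * (norm x * s) ^ (d - 1) = norm x ^ d * s ^ (d - 1)"
        using d by (cases d) (auto simp: power_mult_distrib)
      then have e: "0 < s \<Longrightarrow> ennreal (norm x) * ennreal ((norm x * s) ^ (d - 1)) = ennreal (norm x ^ d) * ennreal (s ^ (d - 1))"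
        using n by (simp flip: ennreal_mult)
      have s: "(norm x * s) *\<^sub>R (x /\<^sub>R norm x) = s *\<^sub>R x" using n by simp
      show "ennreal (norm x) * (F ((norm x * s) *\<^sub>R (x /\<^sub>R norm x)) * ennreal ((norm x * s) ^ (d - 1))
            * indicator {0<..} (norm x * s)) = W x s"
      proof (cases "0 < s")
        case s0: True
        have "ennreal (norm x) * (F (s *\<^sub>R x) * ennreal ((norm x * s) ^ (d - 1)))
            = F (s *\<^sub>R x) * (ennreal (norm x) * ennreal ((norm x * s) ^ (d - 1)))" by (simp only: mult_ac)
        then show ?thesis unfolding s e[OF s0] using s0 True n by (simp add: W_def mult_ac)
      next
        case False
        then have "\<not> 0 < norm x * s" using n by (simp add: zero_less_mult_iff)
        then show ?thesis using False by (simp add: W_def)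
      qed
    qed
    finally show ?thesis using True by simp
  next
    case False then show ?thesis by (simp add: W_def)
  qed
  \<comment> \<open>The substitution \<open>y = s x\<close> maps the punctured unit ball onto the
    one of radius \<open>s\<close> and collects the powers of \<open>s\<close> into
    \<open>s^(-d-1)\<close>.\<close>
  have outer: "of_nat d * (\<integral>\<^sup>+x. W x s \<partial>lborel)
      = (\<integral>\<^sup>+y. F y * ennreal (norm y ^ d) * indicator (- {0}) y * (ennreal (real d / s ^ Suc d) * indicator {norm y..} s) \<partial>lborel)"
    if s: "0 < s" for s
  proof -
    have "(\<integral>\<^sup>+x. W x s \<partial>lborel) = ennreal ((1 / s) ^ d) * (\<integral>\<^sup>+y. W ((1 / s) *\<^sub>R y) s \<partial>lborel)"
      unfolding d_def using s by (intro nn_integral_lborel_scale) auto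
    then have "of_nat d * (\<integral>\<^sup>+x. W x s \<partial>lborel) = (\<integral>\<^sup>+y. of_nat d * (ennreal ((1 / s) ^ d) * W ((1 / s) *\<^sub>R y) s) \<partial>lborel)"
      by (simp add: nn_integral_cmult)
    also have "\<dots> = (\<integral>\<^sup>+y. F y * ennreal (norm y ^ d) * indicator (- {0}) y * (ennreal (real d / s ^ Suc d) * indicator {norm y..} s) \<partial>lborel)"
    proof (rule nn_integral_cong)
      fix y :: 'a
      have B: "(1 / s) *\<^sub>R y \<in> B \<longleftrightarrow> y \<noteq> 0 \<and> norm y \<le> s" using s by (auto simp: B_def field_simps)
      have "real d * ((1 / s) ^ d * ((norm y / s) ^ d * s ^ (d - 1))) = norm y ^ d * (real d / s ^ Suc d)"
        using s d by (cases d) (auto simp: field_simps)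
      then have e: "of_nat d * (ennreal ((1 / s) ^ d) * (ennreal ((norm y / s) ^ d) * ennreal (s ^ (d - 1))))
          = ennreal (norm y ^ d) * ennreal (real d / s ^ Suc d)"
        using s by (simp add: ennreal_of_nat_eq_real_of_nat del: power_Suc flip: ennreal_mult)
      have W: "W ((1 / s) *\<^sub>R y) s = F y * ennreal ((norm y / s) ^ d) * indicator B ((1 / s) *\<^sub>R y) * ennreal (s ^ (d - 1))"
        using s by (simp add: W_def)
      show "of_nat d * (ennreal ((1 / s) ^ d) * W ((1 / s) *\<^sub>R y) s)
        = F y * ennreal (norm y ^ d) * indicator (- {0}) y * (ennreal (real d / s ^ Suc d) * indicator {norm y..} s)"
      proof (cases "y \<noteq> 0 \<and> norm y \<le> s")
        case True
        then have "of_nat d * (ennreal ((1 / s) ^ d) * W ((1 / s) *\<^sub>R y) s)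
          = F y * (of_nat d * (ennreal ((1 / s) ^ d) * (ennreal ((norm y / s) ^ d) * ennreal (s ^ (d - 1)))))"
          unfolding W using B by (simp add: mult_ac)
        then show ?thesis unfolding e using True by (simp add: mult_ac)
      next
        case False then show ?thesis unfolding W using B by (auto split: split_indicator)
      qed
    qed
    finally show ?thesis .
  qed
  have "?R = of_nat d * (\<integral>\<^sup>+x. (\<integral>\<^sup>+r. F (r *\<^sub>R (x /\<^sub>R norm x)) * ennreal (r ^ (d - 1)) * indicator {0<..} r \<partial>lborel) * indicator B x \<partial>lborel)"
    unfolding d_def B_def by (rule nn_integral_sphere_measure) measurable
  also have "\<dots> = of_nat d * (\<integral>\<^sup>+x. (\<integral>\<^sup>+s. W x s \<partial>lborel) \<partial>lborel)" by (simp only: inner)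
  also have "(\<integral>\<^sup>+x. (\<integral>\<^sup>+s. W x s \<partial>lborel) \<partial>lborel) = (\<integral>\<^sup>+s. (\<integral>\<^sup>+x. W x s \<partial>lborel) \<partial>lborel)"
    by (rule lborel_pair.Fubini'[symmetric]) (use Wm in \<open>simp add: case_prod_beta'\<close>)
  also have "of_nat d * (\<integral>\<^sup>+s. (\<integral>\<^sup>+x. W x s \<partial>lborel) \<partial>lborel) = (\<integral>\<^sup>+s. of_nat d * (\<integral>\<^sup>+x. W x s \<partial>lborel) \<partial>lborel)"
    by (rule nn_integral_cmult[symmetric]) measurable
  also have "\<dots> = (\<integral>\<^sup>+s. (\<integral>\<^sup>+y. F y * ennreal (norm y ^ d) * indicator (- {0}) y
        * (ennreal (real d / s ^ Suc d) * indicator {norm y..} s) \<partial>lborel) \<partial>lborel)"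
  proof (rule nn_integral_cong_AE, use AE_lborel_singleton[of "0::real"] in eventually_elim)
    case s0: (elim s)
    show "of_nat d * (\<integral>\<^sup>+x. W x s \<partial>lborel) = (\<integral>\<^sup>+y. F y * ennreal (norm y ^ d) * indicator (- {0}) y
        * (ennreal (real d / s ^ Suc d) * indicator {norm y..} s) \<partial>lborel)"
    proof (cases "0 < s")
      case False
      then have "W x s = 0" for x by (simp add: W_def)
      moreover have "indicator {norm y..} s = (0::ennreal)" for y :: 'a
        using False s0 norm_ge_zero[of y] by (auto simp: indicator_def simp del: norm_ge_zero)
      ultimately show ?thesis by simp
    qed (rule outer)
  qed
  also have "\<dots> = (\<integral>\<^sup>+y. (\<integral>\<^sup>+s. F y * ennreal (norm y ^ d) * indicator (- {0}) y
        * (ennreal (real d / s ^ Suc d) * indicator {norm y..} s) \<partial>lborel) \<partial>lborel)"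
  proof (rule lborel_pair.Fubini')
    have "(\<lambda>(y::'a, s). indicator {norm y..} (s::real) :: ennreal) = (\<lambda>(y, s). if norm y \<le> s then 1 else 0)"
      by (auto simp: indicator_def fun_eq_iff)
    then have [measurable]: "(\<lambda>(y::'a, s). indicator {norm y..} (s::real) :: ennreal) \<in> borel_measurable (lborel \<Otimes>\<^sub>M lborel)"
      by simp
    show "(\<lambda>(y, s). F y * ennreal (norm y ^ d) * indicator (- {0}) y
        * (ennreal (real d / s ^ Suc d) * indicator {norm y..} s)) \<in> borel_measurable (lborel \<Otimes>\<^sub>M lborel)"
      by measurable
  qed
  \<comment> \<open>Integrating \<open>d s^(-d-1)\<close> over \<open>s \<ge> |y|\<close> gives
    \<open>|y|^(-d)\<close>, which cancels the factor \<open>|y|^d\<close>.\<close>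
  also have "\<dots> = (\<integral>\<^sup>+y. F y \<partial>lborel)"
  proof (rule nn_integral_cong_AE, use AE_lborel_singleton[of "0::'a"] in eventually_elim)
    case (elim y)
    then have n: "0 < norm y" by simp
    have "(\<integral>\<^sup>+s. F y * ennreal (norm y ^ d) * indicator (- {0}) y
        * (ennreal (real d / s ^ Suc d) * indicator {norm y..} s) \<partial>lborel)
        = F y * ennreal (norm y ^ d) * indicator (- {0}) y * ennreal (1 / norm y ^ d)"
      by (subst nn_integral_cmult) (auto simp: nn_integral_inverse_power[OF n d] simp del: power_Suc)
    also have "\<dots> = F y * (ennreal (norm y ^ d) * ennreal (1 / norm y ^ d))" using n by (simp add: mult_ac)
    also have "ennreal (norm y ^ d) * ennreal (1 / norm y ^ d) = 1"
      using n by (simp flip: ennreal_mult)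
    finally show "(\<integral>\<^sup>+s. F y * ennreal (norm y ^ d) * indicator (- {0}) y
        * (ennreal (real d / s ^ Suc d) * indicator {norm y..} s) \<partial>lborel) = F y" by simp
  qed
  finally show ?thesis by simp
qed

text \<open>In polar coordinates \<open>z = r \<omega>\<close> the map swaps the unit vectors
  \<open>\<omega>\<close> and \<open>s\<close> and keeps \<open>r\<close>; the product of the two
  surface measures is symmetric.\<close>

lemma nn_integral_exchange_direction:
  fixes H :: "'a::euclidean_space \<times> 'a \<Rightarrow> ennreal"
  assumes H [measurable]: "H \<in> borel_measurable (borel \<Otimes>\<^sub>M borel)"
  shows "(\<integral>\<^sup>+z. (\<integral>\<^sup>+s. H (z, s) \<partial>sphere_measure) \<partial>lborel)
    = (\<integral>\<^sup>+z. (\<integral>\<^sup>+s. H (norm z *\<^sub>R s, z /\<^sub>R norm z) \<partial>sphere_measure) \<partial>lborel)"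
proof -
  define R where "R s \<omega> = (\<integral>\<^sup>+r. H (r *\<^sub>R \<omega>, s) * ennreal (r ^ (DIM('a) - 1)) * indicator {0<..} r \<partial>lborel)" for s \<omega> :: 'a
  have Rm: "(\<lambda>(s, \<omega>). R s \<omega>) \<in> borel_measurable (borel \<Otimes>\<^sub>M borel)" unfolding R_def by measurable
  have "(\<integral>\<^sup>+z. (\<integral>\<^sup>+s. H (z, s) \<partial>sphere_measure) \<partial>lborel) = (\<integral>\<^sup>+s. (\<integral>\<^sup>+z. H (z, s) \<partial>lborel) \<partial>sphere_measure)"
    by (rule lborel_sphere.Fubini'[symmetric]) (rule measurable_pair_sphere_measure, simp)
  also have "\<dots> = (\<integral>\<^sup>+s. (\<integral>\<^sup>+\<omega>. R s \<omega> \<partial>sphere_measure) \<partial>sphere_measure)"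
    unfolding R_def by (subst nn_integral_polar) auto
  also have "\<dots> = (\<integral>\<^sup>+\<omega>. (\<integral>\<^sup>+s. R s \<omega> \<partial>sphere_measure) \<partial>sphere_measure)"
  proof (rule sphere_pair.Fubini'[symmetric])
    have "(\<lambda>x. (fst x, snd x)) \<in> (sphere_measure :: 'a measure) \<Otimes>\<^sub>M (sphere_measure :: 'a measure) \<rightarrow>\<^sub>M borel \<Otimes>\<^sub>M borel"
      by (intro measurable_Pair measurable_compose[OF measurable_fst ident_measurable_sphere_measure]
          measurable_compose[OF measurable_snd ident_measurable_sphere_measure])
    from measurable_compose[OF this Rm] show "(\<lambda>(x, y). R x y) \<in> borel_measurable (sphere_measure \<Otimes>\<^sub>M sphere_measure)"
      by (simp add: case_prod_beta')
  qed
  also have "\<dots> = (\<integral>\<^sup>+\<omega>. (\<integral>\<^sup>+z. H (norm z *\<^sub>R \<omega>, z /\<^sub>R norm z) \<partial>lborel) \<partial>sphere_measure)"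
  proof (rule nn_integral_cong)
    fix \<omega> :: 'a
    have "(\<integral>\<^sup>+z. H (norm z *\<^sub>R \<omega>, z /\<^sub>R norm z) \<partial>lborel) =
        (\<integral>\<^sup>+s. (\<integral>\<^sup>+r. H (norm (r *\<^sub>R s) *\<^sub>R \<omega>, (r *\<^sub>R s) /\<^sub>R norm (r *\<^sub>R s)) * ennreal (r ^ (DIM('a) - 1)) * indicator {0<..} r \<partial>lborel) \<partial>sphere_measure)"
      by (rule nn_integral_polar) measurable
    also have "\<dots> = (\<integral>\<^sup>+s. R s \<omega> \<partial>sphere_measure)"
      unfolding R_def
      by (intro nn_integral_cong) (auto split: split_indicator)
    finally show "(\<integral>\<^sup>+s. R s \<omega> \<partial>sphere_measure) = (\<integral>\<^sup>+z. H (norm z *\<^sub>R \<omega>, z /\<^sub>R norm z) \<partial>lborel)" by simp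
  qed
  also have "\<dots> = (\<integral>\<^sup>+z. (\<integral>\<^sup>+s. H (norm z *\<^sub>R s, z /\<^sub>R norm z) \<partial>sphere_measure) \<partial>lborel)"
    by (rule lborel_sphere.Fubini') (rule measurable_pair_sphere_measure, simp)
  finally show ?thesis .
qed

text \<open>Up to normalisation on the unit ball, Lebesgue measure is the only translation-invariant measure:
  evaluate \<open>\<integral>\<integral> 1\<^sub>A(x) 1\<^sub>B(x + y) dx d\<mu>(y)\<close> in both orders.\<close>
lemma lborel_distr_isometry:
  fixes L :: "'a::euclidean_space \<Rightarrow> 'a"
  assumes L: "orthogonal_transformation L"
  shows "distr lborel borel L = (lborel :: 'a measure)"
proof (rule measure_eqI)
  have lin: "linear L" and nrm: "\<And>x. norm (L x) = norm x"
    using L by (auto simp: orthogonal_transformation orthogonal_transformation_linear)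
  have Lm [measurable]: "L \<in> borel_measurable borel"
    by (intro borel_measurable_continuous_onI linear_continuous_on linear_conv_bounded_linear[THEN iffD1] lin)
  have sur: "surj L" using L by (rule orthogonal_transformation_surj)
  define U where "U = cball (0::'a) 1"
  have U [measurable]: "U \<in> sets borel" by (simp add: U_def)
  fix A :: "'a set" assume "A \<in> sets (distr lborel borel L)"
  then have A [measurable]: "A \<in> sets borel" by simp
  let ?\<mu> = "\<lambda>A. \<integral>\<^sup>+x. indicator A (L x) \<partial>lborel :: ennreal"
  have tr: "(\<integral>\<^sup>+y. indicator B (y + c) \<partial>lborel) = emeasure lborel B" if [measurable]: "B \<in> sets borel" for B and c :: 'a
    using nn_integral_lborel_translate[of "indicator B :: 'a \<Rightarrow> ennreal" c] by (simp add: add.commute)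
  have "?\<mu> A * emeasure lborel U = (\<integral>\<^sup>+x. (\<integral>\<^sup>+y. indicator A (L x) * indicator U (y + L x) \<partial>lborel) \<partial>lborel)"
    by (simp add: nn_integral_cmult tr nn_integral_multc)
  also have "\<dots> = (\<integral>\<^sup>+y. (\<integral>\<^sup>+x. indicator A (L x) * indicator U (y + L x) \<partial>lborel) \<partial>lborel)"
    by (rule lborel_pair.Fubini'[symmetric]) (simp add: lborel_prod[symmetric])
  also have "\<dots> = (\<integral>\<^sup>+y. (\<integral>\<^sup>+x. indicator A (L x + - y) * indicator U (L x) \<partial>lborel) \<partial>lborel)"
  \<comment> \<open>Translating \<open>x\<close> by the preimage of \<open>y\<close> under
    \<open>L\<close> moves the shift by \<open>y\<close> from the argument of \<open>U\<close> to
    that of \<open>A\<close>.\<close>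
  proof (rule nn_integral_cong)
    fix y :: 'a
    obtain a where a: "y = L a" using sur by (metis surjD)
    have "(\<integral>\<^sup>+x. indicator A (L x) * indicator U (y + L x) \<partial>lborel)
        = (\<integral>\<^sup>+x. indicator A (L (a + x) + - y) * indicator U (L (a + x)) \<partial>lborel :: ennreal)"
      unfolding a using lin by (simp add: linear_add)
    also have "\<dots> = (\<integral>\<^sup>+x. indicator A (L x + - y) * indicator U (L x) \<partial>lborel)"
      by (rule nn_integral_lborel_translate) measurable
    finally show "(\<integral>\<^sup>+x. indicator A (L x) * indicator U (y + L x) \<partial>lborel)
        = (\<integral>\<^sup>+x. indicator A (L x + - y) * indicator U (L x) \<partial>lborel :: ennreal)" .
  qed
  also have "\<dots> = (\<integral>\<^sup>+x. (\<integral>\<^sup>+y. indicator A (L x + - y) * indicator U (L x) \<partial>lborel) \<partial>lborel)"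
    by (rule lborel_pair.Fubini') (simp add: lborel_prod[symmetric])
  also have "\<dots> = (\<integral>\<^sup>+x. emeasure lborel A * indicator U (L x) \<partial>lborel)"
  proof (rule nn_integral_cong)
    fix x :: 'a
    have "(\<integral>\<^sup>+y. indicator A (L x + - y) \<partial>lborel) = (\<integral>\<^sup>+y. indicator A (L x + y) \<partial>lborel :: ennreal)"
      by (rule nn_integral_lborel_uminus) measurable
    also have "\<dots> = emeasure lborel A" using tr[OF A, of "L x"] by (simp add: add.commute)
    finally show "(\<integral>\<^sup>+y. indicator A (L x + - y) * indicator U (L x) \<partial>lborel) = emeasure lborel A * indicator U (L x)"
      by (subst nn_integral_multc) auto
  qed
  also have "\<dots> = emeasure lborel A * ?\<mu> U" by (rule nn_integral_cmult) measurable
  \<comment> \<open>The isometry preserves the unit ball. This fixes the normalisation; the mass of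
    the ball is positive and finite and can be cancelled.\<close>
  also have "?\<mu> U = emeasure lborel U"
  proof -
    have "indicator U (L x) = (indicator U x :: ennreal)" for x by (auto simp: U_def nrm split: split_indicator)
    then show ?thesis by simp
  qed
  finally have *: "?\<mu> A * emeasure lborel U = emeasure lborel A * emeasure lborel U" .
  have "emeasure lborel U \<noteq> 0"
  proof -
    have "emeasure lborel (ball (0::'a) 1) \<le> emeasure lborel U" by (intro emeasure_mono) (auto simp: U_def)
    moreover have "emeasure lborel (ball (0::'a) 1) \<noteq> 0"
      using content_ball_pos[of 1 "0::'a"] by (auto simp: measure_def)
    ultimately show ?thesis by auto
  qed
  moreover have "emeasure lborel U < \<infinity>" unfolding U_def by (rule emeasure_lborel_cball_finite)
  ultimately have "?\<mu> A = emeasure lborel A"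
    using arg_cong[OF *, of "\<lambda>x. x / emeasure lborel U"] by (simp add: ennreal_mult_divide_eq)
  moreover have "L -` A \<in> sets borel" using measurable_sets_borel[OF Lm A] by simp
  ultimately show "emeasure (distr lborel borel L) A = emeasure lborel A"
    by (simp add: emeasure_distr indicator_vimage[unfolded comp_def fun_eq_iff, rule_format, symmetric])
qed simp

section \<open>Rotation invariance and zonal integrals\<close>

lemma nn_integral_lborel_isometry:
  fixes F :: "'a::euclidean_space \<Rightarrow> ennreal" and L :: "'a \<Rightarrow> 'a"
  assumes F: "F \<in> borel_measurable borel" and L: "orthogonal_transformation L"
  shows "(\<integral>\<^sup>+x. F (L x) \<partial>lborel) = (\<integral>\<^sup>+x. F x \<partial>lborel)"
proof -
  have [measurable]: "L \<in> borel_measurable borel"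
    using L by (intro borel_measurable_continuous_onI linear_continuous_on linear_conv_bounded_linear[THEN iffD1]
        orthogonal_transformation_linear)
  have "(\<integral>\<^sup>+x. F x \<partial>lborel) = (\<integral>\<^sup>+x. F x \<partial>distr lborel borel L)" by (simp add: lborel_distr_isometry[OF L])
  also have "\<dots> = (\<integral>\<^sup>+x. F (L x) \<partial>lborel)" using F by (subst nn_integral_distr) auto
  finally show ?thesis by simp
qed

text \<open>The cone construction inherits the invariance of Lebesgue measure: an isometry fixing
  \<open>0\<close> preserves the punctured ball and commutes with \<open>x / |x|\<close>.\<close>

lemma nn_integral_sphere_isometry:
  fixes F :: "'a::euclidean_space \<Rightarrow> ennreal" and L :: "'a \<Rightarrow> 'a"
  assumes F [measurable]: "F \<in> borel_measurable borel" and L: "orthogonal_transformation L"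
  shows "(\<integral>\<^sup>+s. F (L s) \<partial>sphere_measure) = (\<integral>\<^sup>+s. F s \<partial>sphere_measure)"
proof -
  have [measurable]: "L \<in> borel_measurable borel"
    using L by (intro borel_measurable_continuous_onI linear_continuous_on linear_conv_bounded_linear[THEN iffD1]
        orthogonal_transformation_linear)
  have nrm: "norm (L x) = norm x" for x using L by (simp add: orthogonal_transformation)
  have lin: "linear L" by (rule orthogonal_transformation_linear[OF L])
  have z: "L x = 0 \<longleftrightarrow> x = 0" for x using nrm[of x] by (metis norm_eq_zero)
  have "(\<integral>\<^sup>+x. F (L (x /\<^sub>R norm x)) * indicator (cball 0 1 - {0}) x \<partial>lborel)
      = (\<integral>\<^sup>+x. F (L x /\<^sub>R norm (L x)) * indicator (cball 0 1 - {0}) (L x) \<partial>lborel)"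
    by (intro nn_integral_cong) (auto simp: nrm z linear_scale[OF lin] split: split_indicator)
  also have "\<dots> = (\<integral>\<^sup>+x. F (x /\<^sub>R norm x) * indicator (cball 0 1 - {0}) x \<partial>lborel)"
  proof (rule nn_integral_lborel_isometry[OF _ L])
    have [measurable]: "cball 0 1 - {0::'a} \<in> sets borel" by simp
    show "(\<lambda>x::'a. F (x /\<^sub>R norm x) * indicator (cball 0 1 - {0}) x) \<in> borel_measurable borel" by measurable
  qed
  finally show ?thesis by (simp add: nn_integral_sphere_measure)
qed

text \<open>The Householder reflection along \<open>\<omega> - \<omega>'\<close> maps
  \<open>\<omega>\<close> to \<open>\<omega>'\<close>. This is why the angular mass is the same for
  all pairs of distinct velocities.\<close>

lemma nn_integral_sphere_zonal:
  fixes \<omega> \<omega>' :: "'a::euclidean_space" and g :: "real \<Rightarrow> ennreal"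
  assumes g [measurable]: "g \<in> borel_measurable borel" and n: "norm \<omega> = 1" "norm \<omega>' = 1"
  shows "(\<integral>\<^sup>+s. g (\<omega> \<bullet> s) \<partial>sphere_measure) = (\<integral>\<^sup>+s. g (\<omega>' \<bullet> s) \<partial>sphere_measure)"
proof (cases "\<omega> = \<omega>'")
  case False
  define u where "u = \<omega> - \<omega>'"
  have u: "u \<bullet> u \<noteq> 0" using False by (simp add: u_def)
  define L where "L x = x - (2 * (x \<bullet> u) / (u \<bullet> u)) *\<^sub>R u" for x
  have lin: "linear L" by (rule linearI) (simp_all add: L_def inner_add_left algebra_simps add_divide_distrib)
  have LL: "L x \<bullet> L y = x \<bullet> y" for x y
    using u by (simp add: L_def inner_diff_left inner_diff_right inner_commute field_simps)
  have orth: "orthogonal_transformation L" using lin LL by (simp add: orthogonal_transformation_def)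
  have "2 * (\<omega> \<bullet> u) = u \<bullet> u"
    using n by (simp add: u_def inner_diff_left inner_diff_right inner_commute norm_eq_sqrt_inner)
  then have "L \<omega> = \<omega>'" using u by (simp add: L_def u_def)
  then have "\<omega>' \<bullet> L s = \<omega> \<bullet> s" for s using LL[of \<omega> s] by simp
  then show ?thesis
    using nn_integral_sphere_isometry[OF _ orth, of "\<lambda>s. g (\<omega>' \<bullet> s)"] by simp
qed simp

text \<open>Average over the translates by \<open>t m\<close> with \<open>t\<close> in
  \<open>{0..1}\<close>: each has the same measure, while by Fubini's theorem the average is an
  integral of one-dimensional null sets.\<close>

lemma null_set_of_finite_line_sections:
  fixes A :: "'a::euclidean_space set" and m :: 'a
  assumes A [measurable]: "A \<in> sets borel" and fin: "\<And>x. finite {t::real. x + t *\<^sub>R m \<in> A}"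
  shows "emeasure lborel A = 0"
proof -
  have "emeasure lborel A = (\<integral>\<^sup>+t. emeasure lborel A * indicator {0..1::real} t \<partial>lborel)"
    by (subst nn_integral_cmult) auto
  also have "\<dots> = (\<integral>\<^sup>+t. (\<integral>\<^sup>+x. indicator A (x + t *\<^sub>R m) * indicator {0..1::real} t \<partial>lborel) \<partial>lborel)"
  proof (rule nn_integral_cong)
    fix t :: real
    have "(\<integral>\<^sup>+x. indicator A (x + t *\<^sub>R m) \<partial>lborel) = emeasure lborel A"
      using nn_integral_lborel_translate[of "indicator A :: 'a \<Rightarrow> ennreal" "t *\<^sub>R m"] by (simp add: add.commute)
    then show "emeasure lborel A * indicator {0..1} t
        = (\<integral>\<^sup>+x. indicator A (x + t *\<^sub>R m) * indicator {0..1::real} t \<partial>lborel)"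
      by (subst nn_integral_multc) auto
  qed
  also have "\<dots> = (\<integral>\<^sup>+x. (\<integral>\<^sup>+t. indicator A (x + t *\<^sub>R m) * indicator {0..1::real} t \<partial>lborel) \<partial>lborel)"
    by (rule lborel_pair.Fubini') measurable
  also have "\<dots> = (\<integral>\<^sup>+x. 0 \<partial>(lborel :: 'a measure))"
  proof (rule nn_integral_cong)
    fix x :: 'a
    have "AE t in lborel. t \<notin> {t. x + t *\<^sub>R m \<in> A}"
      by (rule AE_not_in) (use fin[of x] in \<open>simp add: finite_imp_null_set_lborel\<close>)
    then have "(\<integral>\<^sup>+t. indicator A (x + t *\<^sub>R m) * indicator {0..1::real} t \<partial>lborel) = (\<integral>\<^sup>+t. 0 \<partial>(lborel :: real measure))"
      by (intro nn_integral_cong_AE) (auto elim!: AE_mp split: split_indicator)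
    then show "(\<integral>\<^sup>+t. indicator A (x + t *\<^sub>R m) * indicator {0..1::real} t \<partial>lborel) = 0" by simp
  qed
  finally show ?thesis by simp
qed

lemma finite_quadratic_roots:
  fixes a b c :: real
  assumes "a \<noteq> 0"
  shows "finite {t. a * t\<^sup>2 + b * t + c = 0}"
proof -
  have "{t. a * t\<^sup>2 + b * t + c = 0} = {t. poly [:c, b, a:] t = 0}"
    by (auto simp: power2_eq_square algebra_simps)
  then show ?thesis using poly_roots_finite[of "[:c, b, a:]"] assms by simp
qed

text \<open>The cone over the section lies in the quadric \<open>A\<close>, obtained by squaring to
  get a polynomial. A direction \<open>m\<close> with nonzero leading coefficient meets it in
  finitely many points per line. The normal \<open>n\<close> itself serves unless
  \<open>|n|^2 = c^2\<close>; then \<open>c\<close> is nonzero and a vector orthogonal to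
  \<open>n\<close> works, which exists in dimension at least two.\<close>

lemma AE_sphere_not_in_hyperplane:
  fixes n :: "'a::euclidean_space"
  assumes dim: "2 \<le> DIM('a)" and n: "n \<noteq> 0"
  shows "AE s in sphere_measure. n \<bullet> s \<noteq> c"
proof -
  define A where "A = {x::'a. (n \<bullet> x)\<^sup>2 = c\<^sup>2 * (norm x)\<^sup>2}"
  have A [measurable]: "A \<in> sets borel" unfolding A_def by measurable
  have "\<exists>m. (n \<bullet> m)\<^sup>2 - c\<^sup>2 * (m \<bullet> m) \<noteq> 0"
  proof (cases "(n \<bullet> n)\<^sup>2 - c\<^sup>2 * (n \<bullet> n) = 0")
    case True
    then have c: "c \<noteq> 0" using n by auto
    obtain m where m: "m \<noteq> 0" "orthogonal n m"
      using orthogonal_to_vector_exists[OF dim, of n] by (auto simp: orthogonal_commute)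
    then have "(n \<bullet> m)\<^sup>2 - c\<^sup>2 * (m \<bullet> m) \<noteq> 0" using c by (simp add: orthogonal_def)
    then show ?thesis by blast
  qed blast
  then obtain m where m: "(n \<bullet> m)\<^sup>2 - c\<^sup>2 * (m \<bullet> m) \<noteq> 0" by blast
  have "emeasure lborel A = 0"
  proof (rule null_set_of_finite_line_sections[OF A])
    fix x :: 'a
    have "{t. x + t *\<^sub>R m \<in> A} = {t. ((n \<bullet> m)\<^sup>2 - c\<^sup>2 * (m \<bullet> m)) * t\<^sup>2
        + (2 * (n \<bullet> x) * (n \<bullet> m) - 2 * c\<^sup>2 * (x \<bullet> m)) * t + ((n \<bullet> x)\<^sup>2 - c\<^sup>2 * (x \<bullet> x)) = 0}"
    proof -
      have "(n \<bullet> (x + t *\<^sub>R m))\<^sup>2 - c\<^sup>2 * (norm (x + t *\<^sub>R m))\<^sup>2 = ((n \<bullet> m)\<^sup>2 - c\<^sup>2 * (m \<bullet> m)) * t\<^sup>2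
        + (2 * (n \<bullet> x) * (n \<bullet> m) - 2 * c\<^sup>2 * (x \<bullet> m)) * t + ((n \<bullet> x)\<^sup>2 - c\<^sup>2 * (x \<bullet> x))" for t
        unfolding power2_norm_eq_inner
        by (simp add: inner_add_left inner_add_right inner_commute[of m x] power2_eq_square algebra_simps)
      then show ?thesis unfolding A_def mem_Collect_eq
        by (intro Collect_cong) (simp only: eq_iff_diff_eq_0[of "(n \<bullet> (x + _ *\<^sub>R m))\<^sup>2"])
    qed
    then show "finite {t. x + t *\<^sub>R m \<in> A}" using finite_quadratic_roots[OF m] by simp
  qed
  then have AE: "AE x in lborel. x \<notin> A" by (intro AE_not_in) (auto intro: null_setsI)
  have "(\<integral>\<^sup>+s. indicator {s. n \<bullet> s = c} s \<partial>(sphere_measure :: 'a measure))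
      = of_nat DIM('a) * (\<integral>\<^sup>+x. indicator {s. n \<bullet> s = c} (x /\<^sub>R norm x) * indicator (cball 0 1 - {0}) x \<partial>lborel)"
    by (rule nn_integral_sphere_measure) measurable
  also have "(\<integral>\<^sup>+x. indicator {s. n \<bullet> s = c} (x /\<^sub>R norm x) * indicator (cball 0 1 - {0}) x \<partial>(lborel :: 'a measure))
      = (\<integral>\<^sup>+x. 0 \<partial>(lborel :: 'a measure))"
  proof (rule nn_integral_cong_AE, use AE in eventually_elim)
    case (elim x)
    have "n \<bullet> (x /\<^sub>R norm x) \<noteq> c" if "x \<noteq> 0"
    proof
      assume "n \<bullet> (x /\<^sub>R norm x) = c"
      then have "n \<bullet> x = c * norm x" using that by (simp add: field_simps)
      then show False using elim by (simp add: A_def power_mult_distrib)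
    qed
    then show ?case by (auto split: split_indicator)
  qed
  finally have "(\<integral>\<^sup>+s. indicator {s. n \<bullet> s = c} s \<partial>(sphere_measure :: 'a measure)) = 0" by simp
  then have "AE s in (sphere_measure :: 'a measure). indicator {s. n \<bullet> s = c} s = (0::ennreal)"
    by (subst (asm) nn_integral_0_iff_AE) (auto intro!: measurable_sphere_measure)
  then show ?thesis by eventually_elim (auto split: split_indicator_asm)
qed

section \<open>The collision involution\<close>

definition collision_measure :: "('a::euclidean_space \<times> 'a \<times> 'a) measure" where
  "collision_measure = lborel \<Otimes>\<^sub>M (lborel \<Otimes>\<^sub>M sphere_measure)"

text \<open>Recording the old relative direction as third component makes the map an involution off
  the diagonal \<open>v = w\<close>.\<close>

definition collide :: "'a::euclidean_space \<times> 'a \<times> 'a \<Rightarrow> 'a \<times> 'a \<times> 'a" where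
  "collide = (\<lambda>(v, w, s). (post_velocity v w s, post_velocity_star v w s, (v - w) /\<^sub>R norm (v - w)))"

lemma sigma_finite_lborel_sphere:
  "sigma_finite_measure (lborel \<Otimes>\<^sub>M sphere_measure :: ('a::euclidean_space \<times> 'a) measure)"
  by (intro sigma_finite_pair_measure lborel.sigma_finite_measure_axioms sphere_measure.sigma_finite_measure_axioms)

interpretation lborel_lborel_sphere:
  pair_sigma_finite "lborel :: 'a::euclidean_space measure" "lborel \<Otimes>\<^sub>M sphere_measure :: ('a \<times> 'a) measure"
  by (intro pair_sigma_finite.intro lborel.sigma_finite_measure_axioms sigma_finite_lborel_sphere)

lemma measurable_collision_measure:
  assumes "f \<in> (borel :: ('a::euclidean_space \<times> 'a \<times> 'a) measure) \<rightarrow>\<^sub>M N"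
  shows "f \<in> collision_measure \<rightarrow>\<^sub>M N"
proof -
  have "(\<lambda>x. (fst x, fst (snd x), snd (snd x))) \<in> (collision_measure :: ('a \<times> 'a \<times> 'a) measure) \<rightarrow>\<^sub>M borel \<Otimes>\<^sub>M (borel \<Otimes>\<^sub>M borel)"
    unfolding collision_measure_def
    by (intro measurable_Pair measurable_compose[OF measurable_compose[OF measurable_snd measurable_snd] ident_measurable_sphere_measure])
       auto
  then have "(\<lambda>x. (fst x, fst (snd x), snd (snd x))) \<in> (collision_measure :: ('a \<times> 'a \<times> 'a) measure) \<rightarrow>\<^sub>M borel"
    by (simp add: borel_prod)
  from measurable_compose[OF this assms] show ?thesis by simp
qed

lemma nn_integral_collision_measure:
  fixes F :: "'a::euclidean_space \<times> 'a \<times> 'a \<Rightarrow> ennreal"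
  assumes F: "F \<in> borel_measurable borel"
  shows "(\<integral>\<^sup>+x. F x \<partial>collision_measure) = (\<integral>\<^sup>+v. (\<integral>\<^sup>+w. (\<integral>\<^sup>+s. F (v, w, s) \<partial>sphere_measure) \<partial>lborel) \<partial>lborel)"
proof -
  have m: "F \<in> borel_measurable collision_measure" by (rule measurable_collision_measure[OF F])
  have "(\<integral>\<^sup>+x. F x \<partial>collision_measure) = (\<integral>\<^sup>+v. (\<integral>\<^sup>+y. F (v, y) \<partial>(lborel \<Otimes>\<^sub>M sphere_measure)) \<partial>lborel)"
    unfolding collision_measure_def
    by (rule sigma_finite_measure.nn_integral_fst[OF sigma_finite_lborel_sphere, symmetric]) (use m in \<open>simp add: collision_measure_def\<close>)
  also have "\<dots> = (\<integral>\<^sup>+v. (\<integral>\<^sup>+w. (\<integral>\<^sup>+s. F (v, w, s) \<partial>sphere_measure) \<partial>lborel) \<partial>lborel)"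
  proof (rule nn_integral_cong)
    fix v :: 'a
    have "F \<in> borel_measurable (lborel \<Otimes>\<^sub>M (lborel \<Otimes>\<^sub>M sphere_measure))"
      using m by (simp add: collision_measure_def)
    then have "(\<lambda>y. F (v, y)) \<in> borel_measurable (lborel \<Otimes>\<^sub>M sphere_measure)" by measurable
    then show "(\<integral>\<^sup>+y. F (v, y) \<partial>(lborel \<Otimes>\<^sub>M sphere_measure)) = (\<integral>\<^sup>+w. (\<integral>\<^sup>+s. F (v, w, s) \<partial>sphere_measure) \<partial>lborel)"
      by (rule sphere_measure.nn_integral_fst[symmetric])
  qed
  finally show ?thesis .
qed

lemma collide_measurable: "collide \<in> borel_measurable (borel :: ('a::euclidean_space \<times> 'a \<times> 'a) measure)"
proof -
  have "collide \<in> borel \<Otimes>\<^sub>M (borel \<Otimes>\<^sub>M borel) \<rightarrow>\<^sub>M (borel :: 'a measure) \<Otimes>\<^sub>M ((borel :: 'a measure) \<Otimes>\<^sub>M (borel :: 'a measure))"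
    unfolding collide_def post_velocity_def post_velocity_star_def by measurable
  then show ?thesis by (simp add: borel_prod)
qed

lemma nn_integral_relative_velocity:
  fixes G :: "'a::euclidean_space \<Rightarrow> 'a \<Rightarrow> ennreal"
  assumes G [measurable]: "(\<lambda>(v, w). G v w) \<in> borel_measurable (borel \<Otimes>\<^sub>M borel)"
  shows "(\<integral>\<^sup>+v. (\<integral>\<^sup>+w. G v w \<partial>lborel) \<partial>lborel) = (\<integral>\<^sup>+z. (\<integral>\<^sup>+v. G v (v - z) \<partial>lborel) \<partial>lborel)"
proof -
  have "(\<integral>\<^sup>+w. G v w \<partial>lborel) = (\<integral>\<^sup>+z. G v (v - z) \<partial>lborel)" for v
  proof -
    have "(\<integral>\<^sup>+z. G v (v + - z) \<partial>lborel) = (\<integral>\<^sup>+z. G v (v + z) \<partial>lborel)" by (rule nn_integral_lborel_uminus) measurable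
    also have "\<dots> = (\<integral>\<^sup>+w. G v w \<partial>lborel)" by (rule nn_integral_lborel_translate) measurable
    finally show ?thesis by simp
  qed
  then have "(\<integral>\<^sup>+v. (\<integral>\<^sup>+w. G v w \<partial>lborel) \<partial>lborel) = (\<integral>\<^sup>+v. (\<integral>\<^sup>+z. G v (v - z) \<partial>lborel) \<partial>lborel)" by simp
  also have "\<dots> = (\<integral>\<^sup>+z. (\<integral>\<^sup>+v. G v (v - z) \<partial>lborel) \<partial>lborel)" by (rule lborel_pair.Fubini') measurable
  finally show ?thesis .
qed

text \<open>The coordinates \<open>m = (v + w) / 2\<close> and \<open>z = v - w\<close> have
  Jacobian one; for fixed \<open>z\<close>, passing from \<open>v\<close> to \<open>m\<close> is a
  translation by \<open>z / 2\<close>.\<close>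

lemma nn_integral_centre_of_mass:
  fixes G :: "'a::euclidean_space \<Rightarrow> 'a \<Rightarrow> ennreal"
  assumes G [measurable]: "(\<lambda>(v, w). G v w) \<in> borel_measurable (borel \<Otimes>\<^sub>M borel)"
  shows "(\<integral>\<^sup>+v. (\<integral>\<^sup>+w. G v w \<partial>lborel) \<partial>lborel) = (\<integral>\<^sup>+m. (\<integral>\<^sup>+z. G (m + z /\<^sub>R 2) (m - z /\<^sub>R 2) \<partial>lborel) \<partial>lborel)"
proof -
  have "(\<integral>\<^sup>+v. G v (v - z) \<partial>lborel) = (\<integral>\<^sup>+m. G (m + z /\<^sub>R 2) (m - z /\<^sub>R 2) \<partial>lborel)" for z
  proof -
    have "(\<integral>\<^sup>+m. G (z /\<^sub>R 2 + m) (z /\<^sub>R 2 + m - z) \<partial>lborel) = (\<integral>\<^sup>+v. G v (v - z) \<partial>lborel)"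
      by (rule nn_integral_lborel_translate) measurable
    moreover have "(\<integral>\<^sup>+m. G (z /\<^sub>R 2 + m) (z /\<^sub>R 2 + m - z) \<partial>lborel) = (\<integral>\<^sup>+m. G (m + z /\<^sub>R 2) (m - z /\<^sub>R 2) \<partial>lborel)"
    proof (rule nn_integral_cong, rule arg_cong2[where f=G])
      fix m
      show "z /\<^sub>R 2 + m - z = m - z /\<^sub>R 2"
        using scaleR_half_double[of z] by (auto simp: algebra_simps simp flip: scaleR_2)
    qed (rule add.commute)
    ultimately show ?thesis by (rule trans[OF sym])
  qed
  then have "(\<integral>\<^sup>+v. (\<integral>\<^sup>+w. G v w \<partial>lborel) \<partial>lborel) = (\<integral>\<^sup>+z. (\<integral>\<^sup>+m. G (m + z /\<^sub>R 2) (m - z /\<^sub>R 2) \<partial>lborel) \<partial>lborel)"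
    by (rule trans[OF nn_integral_relative_velocity[OF G] nn_integral_cong])
  also have "\<dots> = (\<integral>\<^sup>+m. (\<integral>\<^sup>+z. G (m + z /\<^sub>R 2) (m - z /\<^sub>R 2) \<partial>lborel) \<partial>lborel)" by (rule lborel_pair.Fubini') measurable
  finally show ?thesis .
qed

text \<open>In centre-of-mass coordinates a collision keeps \<open>m\<close> and sends
  \<open>(z, s)\<close> to \<open>(|z| s, z / |z|)\<close>, which is the exchange of
  directions.\<close>

lemma nn_integral_collide:
  fixes F :: "'a::euclidean_space \<times> 'a \<times> 'a \<Rightarrow> ennreal"
  assumes F: "F \<in> borel_measurable borel"
  shows "(\<integral>\<^sup>+x. F (collide x) \<partial>collision_measure) = (\<integral>\<^sup>+x. F x \<partial>collision_measure)"
proof -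
  have slice: "(\<lambda>(v, w). \<integral>\<^sup>+s. F (v, w, s) \<partial>sphere_measure) \<in> borel_measurable (borel \<Otimes>\<^sub>M borel)"
    if F: "F \<in> borel_measurable borel" for F :: "'a \<times> 'a \<times> 'a \<Rightarrow> ennreal"
  proof -
    have [measurable]: "F \<in> borel_measurable (borel \<Otimes>\<^sub>M (borel \<Otimes>\<^sub>M borel))" using F by (simp add: borel_prod)
    have "(\<lambda>x. F (fst (fst x), snd (fst x), snd x)) \<in> borel_measurable ((borel \<Otimes>\<^sub>M borel) \<Otimes>\<^sub>M sphere_measure)"
      by (rule measurable_pair_sphere_measure) measurable
    from sphere_measure.borel_measurable_nn_integral_fst[OF this]
    show ?thesis by (simp add: case_prod_beta')
  qed
  have Fc: "(\<lambda>x. F (collide x)) \<in> borel_measurable borel" using collide_measurable F by measurable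
  have [measurable]: "F \<in> borel_measurable (borel \<Otimes>\<^sub>M (borel \<Otimes>\<^sub>M borel))" using F by (simp add: borel_prod)
  have "(\<integral>\<^sup>+x. F x \<partial>collision_measure)
      = (\<integral>\<^sup>+m. (\<integral>\<^sup>+z. (\<integral>\<^sup>+s. F (m + z /\<^sub>R 2, m - z /\<^sub>R 2, s) \<partial>sphere_measure) \<partial>lborel) \<partial>lborel)"
    unfolding nn_integral_collision_measure[OF F] by (rule nn_integral_centre_of_mass[OF slice[OF F]])
  also have "\<dots> = (\<integral>\<^sup>+m. (\<integral>\<^sup>+z. (\<integral>\<^sup>+s. F (m + (norm z *\<^sub>R s) /\<^sub>R 2, m - (norm z *\<^sub>R s) /\<^sub>R 2, z /\<^sub>R norm z) \<partial>sphere_measure) \<partial>lborel) \<partial>lborel)"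
  proof (rule nn_integral_cong)
    fix m :: 'a
    have "(\<lambda>(z, s). F (m + z /\<^sub>R 2, m - z /\<^sub>R 2, s)) \<in> borel_measurable (borel \<Otimes>\<^sub>M borel)" by measurable
    from nn_integral_exchange_direction[OF this]
    show "(\<integral>\<^sup>+z. (\<integral>\<^sup>+s. F (m + z /\<^sub>R 2, m - z /\<^sub>R 2, s) \<partial>sphere_measure) \<partial>lborel)
      = (\<integral>\<^sup>+z. (\<integral>\<^sup>+s. F (m + (norm z *\<^sub>R s) /\<^sub>R 2, m - (norm z *\<^sub>R s) /\<^sub>R 2, z /\<^sub>R norm z) \<partial>sphere_measure) \<partial>lborel)"
      by simp
  qed
  also have "\<dots> = (\<integral>\<^sup>+m. (\<integral>\<^sup>+z. (\<integral>\<^sup>+s. F (collide (m + z /\<^sub>R 2, m - z /\<^sub>R 2, s)) \<partial>sphere_measure) \<partial>lborel) \<partial>lborel)"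
  proof -
    have "collide (m + z /\<^sub>R 2, m - z /\<^sub>R 2, s) = (m + (norm z *\<^sub>R s) /\<^sub>R 2, m - (norm z *\<^sub>R s) /\<^sub>R 2, z /\<^sub>R norm z)" for m z s :: 'a
    proof -
      have "(m + z /\<^sub>R 2) - (m - z /\<^sub>R 2) = z" "((m + z /\<^sub>R 2) + (m - z /\<^sub>R 2)) /\<^sub>R 2 = m"
        using scaleR_half_double[of z] scaleR_half_double[of m] by (auto simp: scaleR_add_right)
      then show ?thesis by (simp add: collide_def post_velocity_def post_velocity_star_def)
    qed
    then show ?thesis by simp
  qed
  also have "\<dots> = (\<integral>\<^sup>+x. F (collide x) \<partial>collision_measure)"
    unfolding nn_integral_collision_measure[OF Fc] by (rule nn_integral_centre_of_mass[OF slice[OF Fc], symmetric])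
  finally show ?thesis by simp
qed

text \<open>On the diagonal \<open>v = w\<close> the third component of \<open>collide\<close> is
  \<open>0\<close>, which is not on the sphere. The map therefore leaves the space of
  \<open>collision_measure\<close>, and the invariance is phrased for its image on the Borel
  sets.\<close>

lemma collide_preserves_measure:
  "distr (distr collision_measure borel (\<lambda>x. x)) borel collide = distr collision_measure borel (\<lambda>x::'a::euclidean_space \<times> 'a \<times> 'a. x)"
proof (rule measure_eqI)
  have idm: "(\<lambda>x. x) \<in> collision_measure \<rightarrow>\<^sub>M (borel :: ('a \<times> 'a \<times> 'a) measure)"
    by (rule measurable_collision_measure) simp
  fix A :: "('a \<times> 'a \<times> 'a) set"
  assume "A \<in> sets (distr (distr collision_measure borel (\<lambda>x. x)) borel collide)"
  then have A: "A \<in> sets borel" by simp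
  have [measurable]: "indicator A \<in> borel_measurable (borel :: ('a \<times> 'a \<times> 'a) measure)" using A by simp
  have "emeasure (distr (distr collision_measure borel (\<lambda>x. x)) borel collide) A
      = (\<integral>\<^sup>+x. indicator A x \<partial>distr (distr collision_measure borel (\<lambda>x. x)) borel collide)"
    using A by simp
  also have "\<dots> = (\<integral>\<^sup>+x. indicator A (collide x) \<partial>distr collision_measure borel (\<lambda>x. x))"
    using collide_measurable by (subst nn_integral_distr) simp_all
  also have "\<dots> = (\<integral>\<^sup>+x. indicator A (collide x) \<partial>collision_measure)"
    by (subst nn_integral_distr[OF idm]) (simp_all add: measurable_compose[OF collide_measurable])
  also have "\<dots> = (\<integral>\<^sup>+x. indicator A x \<partial>collision_measure)" by (rule nn_integral_collide) simp
  also have "\<dots> = (\<integral>\<^sup>+x. indicator A x \<partial>distr collision_measure borel (\<lambda>x. x))"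
    by (subst nn_integral_distr[OF idm]) auto
  also have "\<dots> = emeasure (distr collision_measure borel (\<lambda>x. x)) A" using A by simp
  finally show "emeasure (distr (distr collision_measure borel (\<lambda>x. x)) borel collide) A
      = emeasure (distr collision_measure borel (\<lambda>x. x)) A" .
qed simp

lemma
  fixes F :: "'a::euclidean_space \<times> 'a \<times> 'a \<Rightarrow> real"
  assumes F: "F \<in> borel_measurable borel"
  shows integrable_collide: "integrable collision_measure (\<lambda>x. F (collide x)) \<longleftrightarrow> integrable collision_measure F"
    and integral_collide: "(\<integral>x. F (collide x) \<partial>collision_measure) = (\<integral>x. F x \<partial>collision_measure)"
proof -
  have idm: "(\<lambda>x. x) \<in> collision_measure \<rightarrow>\<^sub>M (borel :: ('a \<times> 'a \<times> 'a) measure)"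
    by (rule measurable_collision_measure) simp
  let ?Q = "distr collision_measure borel (\<lambda>x::'a \<times> 'a \<times> 'a. x)"
  have Fc: "(\<lambda>x. F (collide x)) \<in> borel_measurable borel" using collide_measurable F by measurable
  have "integrable collision_measure F \<longleftrightarrow> integrable ?Q F" using integrable_distr_eq[OF idm F] by simp
  also have "\<dots> \<longleftrightarrow> integrable (distr ?Q borel collide) F" by (simp only: collide_preserves_measure)
  also have "\<dots> \<longleftrightarrow> integrable ?Q (\<lambda>x. F (collide x))"
    by (rule integrable_distr_eq) (use collide_measurable F in auto)
  also have "\<dots> \<longleftrightarrow> integrable collision_measure (\<lambda>x. F (collide x))" using integrable_distr_eq[OF idm Fc] by simp
  finally show "integrable collision_measure (\<lambda>x. F (collide x)) \<longleftrightarrow> integrable collision_measure F" by simp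
  have "(\<integral>x. F x \<partial>collision_measure) = (\<integral>x. F x \<partial>?Q)" using integral_distr[OF idm F] by simp
  also have "\<dots> = (\<integral>x. F x \<partial>distr ?Q borel collide)" by (simp only: collide_preserves_measure)
  also have "\<dots> = (\<integral>x. F (collide x) \<partial>?Q)"
    by (rule integral_distr) (use collide_measurable F in auto)
  also have "\<dots> = (\<integral>x. F (collide x) \<partial>collision_measure)" using integral_distr[OF idm Fc] by simp
  finally show "(\<integral>x. F (collide x) \<partial>collision_measure) = (\<integral>x. F x \<partial>collision_measure)" by simp
qed



lemma collide_relative_velocity:
  assumes "norm s = 1"
  shows "post_velocity v w s - post_velocity_star v w s = norm (v - w) *\<^sub>R s"
    and "norm (post_velocity v w s - post_velocity_star v w s) = norm (v - w)"
proof -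
  show *: "post_velocity v w s - post_velocity_star v w s = norm (v - w) *\<^sub>R s"
    by (simp add: post_velocity_def post_velocity_star_def flip: scaleR_add_left)
  show "norm (post_velocity v w s - post_velocity_star v w s) = norm (v - w)" unfolding * using assms by simp
qed

lemma collide_involution:
  assumes "norm s = 1" "v \<noteq> w"
  shows "collide (collide (v, w, s)) = (v, w, s)"
proof -
  note rel = collide_relative_velocity[OF assms(1), of v w]
  have sum: "(post_velocity v w s + post_velocity_star v w s) /\<^sub>R 2 = (v + w) /\<^sub>R 2"
  proof -
    have "post_velocity v w s + post_velocity_star v w s = (2::real) *\<^sub>R ((v + w) /\<^sub>R 2)"
      unfolding scaleR_2 by (simp add: post_velocity_def post_velocity_star_def)
    then show ?thesis by simp
  qed
  have half: "(norm (v - w) / 2) *\<^sub>R ((v - w) /\<^sub>R norm (v - w)) = (v - w) /\<^sub>R 2" using assms by simp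
  have "collide (collide (v, w, s)) = ((v + w) /\<^sub>R 2 + (v - w) /\<^sub>R 2, (v + w) /\<^sub>R 2 - (v - w) /\<^sub>R 2, (norm (v - w) *\<^sub>R s) /\<^sub>R norm (v - w))"
    unfolding collide_def prod.case post_velocity_def[of "post_velocity v w s"] post_velocity_star_def[of "post_velocity v w s"]
      rel(2) sum half rel(1) using assms by simp
  also have "\<dots> = (v, w, s)"
    using assms scaleR_half_double[of v] scaleR_half_double[of w]
    by (auto simp: scaleR_add_right scaleR_diff_right)
  finally show ?thesis .
qed

section \<open>The linear Boltzmann operator on integrable functions\<close>

lemma maxwellian_pos: "0 < maxwellian v"
  by (simp add: maxwellian_def)

lemma maxwellian_nonneg [simp]: "0 \<le> maxwellian v"
  by (rule less_imp_le[OF maxwellian_pos])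

lemma maxwellian_measurable [measurable]: "maxwellian \<in> borel_measurable borel"
  unfolding maxwellian_def[abs_def] by measurable

lemma maxwellian_le: "maxwellian (v :: 'a::euclidean_space) \<le> maxwellian (0 :: 'a)"
  by (simp add: maxwellian_def)

lemma maxwellian_eq_prod: "maxwellian (v :: 'a::euclidean_space) = (\<Prod>e\<in>Basis. std_normal_density (v \<bullet> e))"
proof -
  have "(\<Prod>e\<in>Basis. std_normal_density (v \<bullet> e)) = (1 / sqrt (2 * pi)) ^ DIM('a) * exp (\<Sum>e\<in>Basis. - (v \<bullet> e)\<^sup>2 / 2)"
    unfolding std_normal_density_def prod.distrib prod_constant by (simp add: exp_sum)
  also have "(\<Sum>e\<in>Basis. - (v \<bullet> e)\<^sup>2 / 2) = - (norm v)\<^sup>2 / 2"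
    unfolding power2_norm_eq_inner euclidean_inner[of v v]
    by (simp add: sum_divide_distrib sum_negf power2_eq_square)
  also have "(1 / sqrt (2 * pi)) ^ DIM('a) = (2 * pi) powr (- real DIM('a) / 2)"
  proof -
    have "1 / sqrt (2 * pi) = (2 * pi) powr (- 1 / 2)" by (simp add: powr_minus_divide powr_half_sqrt)
    then have "(1 / sqrt (2 * pi)) ^ DIM('a) = ((2 * pi) powr (- 1 / 2)) powr (real DIM('a))"
      by (simp add: powr_realpow)
    also have "\<dots> = (2 * pi) powr (- real DIM('a) / 2)" by (simp add: powr_powr)
    finally show ?thesis .
  qed
  finally show ?thesis by (simp add: maxwellian_def)
qed

lemma nn_integral_maxwellian: "(\<integral>\<^sup>+v. ennreal (maxwellian (v :: 'a::euclidean_space)) \<partial>lborel) = 1"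
proof -
  have "(\<integral>\<^sup>+v. ennreal (maxwellian (v :: 'a)) \<partial>lborel) = (\<integral>\<^sup>+v. (\<Prod>e\<in>Basis. ennreal (std_normal_density (v \<bullet> e))) \<partial>(lborel :: 'a measure))"
    by (simp add: maxwellian_eq_prod prod_ennreal)
  also have "\<dots> = (\<Prod>e\<in>(Basis :: 'a set). (\<integral>\<^sup>+x. ennreal (std_normal_density x) \<partial>lborel))"
    by (rule nn_integral_lborel_prod) auto
  also have "(\<integral>\<^sup>+x. ennreal (std_normal_density x) \<partial>lborel) = 1"
    by (subst nn_integral_eq_integral) auto
  finally show ?thesis by simp
qed

lemma
  shows integrable_maxwellian: "integrable lborel (maxwellian :: 'a::euclidean_space \<Rightarrow> real)"
    and integral_maxwellian: "(\<integral>v. maxwellian (v :: 'a) \<partial>lborel) = 1"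
proof -
  have "integrable lborel (maxwellian :: 'a \<Rightarrow> real) \<and> (\<integral>v. maxwellian (v :: 'a) \<partial>lborel) = 1"
    using nn_integral_maxwellian[where 'a='a] maxwellian_pos
    by (subst nn_integral_eq_integrable[symmetric]) (auto intro: less_imp_le)
  then show "integrable lborel (maxwellian :: 'a \<Rightarrow> real)" "(\<integral>v. maxwellian (v :: 'a) \<partial>lborel) = 1" by auto
qed

text \<open>Conservation of energy, by the parallelogram identity: a collision keeps the midpoint of
  the two velocities and the length of their difference.\<close>

lemma maxwellian_collide:
  assumes "norm s = 1"
  shows "maxwellian (post_velocity v w s) * maxwellian (post_velocity_star v w s) = maxwellian v * maxwellian (w :: 'a::euclidean_space)"
proof -
  have par: "(norm (p + q))\<^sup>2 + (norm (p - q))\<^sup>2 = 2 * (norm p)\<^sup>2 + 2 * (norm q)\<^sup>2" for p q :: 'a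
    unfolding power2_norm_eq_inner by (simp add: inner_add_left inner_add_right inner_diff_left inner_diff_right)
  have "v = (v + w) /\<^sub>R 2 + (v - w) /\<^sub>R 2" "w = (v + w) /\<^sub>R 2 - (v - w) /\<^sub>R 2"
    using scaleR_half_double[of v] scaleR_half_double[of w] by (auto simp: scaleR_add_right scaleR_diff_right)
  then have "(norm v)\<^sup>2 + (norm w)\<^sup>2 = 2 * (norm ((v + w) /\<^sub>R 2))\<^sup>2 + 2 * (norm ((v - w) /\<^sub>R 2))\<^sup>2"
    using par[of "(v + w) /\<^sub>R 2" "(v - w) /\<^sub>R 2"] by metis
  moreover have "norm ((norm (v - w) / 2) *\<^sub>R s) = norm ((v - w) /\<^sub>R 2)" using assms by simp
  ultimately have "(norm (post_velocity v w s))\<^sup>2 + (norm (post_velocity_star v w s))\<^sup>2 = (norm v)\<^sup>2 + (norm w)\<^sup>2"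
    unfolding post_velocity_def post_velocity_star_def by (simp only: par)
  then have e: "- (norm (post_velocity v w s))\<^sup>2 / 2 + - (norm (post_velocity_star v w s))\<^sup>2 / 2 = - (norm v)\<^sup>2 / 2 + - (norm w)\<^sup>2 / 2"
    by simp
  have "exp (- (norm (post_velocity v w s))\<^sup>2 / 2) * exp (- (norm (post_velocity_star v w s))\<^sup>2 / 2)
      = exp (- (norm v)\<^sup>2 / 2) * exp (- (norm w)\<^sup>2 / 2)"
    unfolding exp_add[symmetric] e ..
  then show ?thesis unfolding maxwellian_def by (simp add: mult_ac)
qed

lemma nn_integral_powr_unit_interval:
  assumes a: "- 1 < a"
  shows "(\<integral>\<^sup>+r. ennreal (r powr a) * indicator {0..1} r \<partial>lborel) < \<infinity>"
proof -
  have "((\<lambda>x. x powr a) has_integral (1 powr (a + 1) / (a + 1))) {0..1}"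
    using a by (intro has_integral_powr_from_0) auto
  then have "(\<integral>\<^sup>+r. ennreal (r powr a) * indicator {0..1} r \<partial>lborel) = ennreal (1 powr (a + 1) / (a + 1))"
    by (intro nn_integral_has_integral_lebesgue') auto
  then show ?thesis by simp
qed

text \<open>In polar coordinates the integrand becomes \<open>r powr (\<gamma> + d - 1)\<close>,
  integrable at \<open>0\<close> precisely because \<open>\<gamma> > - d\<close>.\<close>

lemma nn_integral_norm_powr_ball:
  assumes g: "- real DIM('a) < \<gamma>"
  shows "(\<integral>\<^sup>+z. ennreal (norm z powr \<gamma>) * indicator (cball 0 1) (z :: 'a::euclidean_space) \<partial>lborel) < \<infinity>"
proof -
  let ?I = "\<integral>\<^sup>+r. ennreal (r powr (\<gamma> + real DIM('a) - 1)) * indicator {0..1} r \<partial>lborel"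
  have "(\<integral>\<^sup>+z. ennreal (norm z powr \<gamma>) * indicator (cball 0 1) (z :: 'a) \<partial>lborel)
      = (\<integral>\<^sup>+s. (\<integral>\<^sup>+r. ennreal (norm (r *\<^sub>R s) powr \<gamma>) * indicator (cball 0 1) (r *\<^sub>R s) * ennreal (r ^ (DIM('a) - 1))
          * indicator {0<..} r \<partial>lborel) \<partial>(sphere_measure :: 'a measure))"
  proof (rule nn_integral_polar)
    have [measurable]: "cball 0 1 \<in> sets (borel :: 'a measure)" by simp
    show "(\<lambda>z::'a. ennreal (norm z powr \<gamma>) * indicator (cball 0 1) z) \<in> borel_measurable borel" by measurable
  qed
  also have "\<dots> \<le> (\<integral>\<^sup>+s. ?I \<partial>(sphere_measure :: 'a measure))"
  proof (intro nn_integral_mono)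
    fix s :: 'a and r :: real assume "s \<in> space sphere_measure"
    then have s: "norm s = 1" by simp
    show "ennreal (norm (r *\<^sub>R s) powr \<gamma>) * indicator (cball 0 1) (r *\<^sub>R s) * ennreal (r ^ (DIM('a) - 1)) * indicator {0<..} r
        \<le> ennreal (r powr (\<gamma> + real DIM('a) - 1)) * indicator {0..1} r"
    proof (cases "0 < r \<and> r \<le> 1")
      case True
      have "r ^ (DIM('a) - 1) = r powr (real DIM('a) - 1)"
        using True by (simp add: powr_realpow[symmetric] of_nat_diff)
      then have "r powr \<gamma> * r ^ (DIM('a) - 1) = r powr (\<gamma> + real DIM('a) - 1)"
        using True by (simp add: powr_add[symmetric] add_diff_eq)
      then show ?thesis using True s by (simp add: ennreal_mult[symmetric])
    next
      case False
      then show ?thesis using s by (auto split: split_indicator)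
    qed
  qed
  also have "\<dots> = ?I * emeasure (sphere_measure :: 'a measure) (space sphere_measure)" by simp
  also have "\<dots> < \<infinity>"
  proof -
    have "?I < top" using nn_integral_powr_unit_interval[of "\<gamma> + real DIM('a) - 1"] g by simp
    moreover have "emeasure (sphere_measure :: 'a measure) (space sphere_measure) < top"
      by (rule less_top[THEN iffD1], rule sphere_measure.emeasure_finite)
    ultimately show ?thesis unfolding infinity_ennreal_def ennreal_mult_less_top by blast
  qed
  finally show ?thesis .
qed

text \<open>Here \<open>b\<close> is Borel and nonnegative on the whole line, and its mass is known
  for every unit vector. Truncation to \<open>{-1..1}\<close> and rotation invariance will provide
  both.\<close>

locale collision_operator =
  fixes \<gamma> :: real and b :: "real \<Rightarrow> real" and ell :: real and type_of_velocities :: "'a::euclidean_space itself"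
  assumes dim: "2 \<le> DIM('a)"
    and gamma: "- real DIM('a) < \<gamma>" "\<gamma> < 0"
    and b_measurable [measurable]: "b \<in> borel_measurable borel"
    and b_nonneg: "\<And>s. 0 \<le> b s"
    and ell_pos: "0 < ell"
    and angular: "\<And>e::'a. norm e = 1 \<Longrightarrow> (\<integral>\<^sup>+s. ennreal (b (e \<bullet> s)) \<partial>sphere_measure) = ennreal ell"
begin

abbreviation K :: "'a \<Rightarrow> 'a \<Rightarrow> 'a \<Rightarrow> real" where "K \<equiv> collision_kernel \<gamma> b"

abbreviation Gain :: "('a \<Rightarrow> real) \<Rightarrow> 'a \<Rightarrow> real" where "Gain \<equiv> gain \<gamma> b"

abbreviation Lin :: "('a \<Rightarrow> real) \<Rightarrow> 'a \<Rightarrow> real" where "Lin \<equiv> linear_boltzmann \<gamma> b"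

abbreviation freq :: "'a \<Rightarrow> real" where "freq \<equiv> collision_frequency \<gamma> b"

lemma K_nonneg: "0 \<le> K v w s"
  by (simp add: collision_kernel_def b_nonneg)



text \<open>Microreversibility: the relative speed is preserved, and the two unit vectors in the
  deviation cosine merely change places.\<close>

lemma K_collide:
  assumes "norm s = 1"
  shows "K (post_velocity v w s) (post_velocity_star v w s) ((v - w) /\<^sub>R norm (v - w)) = K v w s"
proof (cases "v = w")
  case False
  have "cos_deviation (post_velocity v w s) (post_velocity_star v w s) ((v - w) /\<^sub>R norm (v - w)) = cos_deviation v w s"
    using False assms
    by (simp add: cos_deviation_def collide_relative_velocity[OF assms] inner_commute)
  then show ?thesis by (simp add: collision_kernel_def collide_relative_velocity(2)[OF assms])
qed (simp add: collision_kernel_def collide_relative_velocity(2)[OF assms])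

text \<open>Off the diagonal this is the angular mass; for \<open>v = w\<close> both sides vanish
  because \<open>0 powr \<gamma> = 0\<close>.\<close>

lemma nn_integral_K:
  "(\<integral>\<^sup>+s. ennreal (K v w s * c) \<partial>sphere_measure) = ennreal ell * ennreal (norm (v - w) powr \<gamma> * c)" if c: "0 \<le> c"
proof (cases "v = w")
  case False
  have "(\<integral>\<^sup>+s. ennreal (K v w s * c) \<partial>sphere_measure)
      = (\<integral>\<^sup>+s. ennreal (norm (v - w) powr \<gamma> * c) * ennreal (b (((v - w) /\<^sub>R norm (v - w)) \<bullet> s)) \<partial>sphere_measure)"
    unfolding collision_kernel_def cos_deviation_def using c b_nonneg by (simp add: ennreal_mult[symmetric] mult_ac)
  also have "\<dots> = ennreal (norm (v - w) powr \<gamma> * c) * (\<integral>\<^sup>+s. ennreal (b (((v - w) /\<^sub>R norm (v - w)) \<bullet> s)) \<partial>sphere_measure)"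
    by (rule nn_integral_cmult) (rule measurable_sphere_measure, measurable)
  also have "\<dots> = ennreal (norm (v - w) powr \<gamma> * c) * ennreal ell" using False by (subst angular) auto
  finally show ?thesis by (simp add: mult.commute)
qed (simp add: collision_kernel_def)

text \<open>For \<open>|v - w| \<le> 1\<close> the Maxwellian is bounded by its value at
  \<open>0\<close> and the singularity is integrable; for larger distances the power is at most
  \<open>1\<close> as \<open>\<gamma> < 0\<close>. Both bounds are uniform in
  \<open>v\<close>.\<close>

lemma freq_bound_nn:
  obtains C where "0 \<le> C" "\<And>v. (\<integral>\<^sup>+w. (\<integral>\<^sup>+s. ennreal (K v w s * maxwellian w) \<partial>sphere_measure) \<partial>lborel) \<le> ennreal C"
proof -
  define I where "I = (\<integral>\<^sup>+z. ennreal (norm z powr \<gamma>) * indicator (cball 0 1) (z :: 'a) \<partial>lborel)"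
  have I: "I < \<infinity>" unfolding I_def by (rule nn_integral_norm_powr_ball[OF gamma(1)])
  have [measurable]: "cball 0 1 \<in> sets (borel :: 'a measure)" by simp
  have bound: "(\<integral>\<^sup>+w. ennreal (norm (v - w) powr \<gamma> * maxwellian w) \<partial>lborel) \<le> ennreal (maxwellian (0::'a)) * I + 1" for v :: 'a
  proof -
    have "(\<integral>\<^sup>+w. ennreal (norm (v - w) powr \<gamma> * maxwellian w) \<partial>lborel)
        \<le> (\<integral>\<^sup>+w. ennreal (maxwellian (0::'a)) * (ennreal (norm (v - w) powr \<gamma>) * indicator (cball 0 1) (v - w)) + ennreal (maxwellian w) \<partial>lborel)"
    proof (rule nn_integral_mono)
      fix w :: 'a
      show "ennreal (norm (v - w) powr \<gamma> * maxwellian w)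
        \<le> ennreal (maxwellian (0::'a)) * (ennreal (norm (v - w) powr \<gamma>) * indicator (cball 0 1) (v - w)) + ennreal (maxwellian w)"
      proof (cases "norm (v - w) \<le> 1")
        case True
        have "norm (v - w) powr \<gamma> * maxwellian w \<le> norm (v - w) powr \<gamma> * maxwellian (0::'a)"
          by (intro mult_left_mono maxwellian_le) auto
        then have "ennreal (norm (v - w) powr \<gamma> * maxwellian w) \<le> ennreal (maxwellian (0::'a) * norm (v - w) powr \<gamma>)"
          by (simp add: ennreal_leI mult.commute)
        also have "\<dots> = ennreal (maxwellian (0::'a)) * (ennreal (norm (v - w) powr \<gamma>) * indicator (cball 0 1) (v - w))"
          using True maxwellian_pos[of "0::'a"] by (simp add: ennreal_mult less_imp_le)
        finally show ?thesis by (rule order_trans) simp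
      next
        case False
        then have "norm (v - w) powr \<gamma> \<le> 1"
          using gamma(2) powr_mono[of \<gamma> 0 "norm (v - w)"] by (auto split: if_splits)
        then have "norm (v - w) powr \<gamma> * maxwellian w \<le> 1 * maxwellian w"
          using maxwellian_pos[of w] by (intro mult_right_mono) auto
        then have "ennreal (norm (v - w) powr \<gamma> * maxwellian w) \<le> ennreal (maxwellian w)" by (simp add: ennreal_leI)
        then show ?thesis by (rule order_trans) simp
      qed
    qed
    also have "\<dots> = ennreal (maxwellian (0::'a)) * (\<integral>\<^sup>+w. ennreal (norm (v - w) powr \<gamma>) * indicator (cball 0 1) (v - w) \<partial>lborel)
        + (\<integral>\<^sup>+w. ennreal (maxwellian (w::'a)) \<partial>lborel)"
      by (subst nn_integral_add) (simp_all add: nn_integral_cmult)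
    also have "(\<integral>\<^sup>+w. ennreal (norm (v - w) powr \<gamma>) * indicator (cball 0 1) (v - w) \<partial>lborel) = I"
    proof -
      have "(\<integral>\<^sup>+w. ennreal (norm (v + - w) powr \<gamma>) * indicator (cball 0 1) (v + - w) \<partial>lborel)
          = (\<integral>\<^sup>+w. ennreal (norm (v + w) powr \<gamma>) * indicator (cball 0 1) (v + w) \<partial>lborel)"
        by (rule nn_integral_lborel_uminus) measurable
      also have "\<dots> = I" unfolding I_def by (rule nn_integral_lborel_translate) measurable
      finally show ?thesis by simp
    qed
    finally show ?thesis by (simp add: nn_integral_maxwellian)
  qed
  define J where "J = ennreal ell * (ennreal (maxwellian (0::'a)) * I + 1)"
  have "J < \<infinity>" using I by (simp add: J_def ennreal_mult_less_top)
  have eq: "(\<integral>\<^sup>+w. (\<integral>\<^sup>+s. ennreal (K v w s * maxwellian w) \<partial>sphere_measure) \<partial>lborel)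
      = ennreal ell * (\<integral>\<^sup>+w. ennreal (norm (v - w) powr \<gamma> * maxwellian w) \<partial>lborel)" for v
    using maxwellian_pos by (simp add: nn_integral_K less_imp_le nn_integral_cmult)
  have "(\<integral>\<^sup>+w. (\<integral>\<^sup>+s. ennreal (K v w s * maxwellian w) \<partial>sphere_measure) \<partial>lborel) \<le> ennreal (enn2real J)" for v
    unfolding eq using bound[of v] \<open>J < \<infinity>\<close> by (simp add: J_def mult_left_mono)
  then show ?thesis by (intro that[of "enn2real J"]) auto
qed

lemma KM_measurable: "(\<lambda>(w, s). K v w s * maxwellian w) \<in> borel_measurable (lborel \<Otimes>\<^sub>M sphere_measure)"
  unfolding collision_kernel_def cos_deviation_def by (rule measurable_pair_sphere_measure) measurable

lemma freq_nn: "ennreal (freq v) = (\<integral>\<^sup>+w. (\<integral>\<^sup>+s. ennreal (K v w s * maxwellian w) \<partial>sphere_measure) \<partial>lborel)"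
proof -
  obtain C where C: "(\<integral>\<^sup>+w. (\<integral>\<^sup>+s. ennreal (K v w s * maxwellian w) \<partial>sphere_measure) \<partial>lborel) \<le> ennreal C"
    using freq_bound_nn by metis
  have nn: "0 \<le> (case y of (w, s) \<Rightarrow> K v w s * maxwellian w)" for y
    by (cases y) (simp add: K_nonneg)
  have eq: "(\<integral>\<^sup>+y. ennreal (case y of (w, s) \<Rightarrow> K v w s * maxwellian w) \<partial>(lborel \<Otimes>\<^sub>M sphere_measure))
      = (\<integral>\<^sup>+w. (\<integral>\<^sup>+s. ennreal (K v w s * maxwellian w) \<partial>sphere_measure) \<partial>lborel)"
    using KM_measurable[of v] by (subst sphere_measure.nn_integral_fst[symmetric]) auto
  have int: "integrable (lborel \<Otimes>\<^sub>M sphere_measure) (\<lambda>(w, s). K v w s * maxwellian w)"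
  proof (rule integrableI_nonneg[OF KM_measurable])
    show "(\<integral>\<^sup>+y. ennreal (case y of (w, s) \<Rightarrow> K v w s * maxwellian w) \<partial>(lborel \<Otimes>\<^sub>M sphere_measure)) < \<infinity>"
      unfolding eq using C by (rule le_less_trans) simp
  qed (use nn in auto)
  show "ennreal (freq v) = (\<integral>\<^sup>+w. (\<integral>\<^sup>+s. ennreal (K v w s * maxwellian w) \<partial>sphere_measure) \<partial>lborel)"
    unfolding collision_frequency_def eq[symmetric] using int nn by (intro nn_integral_eq_integral[symmetric]) auto
qed

lemma freq_nonneg: "0 \<le> freq v"
  unfolding collision_frequency_def by (intro integral_nonneg_AE AE_I2) (auto simp: K_nonneg)

lemma freq_bound: obtains C where "\<And>v. freq v \<le> C"
proof -
  obtain C where C: "0 \<le> C" "\<And>v. ennreal (freq v) \<le> ennreal C" using freq_bound_nn freq_nn by metis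
  then show ?thesis by (intro that[of C]) (simp add: freq_nonneg)
qed

lemma freq_pos: "0 < freq v"
proof -
  have "freq v \<noteq> 0"
  proof
    assume "freq v = 0"
    then have "ennreal ell * (\<integral>\<^sup>+w. ennreal (norm (v - w) powr \<gamma> * maxwellian w) \<partial>lborel) = 0"
      using freq_nn[of v] unfolding nn_integral_K[OF maxwellian_nonneg] by (subst (asm) nn_integral_cmult) auto
    then have "(\<integral>\<^sup>+w. ennreal (norm (v - w) powr \<gamma> * maxwellian w) \<partial>lborel) = 0" using ell_pos by simp
    then have "AE w in lborel. ennreal (norm (v - w) powr \<gamma> * maxwellian w) = 0"
      by (subst (asm) nn_integral_0_iff_AE) auto
    moreover have "AE w in lborel. w \<noteq> v" by (rule AE_lborel_singleton)
    ultimately have "AE w in (lborel :: 'a measure). False"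
    proof eventually_elim
      case (elim w)
      then have "0 < norm (v - w) powr \<gamma> * maxwellian w" using maxwellian_pos[of w] by simp
      with elim show ?case by (simp add: ennreal_eq_0_iff)
    qed
    then show False unfolding eventually_False ae_filter_eq_bot_iff by simp
  qed
  then show ?thesis using freq_nonneg[of v] by simp
qed

text \<open>One density for both parts of the operator: integrating it over \<open>(w, s)\<close>
  gives the loss term, and integrating its composition with \<open>collide\<close> gives the gain
  term.\<close>

definition loss_density :: "('a \<Rightarrow> real) \<Rightarrow> 'a \<times> 'a \<times> 'a \<Rightarrow> real" where
  "loss_density f = (\<lambda>(v, w, s). K v w s * f v * maxwellian w)"

lemma loss_density_measurable:
  assumes [measurable]: "f \<in> borel_measurable borel"
  shows "loss_density f \<in> borel_measurable borel"
proof -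
  have "loss_density f \<in> borel_measurable (borel \<Otimes>\<^sub>M (borel \<Otimes>\<^sub>M borel))"
    unfolding loss_density_def collision_kernel_def cos_deviation_def by measurable
  then show ?thesis by (simp add: borel_prod)
qed

lemma L1_measurable: "f \<in> L1 \<Longrightarrow> f \<in> borel_measurable borel"
  using borel_measurable_integrable[of lborel f] by (simp add: L1_def)

lemma loss_density_integral_v:
  "(\<integral>y. loss_density f (v, y) \<partial>(lborel \<Otimes>\<^sub>M sphere_measure)) = freq v * f v"
proof -
  have "(\<integral>y. loss_density f (v, y) \<partial>(lborel \<Otimes>\<^sub>M sphere_measure))
      = (\<integral>y. (case y of (w, s) \<Rightarrow> K v w s * maxwellian w) * f v \<partial>(lborel \<Otimes>\<^sub>M sphere_measure))"
    by (intro Bochner_Integration.integral_cong) (auto simp: loss_density_def)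
  also have "\<dots> = freq v * f v" by (simp add: collision_frequency_def)
  finally show ?thesis .
qed

lemma loss_density_integrable:
  assumes f: "f \<in> L1"
  shows "integrable collision_measure (loss_density f)"
proof (rule integrableI_bounded)
  note [measurable] = L1_measurable[OF f]
  have m: "loss_density f \<in> borel_measurable borel" by (rule loss_density_measurable) measurable
  show "loss_density f \<in> borel_measurable collision_measure" by (rule measurable_collision_measure[OF m])
  obtain C where C: "\<And>v. freq v \<le> C" using freq_bound by blast
  have C0: "0 \<le> C" using C[of 0] freq_nonneg[of 0] by simp
  have "(\<integral>\<^sup>+x. ennreal (norm (loss_density f x)) \<partial>collision_measure)
      = (\<integral>\<^sup>+v. (\<integral>\<^sup>+w. (\<integral>\<^sup>+s. ennreal (norm (loss_density f (v, w, s))) \<partial>sphere_measure) \<partial>lborel) \<partial>lborel)"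
    by (rule nn_integral_collision_measure) (use m in measurable)
  also have "\<dots> = (\<integral>\<^sup>+v. ennreal \<bar>f v\<bar> * ennreal (freq v) \<partial>lborel)"
  proof (rule nn_integral_cong)
    fix v :: 'a
    have "ennreal (norm (loss_density f (v, w, s))) = ennreal \<bar>f v\<bar> * ennreal (K v w s * maxwellian w)" for w s
      using K_nonneg[of v w s] maxwellian_pos[of w]
      by (simp add: loss_density_def abs_mult less_imp_le mult_ac flip: ennreal_mult)
    moreover have "(\<integral>\<^sup>+s. ennreal \<bar>f v\<bar> * ennreal (K v w s * maxwellian w) \<partial>sphere_measure)
        = ennreal \<bar>f v\<bar> * (\<integral>\<^sup>+s. ennreal (K v w s * maxwellian w) \<partial>sphere_measure)" for w
      unfolding collision_kernel_def cos_deviation_def by (intro nn_integral_cmult measurable_sphere_measure) measurable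
    moreover have "(\<integral>\<^sup>+w. ennreal \<bar>f v\<bar> * (\<integral>\<^sup>+s. ennreal (K v w s * maxwellian w) \<partial>sphere_measure) \<partial>lborel)
        = ennreal \<bar>f v\<bar> * (\<integral>\<^sup>+w. (\<integral>\<^sup>+s. ennreal (K v w s * maxwellian w) \<partial>sphere_measure) \<partial>lborel)"
      using maxwellian_pos by (intro nn_integral_cmult) (simp add: nn_integral_K less_imp_le)
    ultimately show "(\<integral>\<^sup>+w. (\<integral>\<^sup>+s. ennreal (norm (loss_density f (v, w, s))) \<partial>sphere_measure) \<partial>lborel)
        = ennreal \<bar>f v\<bar> * ennreal (freq v)"
      by (simp add: freq_nn)
  qed
  also have "\<dots> \<le> (\<integral>\<^sup>+v. ennreal C * ennreal (norm (f v)) \<partial>lborel)"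
    by (intro nn_integral_mono) (simp add: mult.commute[of "ennreal \<bar>_\<bar>"] mult_right_mono ennreal_leI C)
  also have "\<dots> = ennreal C * (\<integral>\<^sup>+v. ennreal (norm (f v)) \<partial>lborel)" by (rule nn_integral_cmult) measurable
  also have "\<dots> < \<infinity>" using f by (simp add: L1_def integrable_iff_bounded ennreal_mult_less_top)
  finally show "(\<integral>\<^sup>+x. ennreal (norm (loss_density f x)) \<partial>collision_measure) < \<infinity>" .
qed

lemma gain_eq: "Gain f v = (\<integral>y. loss_density f (collide (v, y)) \<partial>(lborel \<Otimes>\<^sub>M sphere_measure))"
  unfolding gain_def
  by (intro Bochner_Integration.integral_cong)
     (auto simp: loss_density_def collide_def K_collide space_pair_measure)

lemma gain_density_integrable:
  "f \<in> L1 \<Longrightarrow> integrable (lborel \<Otimes>\<^sub>M (lborel \<Otimes>\<^sub>M sphere_measure)) (\<lambda>x. loss_density f (collide x))"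
  using integrable_collide[OF loss_density_measurable[OF L1_measurable]] loss_density_integrable[of f]
  unfolding collision_measure_def by blast

lemma gain_L1: "f \<in> L1 \<Longrightarrow> Gain f \<in> L1"
  using lborel_lborel_sphere.integrable_fst'[OF gain_density_integrable[of f]]
  by (simp add: L1_def gain_eq[abs_def])

lemma loss_L1: assumes "f \<in> L1" shows "(\<lambda>v. freq v * f v) \<in> L1"
proof -
  have "integrable (lborel \<Otimes>\<^sub>M (lborel \<Otimes>\<^sub>M sphere_measure)) (loss_density f)"
    using loss_density_integrable[OF assms] by (simp add: collision_measure_def)
  from lborel_lborel_sphere.integrable_fst'[OF this] show ?thesis
    by (simp add: L1_def loss_density_integral_v)
qed

text \<open>Mass conservation: gain and loss densities differ by the measure-preserving map
  \<open>collide\<close>, so they have the same total integral.\<close>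

lemma integral_gain:
  assumes f: "f \<in> L1"
  shows "(\<integral>v. Gain f v \<partial>lborel) = (\<integral>v. freq v * f v \<partial>lborel)"
proof -
  have int: "integrable (lborel \<Otimes>\<^sub>M (lborel \<Otimes>\<^sub>M sphere_measure)) (loss_density f)"
    using loss_density_integrable[OF assms] by (simp add: collision_measure_def)
  have "(\<integral>v. Gain f v \<partial>lborel) = (\<integral>x. loss_density f (collide x) \<partial>collision_measure)"
    unfolding gain_eq collision_measure_def
    by (rule lborel_lborel_sphere.integral_fst'[OF gain_density_integrable[OF f]])
  also have "\<dots> = (\<integral>x. loss_density f x \<partial>collision_measure)"
    by (rule integral_collide[OF loss_density_measurable[OF L1_measurable[OF f]]])
  also have "\<dots> = (\<integral>v. freq v * f v \<partial>lborel)"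
    unfolding collision_measure_def loss_density_integral_v[symmetric]
    by (rule lborel_lborel_sphere.integral_fst'[OF int, symmetric])
  finally show ?thesis .
qed

lemma abs_gain_le: "\<bar>Gain f v\<bar> \<le> Gain (\<lambda>v. \<bar>f v\<bar>) v"
proof -
  have "\<bar>Gain f v\<bar> \<le> (\<integral>y. norm (loss_density f (collide (v, y))) \<partial>(lborel \<Otimes>\<^sub>M sphere_measure))"
    unfolding gain_eq real_norm_def[symmetric] by (rule integral_norm_bound)
  also have "\<dots> = Gain (\<lambda>v. \<bar>f v\<bar>) v"
    unfolding gain_eq using K_nonneg maxwellian_pos
    by (intro Bochner_Integration.integral_cong) (auto simp: loss_density_def abs_mult less_imp_le split: prod.split)
  finally show ?thesis .
qed

text \<open>Additivity holds only almost everywhere: at a fixed \<open>v\<close> the gain integrals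
  of \<open>f\<close> and \<open>g\<close> need not converge.\<close>

lemma gain_add: "f \<in> L1 \<Longrightarrow> g \<in> L1 \<Longrightarrow> L1_eq (Gain (\<lambda>v. f v + g v)) (\<lambda>v. Gain f v + Gain g v)"
proof -
  assume f: "f \<in> L1" and g: "g \<in> L1"
  show ?thesis unfolding L1_eq_def gain_eq
    using lborel_lborel_sphere.AE_integrable_fst'[OF gain_density_integrable[OF f]]
      lborel_lborel_sphere.AE_integrable_fst'[OF gain_density_integrable[OF g]]
  proof eventually_elim
    case (elim v)
    have "loss_density (\<lambda>v. f v + g v) x = loss_density f x + loss_density g x" for x
      by (auto simp: loss_density_def algebra_simps split: prod.split)
    with elim show ?case by (simp add: Bochner_Integration.integral_add)
  qed
qed

lemma gain_scale: "Gain (\<lambda>v. a * f v) v = a * Gain f v"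
proof -
  have "loss_density (\<lambda>v. a * f v) x = a * loss_density f x" for x
    by (auto simp: loss_density_def algebra_simps split: prod.split)
  then show ?thesis by (simp add: gain_eq)
qed

lemma L1_abs: "f \<in> L1 \<Longrightarrow> (\<lambda>v. \<bar>f v\<bar>) \<in> L1"
  by (simp add: L1_def)

lemma linear_boltzmann_L1: "f \<in> L1 \<Longrightarrow> Lin f \<in> L1"
  unfolding linear_boltzmann_def by (intro L1_intros gain_L1 loss_L1)

lemma integral_linear_boltzmann: "f \<in> L1 \<Longrightarrow> (\<integral>v. Lin f v \<partial>lborel) = 0"
  unfolding linear_boltzmann_def using gain_L1[of f] loss_L1[of f] integral_gain[of f]
  by (simp add: L1_def Bochner_Integration.integral_diff)

text \<open>Since \<open>1 - freq v / S\<close> is nonnegative, the modulus is at most the same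
  expression formed with \<open>|f|\<close>, and \<open>Lin\<close> applied to \<open>|f|\<close>
  integrates to zero.\<close>

lemma euler_contraction:
  assumes S: "0 < S" "\<And>v. freq v \<le> S" and f: "f \<in> L1"
  shows "L1_norm (\<lambda>v. f v + 1 / S * Lin f v) \<le> L1_norm f"
proof -
  let ?h = "\<lambda>v. \<bar>f v\<bar> + 1 / S * (Gain (\<lambda>v. \<bar>f v\<bar>) v - freq v * \<bar>f v\<bar>)"
  note af = L1_abs[OF f]
  have "L1_norm (\<lambda>v. f v + 1 / S * Lin f v) \<le> (\<integral>v. ?h v \<partial>lborel)"
    unfolding L1_norm_def
  proof (rule integral_mono)
    have "(\<lambda>v. f v + 1 / S * Lin f v) \<in> L1" by (intro L1_intros linear_boltzmann_L1 f)
    then show "integrable lborel (\<lambda>v. \<bar>f v + 1 / S * Lin f v\<bar>)" by (simp add: L1_def)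
    have "?h \<in> L1" by (intro L1_intros gain_L1 loss_L1 af)
    then show "integrable lborel ?h" by (simp add: L1_def)
    fix v :: 'a
    have "freq v / S \<le> 1" using S by simp
    have "f v + 1 / S * Lin f v = (1 - freq v / S) * f v + Gain f v / S"
      by (simp add: linear_boltzmann_def algebra_simps diff_divide_distrib)
    also have "\<bar>\<dots>\<bar> \<le> \<bar>(1 - freq v / S) * f v\<bar> + \<bar>Gain f v / S\<bar>" by (rule abs_triangle_ineq)
    also have "\<dots> = (1 - freq v / S) * \<bar>f v\<bar> + \<bar>Gain f v\<bar> / S"
      using \<open>freq v / S \<le> 1\<close> S by (simp add: abs_mult)
    also have "\<dots> \<le> (1 - freq v / S) * \<bar>f v\<bar> + Gain (\<lambda>v. \<bar>f v\<bar>) v / S"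
      using S abs_gain_le[of f v] by (intro add_left_mono divide_right_mono) auto
    also have "\<dots> = ?h v" by (simp add: algebra_simps diff_divide_distrib)
    finally show "\<bar>f v + 1 / S * Lin f v\<bar> \<le> ?h v" .
  qed
  also have "\<dots> = (\<integral>v. \<bar>f v\<bar> \<partial>lborel) + (\<integral>v. 1 / S * (Gain (\<lambda>v. \<bar>f v\<bar>) v - freq v * \<bar>f v\<bar>) \<partial>lborel)"
  proof (rule Bochner_Integration.integral_add)
    have "(\<lambda>v. 1 / S * (Gain (\<lambda>v. \<bar>f v\<bar>) v - freq v * \<bar>f v\<bar>)) \<in> L1" by (intro L1_intros gain_L1 loss_L1 af)
    then show "integrable lborel (\<lambda>v. 1 / S * (Gain (\<lambda>v. \<bar>f v\<bar>) v - freq v * \<bar>f v\<bar>))" by (simp add: L1_def)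
  qed (use af in \<open>simp add: L1_def\<close>)
  also have "(\<integral>v. 1 / S * (Gain (\<lambda>v. \<bar>f v\<bar>) v - freq v * \<bar>f v\<bar>) \<partial>lborel) = 0"
    using integral_linear_boltzmann[OF af] by (simp add: linear_boltzmann_def)
  finally show ?thesis by (simp add: L1_norm_def)
qed

lemma linear_boltzmann_bounded_linear: "L1_bounded_linear Lin"
  unfolding L1_bounded_linear_def
proof (intro conjI ballI allI)
  show "Lin f \<in> L1" if "f \<in> L1" for f :: "'a \<Rightarrow> real" using that by (rule linear_boltzmann_L1)
  show "L1_eq (Lin (\<lambda>v. f v + g v)) (\<lambda>v. Lin f v + Lin g v)"
    if "f \<in> L1" "g \<in> L1" for f g :: "'a \<Rightarrow> real"
    using gain_add[OF that] unfolding L1_eq_def linear_boltzmann_def by eventually_elim (simp add: algebra_simps)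
  show "L1_eq (Lin (\<lambda>v. a * f v)) (\<lambda>v. a * Lin f v)" for a and f :: "'a \<Rightarrow> real"
    by (simp add: L1_eq_def linear_boltzmann_def gain_scale algebra_simps)
  obtain C where C: "\<And>v. freq v \<le> C" using freq_bound by blast
  have Cp: "0 < C" using C[of 0] freq_pos[of 0] by simp
  show "\<exists>C'. \<forall>f\<in>L1. L1_norm (Lin f) \<le> C' * L1_norm (f :: 'a \<Rightarrow> real)"
  \<comment> \<open>From \<open>Lin f = C * ((f + Lin f / C) - f)\<close>, where the first term in
    the bracket has norm at most that of \<open>f\<close>.\<close>
  proof (intro exI[of _ "2 * C"] ballI)
    fix f :: "'a \<Rightarrow> real" assume f: "f \<in> L1"
    have Lf: "Lin f \<in> L1" by (rule linear_boltzmann_L1[OF f])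
    have "L1_norm (Lin f) = C * L1_norm (\<lambda>v. 1 / C * Lin f v)"
      unfolding L1_norm_scale using Cp by simp
    also have "L1_norm (\<lambda>v. 1 / C * Lin f v) = L1_norm (\<lambda>v. (f v + 1 / C * Lin f v) + (-1) * f v)"
      by simp
    also have "\<dots> \<le> L1_norm (\<lambda>v. f v + 1 / C * Lin f v) + L1_norm (\<lambda>v. (-1) * f v)"
      by (intro L1_norm_triangle L1_intros f Lf)
    also have "\<dots> \<le> L1_norm f + L1_norm f"
      using euler_contraction[OF Cp C f] L1_norm_scale[of "-1" f] by simp
    finally show "L1_norm (Lin f) \<le> 2 * C * L1_norm f" using Cp by (simp add: mult_left_mono)
  qed
qed

end

section \<open>The kernel of the operator\<close>

lemma AE_lborel_translate:
  fixes a :: "'a::euclidean_space"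
  assumes "AE v in lborel. P v"
  shows "AE v in lborel. P (a + v)"
proof -
  have "AE v in distr lborel borel ((+) a). P v" using assms by (subst lborel_distr_plus)
  then show ?thesis by (rule AE_distrD[rotated]) simp
qed

context collision_operator
begin

text \<open>An entropy dissipation argument. Multiplying gain minus loss by
  \<open>arctan (u v)\<close> and integrating gives \<open>0\<close>; averaging with the collided
  variables gives a nonnegative integrand. Boundedness of the arctangent makes the product
  integrable, and strict monotonicity forces equality of \<open>u\<close> where the integrand
  vanishes.\<close>

lemma kernel_collision_invariant:
  assumes h: "h \<in> L1" and Lh: "L1_eq (Lin h) (\<lambda>v. 0)"
  defines "u \<equiv> \<lambda>v. h v / maxwellian v"
  shows "AE x in collision_measure. case x of (v, w, s) \<Rightarrow> K v w s \<noteq> 0 \<longrightarrow> u (post_velocity v w s) = u v"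
proof -
  note hm [measurable] = L1_measurable[OF h]
  have um [measurable]: "u \<in> borel_measurable borel" unfolding u_def by measurable
  define D where "D x = loss_density h (collide x) - loss_density h x" for x
  define X where "X x = arctan (u (fst x)) * D x" for x :: "'a \<times> 'a \<times> 'a"
  have ldm: "loss_density h \<in> borel_measurable borel" by (rule loss_density_measurable[OF hm])
  have Dm [measurable]: "D \<in> borel_measurable borel"
    unfolding D_def using ldm measurable_compose[OF collide_measurable ldm] by measurable
  have Xm: "X \<in> borel_measurable borel"
  proof -
    have "fst \<in> borel_measurable (borel :: ('a \<times> 'a \<times> 'a) measure)"
      by (simp add: borel_prod[symmetric])
    then show ?thesis unfolding X_def by measurable
  qed
  have ld: "integrable collision_measure (loss_density h)" by (rule loss_density_integrable[OF h])
  have ldc: "integrable collision_measure (\<lambda>x. loss_density h (collide x))"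
    using integrable_collide[OF ldm] ld by simp
  have Dint: "integrable collision_measure D" unfolding D_def by (intro Bochner_Integration.integrable_diff ld ldc)
  have Xint: "integrable collision_measure X"
  proof (rule Bochner_Integration.integrable_bound)
    show "integrable collision_measure (\<lambda>x. pi / 2 * D x)" using Dint by simp
    show "X \<in> borel_measurable collision_measure" by (rule measurable_collision_measure[OF Xm])
    have "\<bar>arctan y\<bar> \<le> pi / 2" for y using arctan_lbound[of y] arctan_ubound[of y] by linarith
    then have "norm (X x) \<le> norm (pi / 2 * D x)" for x
      unfolding X_def by (simp add: abs_mult mult_right_mono del: times_divide_eq_left)
    then show "AE x in collision_measure. norm (X x) \<le> norm (pi / 2 * D x)" by simp
  qed
  have X0: "(\<integral>x. X x \<partial>collision_measure) = 0"
  proof -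
    have "(\<integral>x. X x \<partial>collision_measure) = (\<integral>v. (\<integral>y. X (v, y) \<partial>(lborel \<Otimes>\<^sub>M sphere_measure)) \<partial>lborel)"
      using lborel_lborel_sphere.integral_fst'[of X] Xint by (simp add: collision_measure_def)
    also have "\<dots> = 0"
    proof (rule integral_eq_zero_AE)
      show "AE v in lborel. (\<integral>y. X (v, y) \<partial>(lborel \<Otimes>\<^sub>M sphere_measure)) = 0"
        using lborel_lborel_sphere.AE_integrable_fst'[OF ld[unfolded collision_measure_def]]
          lborel_lborel_sphere.AE_integrable_fst'[OF ldc[unfolded collision_measure_def]] Lh[unfolded L1_eq_def]
      proof eventually_elim
        case (elim v)
        have "(\<integral>y. X (v, y) \<partial>(lborel \<Otimes>\<^sub>M sphere_measure)) = arctan (u v) * Lin h v"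
          unfolding X_def D_def linear_boltzmann_def gain_eq loss_density_integral_v[symmetric]
          using elim by (simp add: Bochner_Integration.integral_diff)
        then show ?case using elim by simp
      qed
    qed
    finally show ?thesis .
  qed
  \<comment> \<open>The dissipation. As \<open>maxwellian v * maxwellian w\<close> and
    \<open>K\<close> are collision invariants, gain and loss densities are the same factor
    \<open>k\<close> times \<open>u\<close> after and before the collision.\<close>
  define Y where "Y x = (case x of (v, w, s) \<Rightarrow> K v w s * (maxwellian v * maxwellian w)
      * ((arctan (u (post_velocity v w s)) - arctan (u v)) * (u (post_velocity v w s) - u v)))" for x
  have XY: "Y x = - (X x + X (collide x))" if "x \<in> space collision_measure" for x
  proof -
    obtain v w s where x: "x = (v, w, s)" by (cases x)
    have s: "norm s = 1" using that unfolding x collision_measure_def by (auto simp: space_pair_measure)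
    define k where "k = K v w s * (maxwellian v * maxwellian w)"
    have l1: "loss_density h x = k * u v"
      using maxwellian_pos[of v] by (simp add: x loss_density_def k_def u_def)
    have "loss_density h (collide x) = K v w s * h (post_velocity v w s) * maxwellian (post_velocity_star v w s)"
      by (simp add: x loss_density_def collide_def K_collide[OF s])
    also have "\<dots> = K v w s * (maxwellian (post_velocity v w s) * maxwellian (post_velocity_star v w s)) * u (post_velocity v w s)"
      using maxwellian_pos[of "post_velocity v w s"] by (simp add: u_def)
    finally have l2: "loss_density h (collide x) = k * u (post_velocity v w s)"
      unfolding maxwellian_collide[OF s] k_def .
    have l3: "loss_density h (collide (collide x)) = k * u v"
    \<comment> \<open>On the diagonal \<open>collide\<close> is not an involution, but the kernel is
      zero there by \<open>0 powr \<gamma> = 0\<close>.\<close>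
    proof (cases "v = w")
      case True
      then have "k = 0" by (simp add: k_def collision_kernel_def)
      moreover have "loss_density h (collide (collide x)) = 0"
        using True by (simp add: x collide_def loss_density_def post_velocity_def post_velocity_star_def collision_kernel_def)
      ultimately show ?thesis by simp
    next
      case False
      then have "collide (collide x) = x" using collide_involution[OF s] by (simp add: x)
      then show ?thesis using l1 by simp
    qed
    have "X x = arctan (u v) * (k * u (post_velocity v w s) - k * u v)"
      unfolding X_def D_def l1 l2 by (simp add: x)
    moreover have "X (collide x) = arctan (u (post_velocity v w s)) * (k * u v - k * u (post_velocity v w s))"
      unfolding X_def D_def l3 l2 by (simp add: x collide_def)
    moreover have "Y x = k * ((arctan (u (post_velocity v w s)) - arctan (u v)) * (u (post_velocity v w s) - u v))"
      by (simp add: Y_def x k_def)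
    ultimately show ?thesis by (simp add: algebra_simps)
  qed
  have Xc: "integrable collision_measure (\<lambda>x. X (collide x))" using integrable_collide[OF Xm] Xint by simp
  have "integrable collision_measure (\<lambda>x. - (X x + X (collide x)))" using Xint Xc by simp
  then have Yint: "integrable collision_measure Y"
    by (subst Bochner_Integration.integrable_cong[OF refl XY]) simp_all
  have "(\<integral>x. Y x \<partial>collision_measure) = (\<integral>x. - (X x + X (collide x)) \<partial>collision_measure)"
    by (rule Bochner_Integration.integral_cong[OF refl XY])
  also have "\<dots> = 0" using Xint Xc X0 integral_collide[OF Xm] by simp
  finally have Y0: "(\<integral>x. Y x \<partial>collision_measure) = 0" .
  have mono: "0 \<le> (arctan p - arctan q) * (p - q)" for p q :: real
    by (cases p q rule: linorder_cases) (auto simp: mult_nonpos_nonpos arctan_le_iff)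
  have Ynn: "0 \<le> Y x" for x
    by (cases x) (auto simp: Y_def intro!: mult_nonneg_nonneg K_nonneg mono)
  have "AE x in collision_measure. Y x = 0"
    using integral_nonneg_eq_0_iff_AE[OF Yint] Ynn Y0 by simp
  then show ?thesis
  proof eventually_elim
    case (elim x)
    obtain v w s where x: "x = (v, w, s)" by (cases x)
    have "u (post_velocity v w s) = u v" if "K v w s \<noteq> 0"
    proof -
      have "(arctan (u (post_velocity v w s)) - arctan (u v)) * (u (post_velocity v w s) - u v) = 0"
        using elim that maxwellian_pos[of v] maxwellian_pos[of w] by (auto simp: Y_def x)
      then show ?thesis by (auto simp: arctan_eq_iff)
    qed
    then show ?case by (simp add: x)
  qed
qed

text \<open>The measure of the set where translation by \<open>y\<close> changes \<open>u\<close>.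
  As a Borel function of \<open>y\<close>, it makes the property of being an almost-everywhere
  period accessible to Fubini's theorem.\<close>

definition period_defect :: "('a \<Rightarrow> real) \<Rightarrow> 'a \<Rightarrow> ennreal" where
  "period_defect u y = (\<integral>\<^sup>+v. (if u (v + y) = u v then 0 else 1) \<partial>lborel)"

lemma period_defect_measurable:
  assumes [measurable]: "u \<in> borel_measurable borel"
  shows "period_defect u \<in> borel_measurable borel"
proof -
  have "(\<lambda>(y, v). if u (v + y) = u v then 0 else 1 :: ennreal) \<in> borel_measurable (borel \<Otimes>\<^sub>M lborel)" by measurable
  then show ?thesis
    using lborel.borel_measurable_nn_integral_fst[of "\<lambda>(y, v). if u (v + y) = u v then 0 else 1 :: ennreal" borel]
    by (simp add: period_defect_def[abs_def])
qed

lemma period_defect_eq_0: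
  assumes [measurable]: "u \<in> borel_measurable borel"
  shows "period_defect u y = 0 \<longleftrightarrow> (AE v in lborel. u (v + y) = u v)"
proof -
  have "period_defect u y = 0 \<longleftrightarrow> (AE v in lborel. (if u (v + y) = u v then 0 else 1) = (0::ennreal))"
    unfolding period_defect_def by (rule nn_integral_0_iff_AE) measurable
  also have "\<dots> \<longleftrightarrow> (AE v in lborel. u (v + y) = u v)" by (simp add: if_split)
  finally show ?thesis .
qed

lemma period_defect_add:
  assumes u: "u \<in> borel_measurable borel" and "period_defect u y = 0" "period_defect u z = 0"
  shows "period_defect u (y + z) = 0"
proof -
  have y: "AE v in lborel. u (v + y) = u v" and z: "AE v in lborel. u (v + z) = u v"
    using assms period_defect_eq_0[OF u] by auto
  from AE_lborel_translate[OF z, of y] y have "AE v in lborel. u (v + (y + z)) = u v"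
    by eventually_elim (simp add: add_ac)
  then show ?thesis using period_defect_eq_0[OF u] by simp
qed

lemma period_defect_uminus:
  assumes u: "u \<in> borel_measurable borel" and "period_defect u y = 0"
  shows "period_defect u (- y) = 0"
proof -
  have y: "AE v in lborel. u (v + y) = u v" using assms period_defect_eq_0[OF u] by auto
  from AE_lborel_translate[OF y, of "- y"] have "AE v in lborel. u (v + - y) = u v"
    by eventually_elim (simp add: add_ac)
  then show ?thesis using period_defect_eq_0[OF u] by simp
qed

text \<open>Periods form a group, and \<open>t y = (t + r) y - r y\<close>. For
  \<open>t \<ge> 0\<close> almost every \<open>r > 0\<close> makes both terms on the right periods,
  so some \<open>r\<close> does; negative \<open>t\<close> follow by reflection.\<close>

lemma period_defect_line:
  assumes u: "u \<in> borel_measurable borel" and ae: "AE r in lborel. 0 < r \<longrightarrow> period_defect u (r *\<^sub>R y) = 0"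
  shows "period_defect u (t *\<^sub>R y) = 0"
proof -
  have main: "period_defect u (t *\<^sub>R y) = 0" if t: "0 \<le> t" for t
  proof -
    have "AE r in lborel. 0 < r \<longrightarrow> period_defect u (r *\<^sub>R y) = 0 \<and> period_defect u ((t + r) *\<^sub>R y) = 0"
      using ae AE_lborel_translate[OF ae, of t] by eventually_elim (use t in auto)
    then have "\<exists>r. 0 < r \<and> period_defect u (r *\<^sub>R y) = 0 \<and> period_defect u ((t + r) *\<^sub>R y) = 0"
    proof (rule contrapos_pp)
      assume "\<nexists>r. 0 < r \<and> period_defect u (r *\<^sub>R y) = 0 \<and> period_defect u ((t + r) *\<^sub>R y) = 0"
      then have *: "(0 < r \<longrightarrow> period_defect u (r *\<^sub>R y) = 0 \<and> period_defect u ((t + r) *\<^sub>R y) = 0) \<longleftrightarrow> r \<notin> {0<..}" for r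
        by auto
      show "\<not> (AE r in lborel. 0 < r \<longrightarrow> period_defect u (r *\<^sub>R y) = 0 \<and> period_defect u ((t + r) *\<^sub>R y) = 0)"
      proof
        assume "AE r in lborel. 0 < r \<longrightarrow> period_defect u (r *\<^sub>R y) = 0 \<and> period_defect u ((t + r) *\<^sub>R y) = 0"
        then have "AE r in lborel. r \<notin> {0<..<1::real}" unfolding * by eventually_elim auto
        then have "{0<..<1::real} \<in> null_sets lborel" by (subst AE_iff_null_sets) auto
        then have "emeasure lborel {0<..<1::real} = 0" by (rule null_setsD1)
        then show False by simp
      qed
    qed
    then obtain r where r: "period_defect u (r *\<^sub>R y) = 0" "period_defect u ((t + r) *\<^sub>R y) = 0" by blast
    have "t *\<^sub>R y = (t + r) *\<^sub>R y + - (r *\<^sub>R y)" by (simp add: algebra_simps)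
    then show ?thesis using period_defect_add[OF u r(2) period_defect_uminus[OF u r(1)]] by simp
  qed
  show ?thesis
  proof (cases "0 \<le> t")
    case False
    then have "period_defect u (- ((- t) *\<^sub>R y)) = 0" by (intro period_defect_uminus[OF u] main) simp
    then show ?thesis by simp
  qed (rule main)
qed

text \<open>With \<open>z = v - w\<close> the collision shifts \<open>v\<close> by
  \<open>(|z| s - z) / 2\<close>, which does not depend on \<open>v\<close>. Integrating over
  \<open>v\<close> first produces the period defect, and polar coordinates
  \<open>z = r \<omega>\<close> turn the shifts into the multiples
  \<open>r (s - \<omega>) / 2\<close>.\<close>

lemma collision_invariant_periods:
  assumes u [measurable]: "u \<in> borel_measurable borel"
    and inv: "AE x in collision_measure. case x of (v, w, s) \<Rightarrow> K v w s \<noteq> 0 \<longrightarrow> u (post_velocity v w s) = u v"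
  shows "AE s in sphere_measure. AE \<omega> in sphere_measure. b (\<omega> \<bullet> s) \<noteq> 0 \<longrightarrow> (\<forall>t. period_defect u (t *\<^sub>R (s - \<omega>)) = 0)"
proof -
  define I where "I v w s = (if K v w s = 0 \<or> u (post_velocity v w s) = u v then 0 else 1 :: ennreal)" for v w s
  have Im [measurable]: "(\<lambda>(v, w, s). I v w s) \<in> borel_measurable (borel \<Otimes>\<^sub>M (borel \<Otimes>\<^sub>M borel))"
    unfolding I_def collision_kernel_def cos_deviation_def post_velocity_def by measurable
  then have Imb: "(\<lambda>(v, w, s). I v w s) \<in> borel_measurable (borel :: ('a \<times> 'a \<times> 'a) measure)" by (simp add: borel_prod)
  note [measurable] = period_defect_measurable[OF u]
  \<comment> \<open>The conditions express that the kernel does not vanish; neither depends on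
    \<open>v\<close>.\<close>
  define E where "E z s = (if z \<noteq> 0 \<and> b ((z /\<^sub>R norm z) \<bullet> s) \<noteq> 0 then period_defect u ((norm z *\<^sub>R s - z) /\<^sub>R 2) else 0)" for z s :: 'a
  have Em [measurable]: "(\<lambda>(z, s). E z s) \<in> borel_measurable (borel \<Otimes>\<^sub>M borel)" unfolding E_def by measurable
  have IE: "(\<integral>\<^sup>+v. I v (v - z) s \<partial>lborel) = E z s" for z s
  proof -
    have K: "K v (v - z) s = 0 \<longleftrightarrow> \<not> (z \<noteq> 0 \<and> b ((z /\<^sub>R norm z) \<bullet> s) \<noteq> 0)" for v
      by (auto simp: collision_kernel_def cos_deviation_def)
    have p: "post_velocity v (v - z) s = v + (norm z *\<^sub>R s - z) /\<^sub>R 2" for v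
      using scaleR_half_double[of v] by (simp add: post_velocity_def scaleR_add_right scaleR_diff_right)
    show ?thesis
      unfolding I_def E_def period_defect_def K p
      by (cases "z \<noteq> 0 \<and> b ((z /\<^sub>R norm z) \<bullet> s) \<noteq> 0") auto
  qed
  have "0 = (\<integral>\<^sup>+x. (case x of (v, w, s) \<Rightarrow> I v w s) \<partial>collision_measure)"
  proof -
    have "AE x in collision_measure. (case x of (v, w, s) \<Rightarrow> I v w s) = 0"
      using inv by eventually_elim (auto simp: I_def)
    then have "(\<integral>\<^sup>+x. (case x of (v, w, s) \<Rightarrow> I v w s) \<partial>collision_measure) = (\<integral>\<^sup>+x. 0 \<partial>(collision_measure :: ('a \<times> 'a \<times> 'a) measure))"
      by (rule nn_integral_cong_AE)
    then show ?thesis by simp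
  qed
  also have "\<dots> = (\<integral>\<^sup>+v. (\<integral>\<^sup>+w. (\<integral>\<^sup>+s. I v w s \<partial>sphere_measure) \<partial>lborel) \<partial>lborel)"
    using nn_integral_collision_measure[OF Imb] by simp
  also have "\<dots> = (\<integral>\<^sup>+z. (\<integral>\<^sup>+v. (\<integral>\<^sup>+s. I v (v - z) s \<partial>sphere_measure) \<partial>lborel) \<partial>lborel)"
  proof (rule nn_integral_relative_velocity)
    have "(\<lambda>x. I (fst (fst x)) (snd (fst x)) (snd x)) \<in> borel_measurable ((borel \<Otimes>\<^sub>M borel) \<Otimes>\<^sub>M sphere_measure)"
      unfolding I_def collision_kernel_def cos_deviation_def post_velocity_def
      by (rule measurable_pair_sphere_measure) measurable
    from sphere_measure.borel_measurable_nn_integral_fst[OF this]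
    show "(\<lambda>(v, w). \<integral>\<^sup>+s. I v w s \<partial>sphere_measure) \<in> borel_measurable (borel \<Otimes>\<^sub>M borel)"
      by (simp add: case_prod_beta')
  qed
  also have "\<dots> = (\<integral>\<^sup>+z. (\<integral>\<^sup>+s. (\<integral>\<^sup>+v. I v (v - z) s \<partial>lborel) \<partial>sphere_measure) \<partial>lborel)"
  proof (rule nn_integral_cong)
    fix z :: 'a
    have "(\<lambda>(v, s). I v (v - z) s) \<in> borel_measurable (lborel \<Otimes>\<^sub>M sphere_measure)"
      unfolding I_def collision_kernel_def cos_deviation_def post_velocity_def
      by (rule measurable_pair_sphere_measure) measurable
    then show "(\<integral>\<^sup>+v. (\<integral>\<^sup>+s. I v (v - z) s \<partial>sphere_measure) \<partial>lborel) = (\<integral>\<^sup>+s. (\<integral>\<^sup>+v. I v (v - z) s \<partial>lborel) \<partial>sphere_measure)"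
      by (rule lborel_sphere.Fubini'[symmetric])
  qed
  also have "\<dots> = (\<integral>\<^sup>+z. (\<integral>\<^sup>+s. E z s \<partial>sphere_measure) \<partial>lborel)" by (simp only: IE)
  also have "\<dots> = (\<integral>\<^sup>+s. (\<integral>\<^sup>+z. E z s \<partial>lborel) \<partial>sphere_measure)"
    by (rule lborel_sphere.Fubini'[symmetric]) (rule measurable_pair_sphere_measure, use Em in simp)
  finally have "(\<integral>\<^sup>+s. (\<integral>\<^sup>+z. E z s \<partial>lborel) \<partial>sphere_measure) = 0" by simp
  then have "AE s in sphere_measure. (\<integral>\<^sup>+z. E z s \<partial>lborel) = 0"
    by (subst (asm) nn_integral_0_iff_AE) (rule measurable_sphere_measure, measurable)
  then show ?thesis
  proof eventually_elim
    case (elim s)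
    define Q where "Q \<omega> = (\<integral>\<^sup>+r. E (r *\<^sub>R \<omega>) s * ennreal (r ^ (DIM('a) - 1)) * indicator {0<..} r \<partial>lborel)" for \<omega>
    have "(\<integral>\<^sup>+\<omega>. Q \<omega> \<partial>sphere_measure) = 0"
      unfolding Q_def elim[symmetric] by (rule nn_integral_polar[symmetric]) measurable
    then have "AE \<omega> in sphere_measure. Q \<omega> = 0"
      by (subst (asm) nn_integral_0_iff_AE) (rule measurable_sphere_measure, unfold Q_def, measurable)
    moreover have "AE \<omega> in (sphere_measure :: 'a measure). norm \<omega> = 1" by (rule AE_I2) simp
    ultimately show ?case
    proof eventually_elim
      case (elim \<omega>)
      have "\<forall>t. period_defect u (t *\<^sub>R (s - \<omega>)) = 0" if bs: "b (\<omega> \<bullet> s) \<noteq> 0"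
      proof
        fix t
        have "AE r in lborel. E (r *\<^sub>R \<omega>) s * ennreal (r ^ (DIM('a) - 1)) * indicator {0<..} r = 0"
          using elim(1) unfolding Q_def by (subst (asm) nn_integral_0_iff_AE) measurable
        then have "AE r in lborel. 0 < r \<longrightarrow> period_defect u (r *\<^sub>R ((s - \<omega>) /\<^sub>R 2)) = 0"
        proof eventually_elim
          case (elim r)
          show ?case
          proof
            assume r: "0 < r"
            then have "E (r *\<^sub>R \<omega>) s = 0" using elim by auto
            moreover have "\<omega> \<noteq> 0" "(r *\<^sub>R \<omega>) /\<^sub>R norm (r *\<^sub>R \<omega>) = \<omega>" "norm (r *\<^sub>R \<omega>) = r"
              using r \<open>norm \<omega> = 1\<close> by auto
            ultimately show "period_defect u (r *\<^sub>R ((s - \<omega>) /\<^sub>R 2)) = 0"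
              using r bs by (simp add: E_def scaleR_diff_right mult.commute)
          qed
        qed
        \<comment> \<open>The factor \<open>2\<close> undoes the halving in the shift.\<close>
        from period_defect_line[OF u this, of "2 * t"] show "period_defect u (t *\<^sub>R (s - \<omega>)) = 0" by simp
      qed
      then show ?case by blast
    qed
  qed
qed

text \<open>The vectors whose multiples are all periods form a subspace \<open>H\<close>. If it had
  a nonzero normal \<open>n\<close>, then for a suitable \<open>s\<close> almost all
  \<open>\<omega>\<close> with \<open>b (\<omega> \<bullet> s)\<close> nonzero would satisfy
  \<open>n \<bullet> \<omega> = n \<bullet> s\<close>. Such \<open>\<omega>\<close> form a null set,
  so the angular mass would vanish.\<close>

lemma collision_invariant_translation_invariant:
  assumes u: "u \<in> borel_measurable borel"
    and inv: "AE x in collision_measure. case x of (v, w, s) \<Rightarrow> K v w s \<noteq> 0 \<longrightarrow> u (post_velocity v w s) = u v"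
  shows "period_defect u y = 0"
proof (rule ccontr)
  assume y: "period_defect u y \<noteq> 0"
  define H where "H = {x. \<forall>t. period_defect u (t *\<^sub>R x) = 0}"
  have p0: "period_defect u 0 = 0" by (simp add: period_defect_def)
  have sub: "subspace H"
    unfolding subspace_def H_def by (auto simp: p0 scaleR_add_right intro: period_defect_add[OF u])
  have "y \<notin> H"
  proof
    assume "y \<in> H"
    then have "period_defect u (1 *\<^sub>R y) = 0" unfolding H_def by blast
    with y show False by simp
  qed
  then have "span H \<noteq> UNIV" using span_eq_iff[of H] sub by (metis UNIV_I)
  then have "dim H < DIM('a)" using dim_subset_UNIV[of H] dim_eq_full[of H] by (meson le_neq_implies_less)
  then obtain n where n: "n \<noteq> 0" "\<And>x. x \<in> span H \<Longrightarrow> orthogonal n x"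
    using orthogonal_to_subspace_exists[of H] by metis
  \<comment> \<open>Extracting one \<open>s\<close> requires that the surface measure is not zero;
    otherwise the angular mass would be zero too.\<close>
  have ex: "\<exists>s. norm s = 1 \<and> (AE \<omega> in sphere_measure. b (\<omega> \<bullet> s) \<noteq> 0 \<longrightarrow> s - \<omega> \<in> H)"
  proof (rule ccontr)
    assume neg: "\<not> ?thesis"
    have "AE s in (sphere_measure :: 'a measure). norm s = 1" by (rule AE_I2) simp
    with collision_invariant_periods[OF u inv] have "AE s in (sphere_measure :: 'a measure). False"
    proof eventually_elim
      case (elim s)
      then have "AE \<omega> in sphere_measure. b (\<omega> \<bullet> s) \<noteq> 0 \<longrightarrow> s - \<omega> \<in> H" by (simp add: H_def)
      with elim neg show ?case by blast
    qed
    then have "(\<integral>\<^sup>+s. ennreal (b (e \<bullet> s)) \<partial>sphere_measure) = (\<integral>\<^sup>+s. 0 \<partial>(sphere_measure :: 'a measure))" for e :: 'a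
      by (intro nn_integral_cong_AE) (auto elim: eventually_mono)
    moreover obtain e :: 'a where "norm e = 1" using SOME_Basis norm_Basis by blast
    ultimately show False using angular[of e] ell_pos by simp
  qed
  then obtain s where s: "norm s = 1" and ae: "AE \<omega> in sphere_measure. b (\<omega> \<bullet> s) \<noteq> 0 \<longrightarrow> s - \<omega> \<in> H" by blast
  have "AE \<omega> in sphere_measure. ennreal (b (s \<bullet> \<omega>)) = 0"
    using ae AE_sphere_not_in_hyperplane[OF dim n(1), of "n \<bullet> s"]
  proof eventually_elim
    case (elim \<omega>)
    have "s - \<omega> \<notin> H"
    proof
      assume "s - \<omega> \<in> H"
      then have "orthogonal n (s - \<omega>)" by (intro n(2) span_base)
      then show False using elim by (simp add: orthogonal_def inner_diff_right)
    qed
    then show ?case using elim by (simp add: inner_commute)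
  qed
  then have "(\<integral>\<^sup>+\<omega>. ennreal (b (s \<bullet> \<omega>)) \<partial>sphere_measure) = (\<integral>\<^sup>+\<omega>. 0 \<partial>(sphere_measure :: 'a measure))"
    by (rule nn_integral_cong_AE)
  then show False using angular[OF s] ell_pos by simp
qed

text \<open>Exchanging the quantifiers by Fubini's theorem yields one base point \<open>v\<close>
  with \<open>u (v + y) = u v\<close> for almost every \<open>y\<close>.\<close>

lemma translation_invariant_constant:
  assumes u [measurable]: "u \<in> borel_measurable borel" and per: "\<And>y. period_defect u y = 0"
  shows "\<exists>c. AE v in lborel. u v = c"
proof -
  have "(\<integral>\<^sup>+v. (\<integral>\<^sup>+y. (if u (v + y) = u v then 0 else 1) \<partial>lborel) \<partial>lborel)
      = (\<integral>\<^sup>+y. (\<integral>\<^sup>+v. (if u (v + y) = u v then 0 else 1 :: ennreal) \<partial>lborel) \<partial>lborel)"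
    by (rule lborel_pair.Fubini') measurable
  also have "\<dots> = (\<integral>\<^sup>+y. period_defect u y \<partial>lborel)"
    unfolding period_defect_def ..
  also have "\<dots> = 0" by (simp add: per)
  finally have "(\<integral>\<^sup>+v. (\<integral>\<^sup>+y. (if u (v + y) = u v then 0 else 1 :: ennreal) \<partial>lborel) \<partial>lborel) = 0" .
  then have "AE v in lborel. (\<integral>\<^sup>+y. (if u (v + y) = u v then 0 else 1 :: ennreal) \<partial>lborel) = 0"
    by (subst (asm) nn_integral_0_iff_AE) measurable
  then have "\<exists>v. (\<integral>\<^sup>+y. (if u (v + y) = u v then 0 else 1 :: ennreal) \<partial>lborel) = 0"
  proof (rule contrapos_pp)
    assume "\<nexists>v. (\<integral>\<^sup>+y. (if u (v + y) = u v then 0 else 1 :: ennreal) \<partial>lborel) = 0"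
    then show "\<not> (AE v in lborel. (\<integral>\<^sup>+y. (if u (v + y) = u v then 0 else 1 :: ennreal) \<partial>lborel) = 0)"
      by (simp add: eventually_False ae_filter_eq_bot_iff)
  qed
  then obtain v where v: "(\<integral>\<^sup>+y. (if u (v + y) = u v then 0 else 1 :: ennreal) \<partial>lborel) = 0" by blast
  then have "AE y in lborel. (if u (v + y) = u v then 0 else 1 :: ennreal) = 0"
    by (subst (asm) nn_integral_0_iff_AE) measurable
  then have "AE y in lborel. u (v + y) = u v" by eventually_elim (auto split: if_splits)
  from AE_lborel_translate[OF this, of "- v"] show ?thesis by auto
qed

theorem kernel_eq_span_maxwellian:
  assumes "h \<in> L1_ker Lin"
  shows "L1_eq h (\<lambda>v. (\<integral>v. h v \<partial>lborel) * maxwellian v)"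
proof -
  have h: "h \<in> L1" and Lh: "L1_eq (Lin h) (\<lambda>v. 0)" using assms by (auto simp: L1_ker_def)
  let ?u = "\<lambda>v. h v / maxwellian v"
  note [measurable] = L1_measurable[OF h]
  have um: "?u \<in> borel_measurable borel" by measurable
  obtain c where "AE v in lborel. ?u v = c"
    using translation_invariant_constant[OF um collision_invariant_translation_invariant[OF um kernel_collision_invariant[OF h Lh]]] by blast
  then have c: "AE v in lborel. h v = c * maxwellian v"
  proof eventually_elim
    case (elim v) then show ?case using maxwellian_pos[of v] by (simp add: field_simps)
  qed
  \<comment> \<open>The constant is the mass of \<open>h\<close>, as the Maxwellian has integral
    one.\<close>
  then have "(\<integral>v. h v \<partial>lborel) = (\<integral>v. c * maxwellian (v :: 'a) \<partial>lborel)" by (intro integral_cong_AE) auto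
  then show ?thesis using c by (simp add: integral_maxwellian L1_eq_def)
qed

end

section \<open>The decay estimate\<close>

text \<open>The hypotheses control \<open>b\<close> only on \<open>[-1, 1]\<close>, which contains all deviation cosines.\<close>
definition truncated_kernel :: "(real \<Rightarrow> real) \<Rightarrow> real \<Rightarrow> real" where
  "truncated_kernel b s = (if s \<in> {-1..1} then b s else 0)"

lemma cos_deviation_bounds:
  assumes "norm s = 1"
  shows "cos_deviation v w s \<in> {-1..1}"
proof -
  have "\<bar>cos_deviation v w s\<bar> \<le> norm ((v - w) /\<^sub>R norm (v - w)) * norm s"
    unfolding cos_deviation_def by (rule Cauchy_Schwarz_ineq2)
  also have "\<dots> \<le> 1" using assms by (cases "v = w") auto
  finally show ?thesis by auto
qed

lemma collision_kernel_truncated: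
  "norm s = 1 \<Longrightarrow> collision_kernel \<gamma> (truncated_kernel b) v w s = collision_kernel \<gamma> b v w s"
  using cos_deviation_bounds[of s v w] by (simp add: collision_kernel_def truncated_kernel_def)

lemma linear_boltzmann_truncated:
  "collision_frequency \<gamma> (truncated_kernel b) = (collision_frequency \<gamma> b :: 'a::euclidean_space \<Rightarrow> real)"
  "linear_boltzmann \<gamma> (truncated_kernel b) = (linear_boltzmann \<gamma> b :: ('a \<Rightarrow> real) \<Rightarrow> 'a \<Rightarrow> real)"
proof -
  show 1: "collision_frequency \<gamma> (truncated_kernel b) = (collision_frequency \<gamma> b :: 'a \<Rightarrow> real)"
    unfolding collision_frequency_def
    by (intro ext Bochner_Integration.integral_cong) (auto simp: collision_kernel_truncated space_pair_measure)
  have "gain \<gamma> (truncated_kernel b) = (gain \<gamma> b :: ('a \<Rightarrow> real) \<Rightarrow> 'a \<Rightarrow> real)"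
    unfolding gain_def
    by (intro ext Bochner_Integration.integral_cong) (auto simp: collision_kernel_truncated space_pair_measure)
  with 1 show "linear_boltzmann \<gamma> (truncated_kernel b) = (linear_boltzmann \<gamma> b :: ('a \<Rightarrow> real) \<Rightarrow> 'a \<Rightarrow> real)"
    by (simp add: linear_boltzmann_def fun_eq_iff)
qed

lemma collision_operator_truncated:
  fixes v0 w0 :: "'a::euclidean_space"
  assumes "DIM('a) \<ge> 2" "- real DIM('a) < \<gamma>" "\<gamma> < 0"
    and b: "b \<in> borel_measurable (restrict_space borel {-1..1})"
    and nn: "\<And>s. s \<in> {-1..1} \<Longrightarrow> 0 \<le> b s"
    and vw: "v0 \<noteq> w0" and fin: "angular_mass b v0 w0 < \<infinity>" and pos: "0 < angular_mass b v0 w0"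
  shows "collision_operator TYPE('a) \<gamma> (truncated_kernel b) (enn2real (angular_mass b v0 w0))"
proof
  have "(\<lambda>s. indicator {-1..1} s *\<^sub>R b s) \<in> borel_measurable borel"
    using b by (subst (asm) borel_measurable_restrict_space_iff) auto
  moreover have "(\<lambda>s. indicator {-1..1} s *\<^sub>R b s) = truncated_kernel b"
    by (auto simp: truncated_kernel_def fun_eq_iff)
  ultimately show m [measurable]: "truncated_kernel b \<in> borel_measurable borel" by simp
  show "0 \<le> truncated_kernel b s" for s using nn by (simp add: truncated_kernel_def)
  show "0 < enn2real (angular_mass b v0 w0)" using fin pos by (simp add: enn2real_positive_iff)
  fix e :: 'a assume e: "norm e = 1"
  let ?e = "(v0 - w0) /\<^sub>R norm (v0 - w0)"
  have "(\<integral>\<^sup>+s. ennreal (truncated_kernel b (e \<bullet> s)) \<partial>sphere_measure) = (\<integral>\<^sup>+s. ennreal (truncated_kernel b (?e \<bullet> s)) \<partial>sphere_measure)"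
    using e vw by (intro nn_integral_sphere_zonal) auto
  also have "\<dots> = angular_mass b v0 w0"
    unfolding angular_mass_def
  proof (rule nn_integral_cong)
    fix s :: 'a assume "s \<in> space sphere_measure"
    then show "ennreal (truncated_kernel b (?e \<bullet> s)) = ennreal (b (cos_deviation v0 w0 s))"
      using cos_deviation_bounds[of s v0 w0] by (simp add: truncated_kernel_def cos_deviation_def)
  qed
  finally show "(\<integral>\<^sup>+s. ennreal (truncated_kernel b (e \<bullet> s)) \<partial>sphere_measure) = ennreal (enn2real (angular_mass b v0 w0))"
    using fin by simp
qed fact+

context collision_operator
begin

lemma Sigma_max_bounds: "freq v \<le> Sigma_max TYPE('a) \<gamma> b" "0 < Sigma_max TYPE('a) \<gamma> b"
proof -
  obtain C where "\<And>v. freq v \<le> C" using freq_bound by blast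
  then have bdd: "bdd_above (range freq)" by (intro bdd_aboveI2)
  show le: "freq v \<le> Sigma_max TYPE('a) \<gamma> b" for v
    unfolding Sigma_max_def using bdd by (intro cSUP_upper) auto
  show "0 < Sigma_max TYPE('a) \<gamma> b" using freq_pos[of 0] le[of 0] by simp
qed

text \<open>Write \<open>f = h + Lin g\<close>. The range of \<open>Lin\<close> has zero mass, so
  \<open>h\<close> is the Maxwellian with the mass of \<open>f\<close>; it is fixed by the
  semigroup, and the deviation is \<open>V t (Lin g)\<close>. Contraction controls it for small
  times, the generator estimate for large ones.\<close>

lemma relaxation_estimate:
  assumes V: "C0_semigroup V" and gen: "generated_by V Lin" and f: "f \<in> L1_sum (L1_ker Lin) (L1_im Lin)"
  obtains D where "0 \<le> D"
    "\<And>t. 0 \<le> t \<Longrightarrow> L1_norm (\<lambda>v. V t f v - (\<integral>u. f u \<partial>lborel) * maxwellian v) \<le> D"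
    "\<And>t. 0 < t \<Longrightarrow> L1_norm (\<lambda>v. V t f v - (\<integral>u. f u \<partial>lborel) * maxwellian v) \<le> D / sqrt t"
proof -
  define S where "S = Sigma_max TYPE('a) \<gamma> b"
  have S: "0 < S" "\<And>v. freq v \<le> S" unfolding S_def by (rule Sigma_max_bounds)+
  note sg = V gen linear_boltzmann_bounded_linear S(1) euler_contraction[OF S]
  obtain h u where fL: "f \<in> L1" and h: "h \<in> L1_ker Lin" and u: "u \<in> L1_im Lin" and fhu: "L1_eq f (\<lambda>v. h v + u v)"
    using f by (auto simp: L1_sum_def)
  obtain g where uL: "u \<in> L1" and g: "g \<in> L1" and ug: "L1_eq u (Lin g)" using u by (auto simp: L1_im_def)
  have hL: "h \<in> L1" using h by (simp add: L1_ker_def)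
  have Lg: "Lin g \<in> L1" by (rule linear_boltzmann_L1[OF g])
  have "(\<integral>v. f v \<partial>lborel) = (\<integral>v. h v + Lin g v \<partial>lborel)"
  proof (rule integral_cong_AE)
    show "AE v in lborel. f v = h v + Lin g v"
      using fhu ug unfolding L1_eq_def by eventually_elim simp
  qed (use fL hL Lg in \<open>auto simp: L1_def\<close>)
  also have "\<dots> = (\<integral>v. h v \<partial>lborel)"
    using hL Lg integral_linear_boltzmann[OF g] by (simp add: L1_def Bochner_Integration.integral_add)
  finally have mass: "(\<integral>v. f v \<partial>lborel) = (\<integral>v. h v \<partial>lborel)" .
  have eq: "L1_norm (\<lambda>v. V t f v - (\<integral>u. f u \<partial>lborel) * maxwellian v) = L1_norm (V t (Lin g))" if t: "0 \<le> t" for t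
  proof (rule L1_norm_cong)
    have VT: "L1_bounded_linear (V t)" using V t by (auto simp: C0_semigroup_def)
    have VL: "F \<in> L1 \<Longrightarrow> V t F \<in> L1" for F using VT by (auto simp: L1_bounded_linear_def)
    show "V t (Lin g) \<in> L1" by (intro VL Lg)
    have "maxwellian \<in> (L1 :: ('a \<Rightarrow> real) set)" using integrable_maxwellian by (simp add: L1_def)
    then show "(\<lambda>v. V t f v - (\<integral>u. f u \<partial>lborel) * maxwellian v) \<in> L1" by (intro L1_intros VL fL)
    have "L1_eq (V t f) (V t (\<lambda>v. h v + u v))" by (intro L1_bounded_linear_cong[OF VT] fL L1_intros hL uL fhu)
    moreover have "L1_eq (V t (\<lambda>v. h v + u v)) (\<lambda>v. V t h v + V t u v)" by (rule L1_bounded_linear_add[OF VT hL uL])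
    moreover have "L1_eq (V t u) (V t (Lin g))" by (rule L1_bounded_linear_cong[OF VT uL Lg ug])
    moreover have "L1_eq (V t h) h" by (rule L1_semigroup_fixes_kernel[OF sg h t])
    moreover have "L1_eq h (\<lambda>v. (\<integral>v. h v \<partial>lborel) * maxwellian v)" by (rule kernel_eq_span_maxwellian[OF h])
    ultimately show "L1_eq (\<lambda>v. V t f v - (\<integral>u. f u \<partial>lborel) * maxwellian v) (V t (Lin g))"
      unfolding L1_eq_def mass by eventually_elim simp
  qed
  \<comment> \<open>The second entry is the constant left after splitting
    \<open>sqrt (S * t)\<close> into \<open>sqrt S * sqrt t\<close>.\<close>
  define D where "D = max (L1_norm (Lin g)) (S / sqrt S * L1_norm g)"
  show ?thesis
  proof
    show "0 \<le> D" unfolding D_def using L1_norm_nonneg[of "Lin g"] by simp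
    show "L1_norm (\<lambda>v. V t f v - (\<integral>u. f u \<partial>lborel) * maxwellian v) \<le> D" if "0 \<le> t" for t
      unfolding eq[OF that] D_def using L1_semigroup_contraction[OF sg Lg that] by simp
    show "L1_norm (\<lambda>v. V t f v - (\<integral>u. f u \<partial>lborel) * maxwellian v) \<le> D / sqrt t" if t: "0 < t" for t
    proof -
      have "L1_norm (V t (Lin g)) \<le> S / sqrt (S * t) * L1_norm g" by (rule L1_semigroup_generator_decay[OF sg g t])
      also have "\<dots> = (S / sqrt S * L1_norm g) / sqrt t" by (simp add: real_sqrt_mult)
      also have "\<dots> \<le> D / sqrt t" using t by (intro divide_right_mono) (auto simp: D_def)
      finally show ?thesis using eq[of t] t by simp
    qed
  qed
qed

end

text \<open>For \<open>t \<le> 1\<close> the power is at least \<open>1 / 2\<close>, which accounts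
  for the factor \<open>2\<close>. For \<open>t > 1\<close>, \<open>sqrt t\<close> is at least
  \<open>sqrt (1 + t) / 2\<close>. The summand \<open>1\<close> keeps the constant positive when
  \<open>D = 0\<close>.\<close>

lemma inverse_sqrt_decay_bound:
  fixes E :: "real \<Rightarrow> real"
  assumes D: "0 \<le> D" and E0: "\<And>t. 0 \<le> t \<Longrightarrow> E t \<le> D" and E1: "\<And>t. 0 < t \<Longrightarrow> E t \<le> D / sqrt t"
    and a: "0 < a" "a \<le> 1 / 2" and t: "0 \<le> t"
  shows "E t \<le> (2 * D + 1) * (1 + t) powr (- a)"
proof (cases "t \<le> 1")
  case True
  have "1 / 2 = 2 powr (- 1 :: real)" by (simp add: powr_minus_divide)
  also have "\<dots> \<le> 2 powr (- a)" using a by (intro powr_mono) auto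
  also have "\<dots> \<le> (1 + t) powr (- a)" using a t True by (intro powr_mono2') auto
  finally have h: "1 / 2 \<le> (1 + t) powr (- a)" .
  have "E t \<le> (2 * D + 1) * (1 / 2)" using E0[OF t] by simp
  also have "\<dots> \<le> (2 * D + 1) * (1 + t) powr (- a)" using h D by (intro mult_left_mono) auto
  finally show ?thesis .
next
  case False
  have "(1 + t) / 4 \<le> t" using False by simp
  then have "sqrt ((1 + t) / 4) \<le> sqrt t" by simp
  then have s: "sqrt (1 + t) / 2 \<le> sqrt t" by (simp add: real_sqrt_divide)
  have "E t \<le> D / sqrt t" using False by (intro E1) simp
  also have "\<dots> \<le> D / (sqrt (1 + t) / 2)" using s D False by (intro divide_left_mono) (auto intro!: mult_pos_pos)
  also have "\<dots> = 2 * D * (1 + t) powr (- (1 / 2))" using t by (simp add: powr_minus_divide powr_half_sqrt)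
  also have "\<dots> \<le> 2 * D * (1 + t) powr (- a)" using a t D by (intro mult_left_mono powr_mono) auto
  also have "\<dots> \<le> (2 * D + 1) * (1 + t) powr (- a)" by (intro mult_right_mono) auto
  finally show ?thesis .
qed

theorem theorem1p3:
  fixes \<gamma> :: real
    and b :: "real \<Rightarrow> real"
    and v0 w0 :: "'a::euclidean_space"
    and V :: "real \<Rightarrow> ('a \<Rightarrow> real) \<Rightarrow> ('a \<Rightarrow> real)"
    and f :: "'a \<Rightarrow> real"
  assumes "DIM('a) \<ge> 2"
    and "- real DIM('a) < \<gamma>" and "\<gamma> < 0"
    and "b \<in> borel_measurable (restrict_space borel {-1..1})"
    and "\<And>s. s \<in> {-1..1} \<Longrightarrow> 0 \<le> b s"
    and "v0 \<noteq> w0"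
    and "angular_mass b v0 w0 < \<infinity>" and "0 < angular_mass b v0 w0"
    and "C0_semigroup V"
    and "generated_by V (linear_boltzmann \<gamma> b)"
    and "f \<in> L1_sum (L1_ker (linear_boltzmann \<gamma> b)) (L1_im (linear_boltzmann \<gamma> b))"
    and "AE v in lborel. 0 \<le> f v"
  shows "strict_antimono_on {0<..} (vartheta_log (Sigma_max TYPE('a) \<gamma> b))
    \<and> (\<forall>c\<in>{0<..<1}.
        (\<lambda>t. L1_norm (\<lambda>v. V t f v - (\<integral>u. f u \<partial>lborel) * maxwellian v))
          \<in> O[at_top](\<lambda>t. vartheta_log_inv (Sigma_max TYPE('a) \<gamma> b) (c * t)))
    \<and> (\<forall>\<epsilon>>0. \<exists>C>0. \<forall>t\<ge>0.
        L1_norm (\<lambda>v. V t f v - (\<integral>u. f u \<partial>lborel) * maxwellian v)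
          \<le> C * (1 + t) powr (- (1 / (3 + \<epsilon>))))"
proof -
  interpret collision_operator \<gamma> "truncated_kernel b" "enn2real (angular_mass b v0 w0)" "TYPE('a)"
    by (rule collision_operator_truncated) fact+
  have Smax: "Sigma_max TYPE('a) \<gamma> (truncated_kernel b) = Sigma_max TYPE('a) \<gamma> b"
    by (simp add: Sigma_max_def linear_boltzmann_truncated(1))
  define S where "S = Sigma_max TYPE('a) \<gamma> b"
  have S: "0 < S" using Sigma_max_bounds(2) by (simp add: S_def Smax)
  define E where "E t = L1_norm (\<lambda>v. V t f v - (\<integral>u. f u \<partial>lborel) * maxwellian v)" for t
  have E: "0 \<le> E t" for t unfolding E_def by (rule L1_norm_nonneg)
  obtain D where D: "0 \<le> D" "\<And>t. 0 \<le> t \<Longrightarrow> E t \<le> D" "\<And>t. 0 < t \<Longrightarrow> E t \<le> D / sqrt t"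
    using relaxation_estimate[OF assms(9)] assms(10,11) unfolding linear_boltzmann_truncated(2) E_def by metis
  have "E \<in> O[at_top](\<lambda>t. vartheta_log_inv S (c * t))" if c: "c \<in> {0<..<1}" for c
  proof -
    obtain K where K: "0 < K" "\<And>t. 1 \<le> t \<Longrightarrow> K / sqrt t \<le> vartheta_log_inv S (c * t)"
      using vartheta_log_inv_ge[OF S, of c] c by auto
    show ?thesis
    \<comment> \<open>The constant compares \<open>D / sqrt t\<close> with the lower bound
      \<open>K / sqrt t\<close> of the inverse function.\<close>
    proof (rule bigoI[where c = "D / K"], rule eventually_at_top_linorderI[of 1])
      fix t :: real assume t: "1 \<le> t"
      have "norm (E t) \<le> D / K * (K / sqrt t)" using D(3)[of t] t E[of t] K(1) by simp
      also have "\<dots> \<le> D / K * norm (vartheta_log_inv S (c * t))"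
        using K(2)[OF t] K(1) D(1) by (intro mult_left_mono) auto
      finally show "norm (E t) \<le> D / K * norm (vartheta_log_inv S (c * t))" .
    qed
  qed
  moreover have "\<exists>C>0. \<forall>t\<ge>0. E t \<le> C * (1 + t) powr (- (1 / (3 + \<epsilon>)))" if "0 < \<epsilon>" for \<epsilon>
  proof (intro exI[of _ "2 * D + 1"] conjI allI impI)
    show "0 < 2 * D + 1" using D(1) by simp
    show "E t \<le> (2 * D + 1) * (1 + t) powr (- (1 / (3 + \<epsilon>)))" if "0 \<le> t" for t
      \<comment> \<open>The exponent \<open>1 / (3 + \<epsilon>)\<close> is positive and below
        \<open>1 / 2\<close>.\<close>
      by (rule inverse_sqrt_decay_bound[OF D]) (use that \<open>0 < \<epsilon>\<close> in \<open>auto simp: field_simps\<close>)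
  qed
  ultimately show ?thesis
    using vartheta_log_strict_antimono[OF S] unfolding E_def[abs_def] S_def by blast
qed

end
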